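(* For all compactly supported smooth differential forms $\varphi$ of bidegree $(n-1,n-1)$ on the unit ball $\mathbb B_n\subset\mathbb C^n$ and all $\delta>0$, there exist $c>0$ and $L_0=L_0(\varphi,\delta,n)$ such that for all $L\ge L_0$, \[ \mathbb P\left[\,|I_L(\varphi)-\mathbb E(I_L(\varphi))|>\delta\,\mathbb E(I_L(\varphi))\right]\le e^{-cL^{n+1}} , \] where $I_L(\varphi)=\int_{Z_{f_L}}\varphi$ and $f_L$ is the hyperbolic Gaussian analytic function of intensity $L$.
   Context: $\mathbb B_n$ is the open unit ball of $\mathbb C^n$ and $\omega=\frac{i}{2\pi}\partial\bar\partial\log\frac{1}{1-|z|^2}$. For real $L>0$, the hyperbolic Gaussian analytic function of intensity $L$ is the random holomorphic function \[ f_L(z)=\sum_{\alpha} a_\alpha\left(\frac{\Gamma(L+|\alpha|)}{\alpha!\,\Gamma(L)}\right)^{1/2}z^\alpha,\qquad z\in\mathbb B_n, \] where $\alpha$ ranges over multi-indices in $\mathbb Z_{\ge0}^n$ and the $a_\alpha$ are i.i.d. complex Gaussians of mean $0$ and variance $1$. Its covariance kernel is $K_L(z,w)=\mathbb E[f_L(z)\overline{f_L(w)}]=(1-z\cdot\bar w)^{-L}$. $Z_{f_L}$ is the zero set of $f_L$, and $[Z_{f_L}]=\frac{i}{2\pi}\partial\bar\partial\log|f_L|^2$ is its integration current. By definition $I_L(\varphi)=\int_{Z_{f_L}}\varphi=\int_{\mathbb B_n}\varphi\wedge[Z_{f_L}]$. One has $\mathbb E[I_L(\varphi)]=L\int_{\mathbb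 B_n}\varphi\wedge\omega$.
   Formalization: It is assumed that the integral of φ∧ω over the ball is nonzero, and the deviation is compared with δ|E(I_L(φ))| instead of δE(I_L(φ)); the literal claim fails when the mean is negative and, in general, when it is zero. *)

theory Defs
  imports "HOL-Probability.Probability"
begin

section \<open>Smooth functions and differential forms on \<open>\<complex>\<^sup>n\<close>\<close>

text \<open>\<open>C\<^sup>k\<close> for functions on a Euclidean space: all directional derivatives of order at most
  \<open>k\<close> exist (as Frechet derivatives) and are continuous.\<close>

primrec Ck :: "nat \<Rightarrow> ('a::euclidean_space \<Rightarrow> 'b::real_normed_vector) \<Rightarrow> bool" where
  "Ck 0 f = continuous_on UNIV f"
| "Ck (Suc k) f =
     ((\<forall>x. f differentiable (at x)) \<and> (\<forall>v. Ck k (\<lambda>x. frechet_derivative f (at x) v)))"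

definition smooth :: "('a::euclidean_space \<Rightarrow> 'b::real_normed_vector) \<Rightarrow> bool" where
  "smooth f \<longleftrightarrow> (\<forall>k. Ck k f)"

text \<open>A complex differential form on \<open>\<complex>\<^sup>n\<close> is given by its coefficients: \<open>\<phi> z I J\<close> is the
  coefficient at \<open>z\<close> of \<open>dz\<^sub>I \<and> dzbar\<^sub>J\<close> (\<open>dzbar\<close> being the conjugate of \<open>dz\<close>), where the factors of
  \<open>dz\<^sub>I\<close> and of \<open>dzbar\<^sub>J\<close> are wedged in increasing order of the index. The linear
  order on the index type is only used to fix this basis.\<close>

type_synonym 'n form = "complex ^ 'n \<Rightarrow> 'n set \<Rightarrow> 'n set \<Rightarrow> complex"

definition smooth_form :: "'n::finite form \<Rightarrow> bool" where
  "smooth_form \<phi> \<longleftrightarrow> (\<forall>I J. smooth (\<lambda>z. \<phi> z I J))"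

definition of_bidegree :: "nat \<Rightarrow> nat \<Rightarrow> 'n::finite form \<Rightarrow> bool" where
  "of_bidegree p q \<phi> \<longleftrightarrow> (\<forall>z I J. \<phi> z I J \<noteq> 0 \<longrightarrow> card I = p \<and> card J = q)"

definition compactly_supported_in :: "(complex ^ 'n) set \<Rightarrow> 'n::finite form \<Rightarrow> bool" where
  "compactly_supported_in U \<phi> \<longleftrightarrow>
     (\<exists>K. compact K \<and> K \<subseteq> U \<and> (\<forall>z. z \<notin> K \<longrightarrow> (\<forall>I J. \<phi> z I J = 0)))"

text \<open>For disjoint \<open>A\<close> and \<open>B\<close>: \<open>dz\<^sub>A \<and> dz\<^sub>B = shuffle_sign A B \<cdot> dz\<^bsub>A \<union> B\<^esub>\<close>.\<close>

definition shuffle_sign :: "'n::{finite,linorder} set \<Rightarrow> 'n set \<Rightarrow> complex" where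
  "shuffle_sign A B = (- 1) ^ card {(a, b). a \<in> A \<and> b \<in> B \<and> b < a}"

text \<open>The sign \<open>(- 1) ^ (card J1 * card I2)\<close> comes from moving \<open>dz\<close> with index \<open>I2\<close> across the
  conjugate factors with index \<open>J1\<close>; here \<open>I2 = I - I1\<close> and \<open>J2 = J - J1\<close>.\<close>

definition wedge :: "'n::{finite,linorder} form \<Rightarrow> 'n form \<Rightarrow> 'n form" where
  "wedge \<phi> \<psi> = (\<lambda>z I J. \<Sum>I1\<in>Pow I. \<Sum>J1\<in>Pow J.
     (- 1) ^ (card J1 * card (I - I1)) * shuffle_sign I1 (I - I1) * shuffle_sign J1 (J - J1)
       * \<phi> z I1 J1 * \<psi> z (I - I1) (J - J1))"

definition scalar_form :: "(complex ^ 'n \<Rightarrow> complex) \<Rightarrow> 'n::finite form" where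
  "scalar_form u = (\<lambda>z I J. if I = {} \<and> J = {} then u z else 0)"

text \<open>Wirtinger derivatives: \<open>\<partial>/\<partial>z\<^sub>j = (\<partial>/\<partial>x\<^sub>j - i \<partial>/\<partial>y\<^sub>j) / 2\<close> and its conjugate.\<close>

definition wirt :: "'n::finite \<Rightarrow> (complex ^ 'n \<Rightarrow> complex) \<Rightarrow> complex ^ 'n \<Rightarrow> complex" where
  "wirt j g z = (frechet_derivative g (at z) (axis j 1)
                 - \<i> * frechet_derivative g (at z) (axis j \<i>)) / 2"

definition wirt_bar :: "'n::finite \<Rightarrow> (complex ^ 'n \<Rightarrow> complex) \<Rightarrow> complex ^ 'n \<Rightarrow> complex" where
  "wirt_bar j g z = (frechet_derivative g (at z) (axis j 1)
                     + \<i> * frechet_derivative g (at z) (axis j \<i>)) / 2"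

definition del :: "'n::{finite,linorder} form \<Rightarrow> 'n form" where
  "del \<phi> = (\<lambda>z I J. \<Sum>j\<in>I. shuffle_sign {j} (I - {j}) * wirt j (\<lambda>w. \<phi> w (I - {j}) J) z)"

text \<open>The sign \<open>(- 1) ^ card I\<close> comes from moving the new conjugate factor across \<open>dz\<^sub>I\<close>.\<close>

definition delbar :: "'n::{finite,linorder} form \<Rightarrow> 'n form" where
  "delbar \<phi> = (\<lambda>z I J. \<Sum>j\<in>J.
     (- 1) ^ card I * shuffle_sign {j} (J - {j}) * wirt_bar j (\<lambda>w. \<phi> w I (J - {j})) z)"

text \<open>Integral of the top-degree component with respect to the standard orientation of \<open>\<complex>\<^sup>n\<close>,
  for which the product of the \<open>(i/2) dz\<^sub>j \<and> dzbar\<^sub>j\<close> is Lebesgue measure. Sorting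
  \<open>dz\<^sub>1 \<and> \<dots> \<and> dz\<^sub>n\<close> and its conjugate into these pairs costs \<open>(-1) ^ (n(n-1)/2)\<close>.\<close>

definition form_integral :: "(complex ^ 'n::{finite,linorder}) set \<Rightarrow> 'n form \<Rightarrow> complex" where
  "form_integral U \<phi> =
     (- 1) ^ (CARD('n) * (CARD('n) - 1) div 2) * (- 2 * \<i>) ^ CARD('n)
       * (LINT z:U|lborel. \<phi> z UNIV UNIV)"


section \<open>The invariant form and the integration current of a zero set\<close>

abbreviation unit_ball :: "(complex ^ 'n::finite) set" where
  "unit_ball \<equiv> ball 0 1"

definition bergman_form :: "'n::{finite,linorder} form" where
  "bergman_form = (\<lambda>z I J. \<i> / (2 * of_real pi)
     * del (delbar (scalar_form (\<lambda>w. of_real (ln (1 / (1 - (norm w)\<^sup>2)))))) z I J)"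

text \<open>The current \<open>del delbar u\<close> on \<open>U\<close> is taken in the sense of distributions: its value on a test form
  \<open>\<phi>\<close> of bidegree \<open>(n-1,n-1)\<close> is the integral of \<open>u del delbar \<phi>\<close>.\<close>

definition ddbar_current ::
  "(complex ^ 'n::{finite,linorder}) set \<Rightarrow> (complex ^ 'n::{finite,linorder} \<Rightarrow> real) \<Rightarrow> 'n form \<Rightarrow> complex" where
  "ddbar_current U u \<phi> = form_integral U (\<lambda>z I J. of_real (u z) * del (delbar \<phi>) z I J)"

text \<open>The current \<open>[Z\<^sub>f] = (i/2\<pi>) del delbar log |f|\<^sup>2\<close> of integration over the zero set of \<open>f\<close> in the
  unit ball, counted with multiplicity. The value \<open>ln 0 = 0\<close> on the zero set itself plays no
  role, as this is a null set unless \<open>f\<close> vanishes identically.\<close>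

definition zero_current :: "(complex ^ 'n::{finite,linorder} \<Rightarrow> complex) \<Rightarrow> 'n form \<Rightarrow> complex" where
  "zero_current f \<phi> =
     \<i> / (2 * of_real pi) * ddbar_current unit_ball (\<lambda>z. ln ((cmod (f z))\<^sup>2)) \<phi>"


section \<open>Hyperbolic Gaussian analytic functions\<close>

text \<open>A standard complex Gaussian has density \<open>exp (- |z|\<^sup>2) / \<pi>\<close>; it has mean \<open>0\<close> and
  \<open>E|a|\<^sup>2 = 1\<close>. Multi-indices are functions \<open>'n \<Rightarrow> nat\<close>.\<close>

definition iid_complex_gaussians :: "'w measure \<Rightarrow> ('i \<Rightarrow> 'w \<Rightarrow> complex) \<Rightarrow> bool" where
  "iid_complex_gaussians M a \<longleftrightarrow>
     (\<forall>\<alpha>. distributed M lborel (a \<alpha>) (\<lambda>z. ennreal (exp (- (cmod z)\<^sup>2) / pi))) \<and>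
     prob_space.indep_vars M (\<lambda>_. borel) a UNIV"

definition hyperbolic_series :: "real \<Rightarrow> (('n::finite \<Rightarrow> nat) \<Rightarrow> complex) \<Rightarrow> complex ^ 'n \<Rightarrow> complex" where
  "hyperbolic_series L c z = (\<Sum>\<^sub>\<infinity>\<alpha>. c \<alpha>
     * of_real (sqrt (Gamma (L + real (\<Sum>j\<in>UNIV. \<alpha> j)) / ((\<Prod>j\<in>UNIV. fact (\<alpha> j)) * Gamma L)))
     * (\<Prod>j\<in>UNIV. (z $ j) ^ \<alpha> j))"

definition hyperbolic_GAF ::
  "real \<Rightarrow> (('n::finite \<Rightarrow> nat) \<Rightarrow> 'w \<Rightarrow> complex) \<Rightarrow> 'w \<Rightarrow> complex ^ 'n \<Rightarrow> complex" where
  "hyperbolic_GAF L a x = hyperbolic_series L (\<lambda>\<alpha>. a \<alpha> x)"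

text \<open>The linear statistic \<open>I\<^sub>L(\<phi>)\<close>, as a complex random variable.\<close>

definition lin_stat ::
  "real \<Rightarrow> (('n::{finite,linorder} \<Rightarrow> nat) \<Rightarrow> 'w \<Rightarrow> complex) \<Rightarrow> 'n form \<Rightarrow> 'w \<Rightarrow> complex" where
  "lin_stat L a \<phi> x = zero_current (hyperbolic_GAF L a x) \<phi>"

end

theory Submission
  imports Defs "HOL-Complex_Analysis.Complex_Analysis" "HOL-Real_Asymp.Real_Asymp"
begin

text \<open>Let \<open>\<psi>(z) = - ln (1 - |z|\<^sup>2)\<close> and \<open>v = ln |f|\<^sup>2 - L \<psi>\<close>. Integrating by parts, \<open>I(\<phi>)\<close> differs from
  \<open>L\<close> times the integral of \<open>\<phi> \<and> \<omega>\<close> by the integral of \<open>v\<close> against a continuous density with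
  support in a compact set \<open>K\<close>, so it suffices that the \<open>L\<^sup>1\<close> norm of \<open>v\<close> on \<open>K\<close> is at most a small
  multiple of \<open>L\<close>, outside an event of probability \<open>exp (- c L\<^bsup>n+1\<^esup>)\<close> and in the mean.

  Upper bound: if every coefficient satisfies \<open>|a\<^sub>\<alpha>| \<le> E s\<^bsup>|\<alpha>|\<^esup>\<close> with \<open>s > 1\<close> close to 1 and \<open>E = exp (\<epsilon> L / 2)\<close>,
  then \<open>v \<le> 3 \<epsilon> L\<close>; the exceptional probability is doubly exponentially small. Lower bound at some
  point near a given \<open>w\<close>: let \<open>\<alpha>\<^sub>0\<close> be the index of a dominant term of the series of the covariance
  kernel at \<open>w\<close>. Interpolating \<open>f(z) z\<^bsup>-\<alpha>\<^sub>0\<^esup>\<close> at \<open>(m+1)\<^sup>n\<close> nodes close to \<open>w\<close>, with \<open>m\<close> a small multiple of \<open>L\<close>,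
  recovers the coefficients with index in \<open>\<alpha>\<^sub>0 + {0..m}\<^sup>n\<close> up to an independent error. If \<open>f\<close> is small at
  all nodes, each of these independent Gaussians lies in a disc of exponentially small radius,
  which has probability at most \<open>exp (- c L (m+1)\<^sup>n)\<close>. The submean value property turns the
  lower bound at single points into a bound of the \<open>L\<^sup>1\<close> norm of \<open>v\<close> on small balls covering \<open>K\<close>. For the mean,
  the contribution of the exceptional event is controlled by the second moment of \<open>v\<close>, which is
  at most exponential in \<open>L\<close>.\<close>

text \<open>The exponent n + 1 arises because about L^n independent coefficients must be small at
  once, each at a cost exp (- c L). Smallness of f at the nodes constrains a coefficient only
  relative to its weight \<open>sqrt (hcoef L \<alpha>)\<close>. Starting the box at the dominant
  index settles this, as \<open>hcoef\<close> only grows in the directions of the box; and since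
  that index has degree O(L), passing from w to nearby nodes costs only a small exponential. The
  estimate is made at w itself, without an automorphism of the ball moving w to the origin, where
  the dominant index would be 0. The tolerance must be fixed before the radius of the covering
  balls, which depends on it through the continuity of \<psi>; so the total volume of the cover must
  be bounded independently of that radius. The mean is not computed but compared with L times the
  integral of \<phi> \<and> \<omega>, as is the statistic itself. The moment estimates hold with the
  value 0 that \<open>infsum\<close> gives to a divergent series, so they do not presuppose
  convergence.\<close>

section \<open>The submean value property of the logarithm\<close>

(* By uniqueness of Haar measure: compare both sides after convolving with the indicator of the unit ball, which the isometry preserves. *)
lemma nn_integral_lborel_linear_isometry:
  fixes T :: "'a::euclidean_space \<Rightarrow> 'a" and f :: "'a \<Rightarrow> ennreal"
  assumes T: "linear T" "\<And>x. norm (T x) = norm x" and [measurable]: "f \<in> borel_measurable borel"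
  shows "(\<integral>\<^sup>+x. f (T x) \<partial>lborel) = (\<integral>\<^sup>+x. f x \<partial>lborel)"
proof -
  define g :: "'a \<Rightarrow> ennreal" where "g = indicator (ball 0 1)"
  have [measurable]: "g \<in> borel_measurable borel" unfolding g_def by (intro borel_measurable_indicator) simp
  have [measurable]: "T \<in> borel_measurable borel"
    by (intro borel_measurable_continuous_onI linear_continuous_on linear_conv_bounded_linear[THEN iffD1] T)
  have "inj T"
    using T by (metis linear_injective_0 norm_eq_zero)
  then have surj: "surj T" by (rule linear_injective_imp_surjective[OF T(1)]) simp
  have shift: "(\<integral>\<^sup>+x. h (c + x) \<partial>lborel) = (\<integral>\<^sup>+x. h x \<partial>lborel)"
    if [measurable]: "h \<in> borel_measurable borel" for h :: "'a \<Rightarrow> ennreal" and c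
    using nn_integral_distr[of "(+) c" lborel borel h] by (simp add: lborel_distr_plus)
  have g_sym: "g (- x) = g x" for x by (simp add: g_def indicator_def)
  have g_T: "g (T x) = g x" for x by (simp add: g_def indicator_def T)
  have inner: "(\<integral>\<^sup>+x. g (y - T x) \<partial>lborel) = (\<integral>\<^sup>+x. g x \<partial>lborel)" for y
  proof -
    obtain b where b: "y = T b" using surj by auto
    have "g (y - T x) = g (- b + x)" for x
      using g_T[of "b - x"] g_sym[of "b - x"] by (simp add: b linear_diff[OF T(1)])
    then show ?thesis using shift[of g "- b"] by simp
  qed
  have "(\<integral>\<^sup>+y. g y \<partial>lborel) * (\<integral>\<^sup>+x. f (T x) \<partial>lborel)
      = (\<integral>\<^sup>+y. (\<integral>\<^sup>+x. g y * f (T x) \<partial>lborel) \<partial>lborel)"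
    by (simp add: nn_integral_cmult nn_integral_multc)
  also have "\<dots> = (\<integral>\<^sup>+y. (\<integral>\<^sup>+x. g y * f (T x + y) \<partial>lborel) \<partial>lborel)"
  proof (rule nn_integral_cong)
    fix y obtain b where b: "y = T b" using surj by auto
    have "(\<integral>\<^sup>+x. g y * f (T (b + x)) \<partial>lborel) = (\<integral>\<^sup>+x. g y * f (T x) \<partial>lborel)"
      by (rule shift) measurable
    then show "(\<integral>\<^sup>+x. g y * f (T x) \<partial>lborel) = (\<integral>\<^sup>+x. g y * f (T x + y) \<partial>lborel)"
      by (simp add: b linear_add[OF T(1)] add.commute)
  qed
  also have "\<dots> = (\<integral>\<^sup>+x. (\<integral>\<^sup>+y. g y * f (T x + y) \<partial>lborel) \<partial>lborel)"
    by (rule lborel_pair.Fubini') measurable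
  also have "\<dots> = (\<integral>\<^sup>+x. (\<integral>\<^sup>+y. g (y - T x) * f y \<partial>lborel) \<partial>lborel)"
  proof (rule nn_integral_cong)
    fix x
    have "(\<integral>\<^sup>+y. g (T x + y - T x) * f (T x + y) \<partial>lborel) = (\<integral>\<^sup>+y. g (y - T x) * f y \<partial>lborel)"
      by (rule shift) measurable
    then show "(\<integral>\<^sup>+y. g y * f (T x + y) \<partial>lborel) = (\<integral>\<^sup>+y. g (y - T x) * f y \<partial>lborel)" by simp
  qed
  also have "\<dots> = (\<integral>\<^sup>+y. (\<integral>\<^sup>+x. g (y - T x) * f y \<partial>lborel) \<partial>lborel)"
    by (rule lborel_pair.Fubini'[symmetric]) measurable
  also have "\<dots> = (\<integral>\<^sup>+y. g y \<partial>lborel) * (\<integral>\<^sup>+x. f x \<partial>lborel)"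
    by (simp add: nn_integral_multc inner nn_integral_cmult)
  finally have eq: "(\<integral>\<^sup>+y. g y \<partial>lborel) * (\<integral>\<^sup>+x. f (T x) \<partial>lborel)
      = (\<integral>\<^sup>+y. g y \<partial>lborel) * (\<integral>\<^sup>+x. f x \<partial>lborel)" .
  have g_int: "(\<integral>\<^sup>+y. g y \<partial>lborel) = emeasure lborel (ball (0::'a) 1)"
    by (simp add: g_def)
  have "emeasure lborel (ball (0::'a) 1) \<noteq> \<infinity>"
    using emeasure_bounded_finite[of "ball (0::'a) 1"] by auto
  moreover have "emeasure lborel (ball (0::'a) 1) \<noteq> 0"
    using content_ball_pos[of 1 "0::'a"] by (auto simp: measure_def)
  ultimately show ?thesis
    using eq by (simp add: g_int ennreal_mult_cancel_left)
qed

lemma lborel_distr_linear_isometry: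
  fixes T :: "'a::euclidean_space \<Rightarrow> 'a"
  assumes T: "linear T" "\<And>x. norm (T x) = norm x"
  shows "distr lborel borel T = lborel"
proof (rule measure_eqI)
  fix A assume "A \<in> sets (distr lborel borel T)"
  then have A [measurable]: "A \<in> sets borel" by simp
  have [measurable]: "T \<in> borel_measurable borel"
    by (intro borel_measurable_continuous_onI linear_continuous_on linear_conv_bounded_linear[THEN iffD1] T)
  have "emeasure (distr lborel borel T) A = (\<integral>\<^sup>+x. indicator A x \<partial>distr lborel borel T)" by simp
  also have "\<dots> = (\<integral>\<^sup>+x. indicator A (T x) \<partial>lborel)" by (subst nn_integral_distr) auto
  also have "\<dots> = (\<integral>\<^sup>+x. indicator A x \<partial>lborel)"
    by (rule nn_integral_lborel_linear_isometry[OF T]) measurable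
  finally show "emeasure (distr lborel borel T) A = emeasure lborel A" by simp
qed simp

lemma norm_vector_smult:
  fixes x :: "'a::real_normed_field ^ 'n"
  shows "norm (c *s x) = norm c * norm x"
  by (simp add: norm_vec_def norm_mult L2_set_right_distrib)

lemma linear_vector_smult: "linear (\<lambda>x :: complex ^ 'n. c *s x)"
  by (intro linearI) (auto simp: vec_eq_iff algebra_simps)

text \<open>Round the argument of t down to a multiple of \<open>2 * pi / N\<close>; a chord is no
  longer than its arc.\<close>

lemma roots_of_unity_dense:
  fixes t :: complex and N :: nat
  assumes "cmod t = 1" "N > 0"
  obtains r where "r ^ N = 1" "cmod (t - r) \<le> 2 * pi / N"
proof -
  obtain a where a: "t = cis a" "0 \<le> a" "a < 2 * pi"
  proof -
    have "t = cis (Arg2pi t)" using assms(1) complex_norm_eq_1_exp[of t] by (simp add: cis_conv_exp)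
    then show ?thesis using that Arg2pi_ge_0 Arg2pi_lt_2pi by blast
  qed
  define j where "j = nat \<lfloor>a * N / (2 * pi)\<rfloor>"
  define b where "b = 2 * pi * j / N"
  have j: "real j \<le> a * N / (2 * pi)" "a * N / (2 * pi) < real j + 1"
    using a by (auto simp: j_def)
  have "b \<le> a" "a \<le> b + 2 * pi / N"
    using j assms(2) pi_gt_zero by (auto simp: b_def field_simps)
  have "cmod (cis a - cis b) \<le> \<bar>a - b\<bar>"
  proof -
    have "cis a - cis b = cis b * (exp (\<i> * of_real (a - b)) - 1)"
      by (simp add: right_diff_distrib cis_mult flip: cis_conv_exp del: of_real_diff)
    then show ?thesis
      using dist_exp_i_1[of "a - b"] abs_sin_x_le_abs_x[of "(a - b) / 2"]
      by (simp add: norm_mult)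
  qed
  moreover have "cis b ^ N = 1"
    using assms(2) cis_multiple_2pi[of "real j"] by (simp add: b_def Complex.DeMoivre mult_ac)
  ultimately show ?thesis
    using that[of "cis b"] \<open>b \<le> a\<close> \<open>a \<le> b + 2 * pi / N\<close> a(1) by force
qed

text \<open>The mean over a circle is replaced by the mean over the N-th roots of unity, so that
  only the maximum principle is needed. The product of f(z0 + r t y) over all roots r is holomorphic
  in t with value \<open>f z0 ^ N\<close> at 0, hence at least as large in modulus at some t0 on the
  unit circle. Integrating over y in the ball, which rotations preserve, gives the volume integral.
  The floor e keeps the logarithm continuous across the zeros of f.\<close>

lemma submean_ln_ball:
  fixes f :: "complex ^ 'n::finite \<Rightarrow> complex"
  assumes cont: "continuous_on (cball z0 \<rho>) f" and "\<rho> > 0" and "e > 0" and nz: "f z0 \<noteq> 0"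
    and hol: "\<And>y. norm y \<le> \<rho> \<Longrightarrow> (\<lambda>t. f (z0 + t *s y)) holomorphic_on ball 0 1"
  shows "measure lborel (ball z0 \<rho>) * ln (cmod (f z0))
         \<le> (LINT z:ball z0 \<rho>|lborel. ln (max (cmod (f z)) e))"
proof -
  define F where "F y = ln (max (cmod (f (z0 + y))) e)" for y
  define G where "G y = indicator (ball 0 \<rho>) y * F y" for y
  have cont_F: "continuous_on (cball 0 \<rho>) F"
    unfolding F_def using \<open>e > 0\<close>
    by (intro continuous_intros continuous_on_compose2[OF cont]) (auto simp: dist_norm max_def)
  have G_int: "integrable lborel G"
  proof -
    have "set_integrable lborel (cball 0 \<rho>) F"
      using borel_integrable_compact[of "cball 0 \<rho>" F] cont_F by (simp add: set_integrable_def)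
    then have "set_integrable lborel (ball 0 \<rho>) F"
      by (rule set_integrable_subset) auto
    then show ?thesis by (simp add: set_integrable_def G_def[abs_def])
  qed
  have G_rot: "(\<integral>y. G (r *s y) \<partial>lborel) = (\<integral>y. G y \<partial>lborel)" "integrable lborel (\<lambda>y. G (r *s y))"
    if "cmod r = 1" for r
  proof -
    have d: "distr lborel borel (\<lambda>y :: complex ^ 'n. r *s y) = lborel"
      using that by (intro lborel_distr_linear_isometry linear_vector_smult) (auto simp: norm_vector_smult)
    have m: "(\<lambda>y :: complex ^ 'n. r *s y) \<in> borel_measurable borel"
      by (intro borel_measurable_continuous_onI linear_continuous_on linear_conv_bounded_linear[THEN iffD1] linear_vector_smult)
    have Gm: "G \<in> borel_measurable borel" using G_int by auto
    show "(\<integral>y. G (r *s y) \<partial>lborel) = (\<integral>y. G y \<partial>lborel)"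
      using integral_distr[of "\<lambda>y. r *s y" lborel borel G] m Gm by (simp add: d)
    show "integrable lborel (\<lambda>y. G (r *s y))"
      using integrable_distr_eq[of "\<lambda>y. r *s y" lborel borel G] m Gm G_int by (simp add: d)
  qed
  have vol: "measure lborel (ball z0 \<rho>) = measure lborel (ball (0 :: complex ^ 'n) \<rho>)"
    by (simp add: content_ball_conv_unit_ball[OF less_imp_le[OF \<open>\<rho> > 0\<close>], of z0]
        content_ball_conv_unit_ball[OF less_imp_le[OF \<open>\<rho> > 0\<close>], of 0])
  have G_eq: "(LINT z:ball z0 \<rho>|lborel. ln (max (cmod (f z)) e)) = (\<integral>y. G y \<partial>lborel)"
  proof -
    have "(LINT z:ball z0 \<rho>|lborel. ln (max (cmod (f z)) e)) = (\<integral>z. G (- z0 + z) \<partial>lborel)"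
      unfolding set_lebesgue_integral_def
      by (intro Bochner_Integration.integral_cong) (auto simp: G_def F_def indicator_def dist_norm norm_minus_commute)
    also have "\<dots> = (\<integral>y. G y \<partial>lborel)"
      using integral_distr[of "(+) (- z0)" lborel borel G] G_int by (simp add: lborel_distr_plus)
    finally show ?thesis .
  qed
  have approx: "measure lborel (ball z0 \<rho>) * (ln (cmod (f z0)) - \<eta>) \<le> (\<integral>y. G y \<partial>lborel)"
    if "\<eta> > 0" for \<eta>
  proof -
    have "uniformly_continuous_on (cball 0 \<rho>) F"
      by (intro compact_uniformly_continuous cont_F) auto
    then obtain d where d: "d > 0"
      "\<And>x y. x \<in> cball 0 \<rho> \<Longrightarrow> y \<in> cball 0 \<rho> \<Longrightarrow> dist y x < d \<Longrightarrow> dist (F y) (F x) < \<eta>"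
      using \<open>\<eta> > 0\<close> unfolding uniformly_continuous_on_def by metis
    \<comment> \<open>\<open>2 * pi * \<rho> / N\<close> bounds how far a point of the ball moves
      when t0 is replaced by a root of unity close to it.\<close>
    obtain N :: nat where N: "N > 0" "2 * pi * \<rho> / N < d"
    proof -
      obtain N :: nat where "2 * pi * \<rho> / d < N" using reals_Archimedean2 by blast
      moreover from this have "N > 0" using \<open>\<rho> > 0\<close> \<open>d > 0\<close> pi_gt_zero
        by (metis divide_pos_pos mult_pos_pos of_nat_0_less_iff order_less_trans zero_less_numeral)
      ultimately show ?thesis using that \<open>d > 0\<close> by (simp add: field_simps)
    qed
    define S where "S = {r :: complex. r ^ N = 1}"
    have S: "finite S" "card S = N"
      using N(1) card_roots_unity_eq[of N] finite_roots_unity[of N] by (auto simp: S_def)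
    have S_norm: "cmod r = 1" if "r \<in> S" for r
      using that N(1) by (metis (mono_tags) S_def mem_Collect_eq norm_one norm_power power_eq_1_iff norm_ge_zero less_not_refl)
    have point: "N * (ln (cmod (f z0)) - \<eta>) \<le> (\<Sum>r\<in>S. F (r *s y))" if y: "norm y \<le> \<rho>" for y
    proof -
      define h where "h t = (\<Prod>r\<in>S. f (z0 + (r * t) *s y))" for t
      have h_hol: "h holomorphic_on ball 0 1"
        unfolding h_def
      proof (intro holomorphic_on_prod)
        fix r assume "r \<in> S"
        have "((\<lambda>t. f (z0 + t *s y)) \<circ> (\<lambda>t. r * t)) holomorphic_on ball 0 1"
          using S_norm[OF \<open>r \<in> S\<close>]
          by (intro holomorphic_on_compose_gen[OF _ hol[OF y]] holomorphic_intros) (auto simp: norm_mult)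
        then show "(\<lambda>t. f (z0 + (r * t) *s y)) holomorphic_on ball 0 1" by (simp add: o_def)
      qed
      have inj_cball: "norm (t *s y) \<le> \<rho>" if "cmod t \<le> 1" for t
        using mult_right_mono[OF that norm_ge_zero[of y]] y by (simp add: norm_vector_smult)
      have cont_line: "continuous_on (cball 0 1) (\<lambda>t. f (z0 + (r * t) *s y))" if "r \<in> S" for r
      proof (rule continuous_on_compose2[OF cont])
        have "bounded_linear (\<lambda>t. (r * t) *s y)"
          by (intro linear_conv_bounded_linear[THEN iffD1] linearI) (auto simp: vec_eq_iff algebra_simps)
        then show "continuous_on (cball 0 1) (\<lambda>t. z0 + (r * t) *s y)"
          by (intro continuous_intros linear_continuous_on)
        show "(\<lambda>t. z0 + (r * t) *s y) ` cball 0 1 \<subseteq> cball z0 \<rho>"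
        proof safe
          fix t :: complex assume "t \<in> cball 0 1"
          then have "cmod (r * t) \<le> 1" using S_norm[OF that] by (simp add: norm_mult)
          from inj_cball[OF this] show "z0 + (r * t) *s y \<in> cball z0 \<rho>" by (simp add: dist_norm)
        qed
      qed
      have h_cont: "continuous_on (cball 0 1) h"
        unfolding h_def by (intro continuous_on_prod cont_line)
      have "continuous_on (sphere 0 1) (\<lambda>t. cmod (h t))"
        by (rule continuous_on_subset[OF continuous_on_norm[OF h_cont]]) auto
      moreover have "sphere (0::complex) 1 \<noteq> {}" by (metis norm_one mem_sphere_0 empty_iff)
      ultimately obtain t0 where t0: "t0 \<in> sphere 0 1" "\<And>t. t \<in> sphere 0 1 \<Longrightarrow> cmod (h t) \<le> cmod (h t0)"
        using continuous_attains_sup[of "sphere (0::complex) 1" "\<lambda>t. cmod (h t)"] by auto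
      have "cmod (h 0) \<le> cmod (h t0)"
        by (rule maximum_modulus_frontier[of h "ball 0 1"]) (use h_hol h_cont t0 in auto)
      moreover have "h 0 = f z0 ^ N" by (simp add: h_def S)
      ultimately have h_ge: "cmod (f z0) ^ N \<le> (\<Prod>r\<in>S. cmod (f (z0 + (r * t0) *s y)))"
        by (simp add: h_def norm_power prod_norm S(2))
      \<comment> \<open>t0 depends on y, which would spoil the integration over y. Replacing it by a
        root of unity r0 costs \<open>\<eta>\<close> in each term, and multiplication by r0 merely
        permutes the roots, so t0 disappears from the sum.\<close>
      obtain r0 where r0: "r0 ^ N = 1" "cmod (t0 - r0) \<le> 2 * pi / N"
        using roots_of_unity_dense[of t0 N] t0(1) N(1) by auto
      have r0S: "r0 \<in> S" using r0 by (simp add: S_def)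
      have "N * ln (cmod (f z0)) = ln (cmod (f z0) ^ N)" using nz by (simp add: ln_realpow)
      also have "\<dots> \<le> ln (\<Prod>r\<in>S. max (cmod (f (z0 + (r * t0) *s y))) e)"
        using nz \<open>e > 0\<close> h_ge
        by (intro ln_mono order_trans[OF h_ge] prod_mono) (auto intro!: prod_pos simp: less_max_iff_disj)
      also have "\<dots> = (\<Sum>r\<in>S. F ((r * t0) *s y))"
        unfolding F_def using \<open>e > 0\<close> by (subst ln_prod) (auto simp: S less_max_iff_disj)
      also have "\<dots> \<le> (\<Sum>r\<in>S. F ((r * r0) *s y) + \<eta>)"
      proof (rule sum_mono)
        fix r assume r: "r \<in> S"
        have "dist ((r * t0) *s y) ((r * r0) *s y) = cmod (t0 - r0) * norm y"
          using S_norm[OF r]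
          by (simp add: dist_norm norm_vector_smult norm_mult flip: vector_sub_rdistrib right_diff_distrib)
        also have "\<dots> \<le> (2 * pi / N) * \<rho>" using r0 y by (intro mult_mono) auto
        also have "\<dots> < d" using N by simp
        finally have "dist (F ((r * t0) *s y)) (F ((r * r0) *s y)) < \<eta>"
          using S_norm[OF r] S_norm[OF r0S] t0(1)
          by (intro d(2)) (auto intro!: inj_cball simp: norm_mult)
        then show "F ((r * t0) *s y) \<le> F ((r * r0) *s y) + \<eta>" by (simp add: dist_norm)
      qed
      also have "\<dots> = (\<Sum>r\<in>S. F (r *s y)) + N * \<eta>"
      proof -
        have "r0 \<noteq> 0" using r0 N(1) by (auto simp: zero_power)
        have "(\<Sum>r\<in>S. F ((r * r0) *s y)) = (\<Sum>r\<in>S. F (r *s y))"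
          by (rule sum.reindex_bij_witness[of _ "\<lambda>r. r / r0" "\<lambda>r. r * r0"])
             (use \<open>r0 \<noteq> 0\<close> r0 in \<open>auto simp: S_def power_mult_distrib power_divide\<close>)
        then show ?thesis by (simp add: sum.distrib S)
      qed
      finally show ?thesis by (simp add: algebra_simps)
    qed
    have "N * (measure lborel (ball z0 \<rho>) * (ln (cmod (f z0)) - \<eta>))
        = (\<integral>y. indicator (ball 0 \<rho>) (y :: complex ^ 'n) * (N * (ln (cmod (f z0)) - \<eta>)) \<partial>lborel)"
      by (simp add: vol)
    also have "\<dots> \<le> (\<integral>y. (\<Sum>r\<in>S. G (r *s y)) \<partial>lborel)"
    proof (rule integral_mono)
      show "integrable lborel (\<lambda>y :: complex ^ 'n. indicator (ball 0 \<rho>) y * (N * (ln (cmod (f z0)) - \<eta>)))"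
        by (intro integrable_mult_left integrable_real_indicator) (use emeasure_lborel_ball_finite[of "0 :: complex ^ 'n" \<rho>] in auto)
      show "integrable lborel (\<lambda>y. \<Sum>r\<in>S. G (r *s y))"
        by (intro Bochner_Integration.integrable_sum G_rot S_norm)
      fix y :: "complex ^ 'n"
      have "(\<Sum>r\<in>S. G (r *s y)) = indicator (ball 0 \<rho>) y * (\<Sum>r\<in>S. F (r *s y))"
        unfolding sum_distrib_left
        by (intro sum.cong) (auto simp: G_def indicator_def norm_vector_smult S_norm)
      then show "indicator (ball 0 \<rho>) y * (N * (ln (cmod (f z0)) - \<eta>)) \<le> (\<Sum>r\<in>S. G (r *s y))"
        using point[of y] by (auto simp: indicator_def)
    qed
    also have "\<dots> = N * (\<integral>y. G y \<partial>lborel)"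
      by (subst Bochner_Integration.integral_sum) (auto intro: G_rot(2) S_norm simp: G_rot(1) S_norm S)
    finally show ?thesis using N(1) by simp
  qed
  show ?thesis unfolding G_eq
  proof (rule field_le_epsilon)
    fix \<epsilon> :: real assume "\<epsilon> > 0"
    have pos: "measure lborel (ball z0 \<rho>) > 0" using \<open>\<rho> > 0\<close> by (simp add: content_ball_pos)
    from approx[of "\<epsilon> / measure lborel (ball z0 \<rho>)"]
    show "measure lborel (ball z0 \<rho>) * ln (cmod (f z0)) \<le> (\<integral>y. G y \<partial>lborel) + \<epsilon>"
      using pos \<open>\<epsilon> > 0\<close> by (simp add: algebra_simps)
  qed
qed

section \<open>Forms, currents and integration by parts\<close>

lemma integrable_continuous_compact_support:
  fixes g :: "'a::euclidean_space \<Rightarrow> 'b::{banach, second_countable_topology}"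
  assumes "continuous_on UNIV g" "compact K" "\<And>x. x \<notin> K \<Longrightarrow> g x = 0"
  shows "integrable lborel g"
proof -
  have "integrable lborel (\<lambda>x. indicator K x *\<^sub>R g x)"
    by (intro borel_integrable_compact assms continuous_on_subset[OF assms(1)]) auto
  also have "(\<lambda>x. indicator K x *\<^sub>R g x) = g"
    using assms(3) by (auto simp: indicator_def fun_eq_iff)
  finally show ?thesis .
qed

lemma frechet_derivative_zero_off_support:
  fixes g :: "'a::euclidean_space \<Rightarrow> 'b::real_normed_vector"
  assumes "closed K" "\<And>x. x \<notin> K \<Longrightarrow> g x = 0" "x \<notin> K"
  shows "(g has_derivative (\<lambda>_. 0)) (at x)" "frechet_derivative g (at x) v = 0"
proof -
  show *: "(g has_derivative (\<lambda>_. 0)) (at x)"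
    by (rule has_derivative_transform_within_open[OF has_derivative_const[of 0], of "- K"])
       (use assms in auto)
  show "frechet_derivative g (at x) v = 0"
    using frechet_derivative_at[OF *] by metis
qed

text \<open>Difference quotients of g integrate to 0 because Lebesgue measure is translation
  invariant, and they converge to the derivative under a common integrable bound.\<close>

lemma integral_frechet_derivative_zero:
  fixes g :: "'a::euclidean_space \<Rightarrow> complex"
  assumes diff: "\<And>x. g differentiable (at x)"
    and cont: "continuous_on UNIV (\<lambda>x. frechet_derivative g (at x) v)"
    and K: "compact K" "\<And>x. x \<notin> K \<Longrightarrow> g x = 0"
  shows "(\<integral>x. frechet_derivative g (at x) v \<partial>lborel) = 0"
proof -
  define D where "D x = frechet_derivative g (at x) v" for x
  have D0: "D x = 0" if "x \<notin> K" for x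
    unfolding D_def using frechet_derivative_zero_off_support(2)[of K g x v] K that
    by (simp add: compact_imp_closed)
  have g_cont: "continuous_on UNIV g"
    using diff differentiable_imp_continuous_within continuous_at_imp_continuous_on by blast
  have contD: "continuous_on UNIV D" using cont by (simp add: D_def[abs_def])
  have [measurable]: "g \<in> borel_measurable borel" "D \<in> borel_measurable borel"
    by (intro borel_measurable_continuous_onI g_cont contD)+
  obtain B where B: "B > 0" "\<And>x. norm (D x) \<le> B"
  proof -
    have "compact (D ` K)" by (intro compact_continuous_image continuous_on_subset[OF contD] K) auto
    then obtain B where B: "B > 0" "\<forall>y\<in>D ` K. norm y \<le> B"
      using compact_imp_bounded bounded_pos by blast
    have "norm (D x) \<le> B" for x
      using B D0[of x] by (cases "x \<in> K") auto
    with B(1) show ?thesis using that by blast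
  qed
  obtain R where R: "\<And>x. x \<in> K \<Longrightarrow> norm x \<le> R"
    using compact_imp_bounded[OF K(1)] by (auto simp: bounded_iff)
  define h where "h k x = of_nat (Suc k) * (g (x + (1 / real (Suc k)) *\<^sub>R v) - g x)" for k x
  have g_int: "integrable lborel g"
    by (rule integrable_continuous_compact_support[OF g_cont K])
  have h_int: "(\<integral>x. h k x \<partial>lborel) = 0" for k
  proof -
    define c where "c = (1 / real (Suc k)) *\<^sub>R v"
    have 1: "integrable lborel (\<lambda>x. g (c + x))" "(\<integral>x. g (c + x) \<partial>lborel) = (\<integral>x. g x \<partial>lborel)"
      using integrable_distr_eq[of "(+) c" lborel borel g] integral_distr[of "(+) c" lborel borel g] g_int
      by (simp_all add: lborel_distr_plus)
    have "(\<integral>x. h k x \<partial>lborel) = of_nat (Suc k) * (\<integral>x. (g (c + x) - g x) \<partial>lborel)"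
      unfolding h_def c_def[symmetric] by (simp add: add.commute del: of_nat_Suc)
    also have "\<dots> = 0" using 1 g_int by simp
    finally show ?thesis .
  qed
  have "(\<lambda>k. \<integral>x. h k x \<partial>lborel) \<longlonglongrightarrow> (\<integral>x. D x \<partial>lborel)"
  proof (rule integral_dominated_convergence)
    show "D \<in> borel_measurable lborel" by simp
    show "h k \<in> borel_measurable lborel" for k unfolding h_def by measurable
    \<comment> \<open>All shifts have length at most \<open>norm v\<close>, so every quotient
      vanishes outside the ball of radius \<open>R + norm v\<close>; inside, the mean value
      inequality bounds it by B.\<close>
    show "integrable lborel (\<lambda>x. B * indicator (cball (0::'a) (R + norm v)) x)"
      using emeasure_lborel_cball_finite[of "0::'a" "R + norm v"] by auto
    show "AE x in lborel. (\<lambda>k. h k x) \<longlonglongrightarrow> D x"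
    proof (rule AE_I2)
      fix x :: 'a
      have "(g has_derivative frechet_derivative g (at x)) (at x)"
        using diff frechet_derivative_works by blast
      moreover have "((\<lambda>t. x + t *\<^sub>R v) has_derivative (\<lambda>t. t *\<^sub>R v)) (at 0)"
        by (auto intro!: derivative_eq_intros)
      ultimately have "((\<lambda>t. g (x + t *\<^sub>R v)) has_derivative (\<lambda>t. frechet_derivative g (at x) (t *\<^sub>R v))) (at (0::real))"
        using has_derivative_compose[of "\<lambda>t. x + t *\<^sub>R v" "\<lambda>t. t *\<^sub>R v" "0::real" UNIV g "frechet_derivative g (at x)"] by simp
      moreover have "frechet_derivative g (at x) (t *\<^sub>R v) = t *\<^sub>R D x" for t
        unfolding D_def by (rule linear_scale[OF linear_frechet_derivative[OF diff]])
      ultimately have "((\<lambda>t. g (x + t *\<^sub>R v)) has_vector_derivative D x) (at 0)"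
        by (simp add: has_vector_derivative_def)
      then have "((\<lambda>t. (1 / t) *\<^sub>R (g (x + t *\<^sub>R v) - g x)) \<longlongrightarrow> D x) (at 0)"
      proof -
        assume "((\<lambda>t. g (x + t *\<^sub>R v)) has_vector_derivative D x) (at 0)"
        then have A: "((\<lambda>t. norm (g (x + t *\<^sub>R v) - g x - t *\<^sub>R D x) / norm t) \<longlongrightarrow> 0) (at 0)"
          by (simp add: has_vector_derivative_def has_derivative_at)
        have B: "norm (g (x + t *\<^sub>R v) - g x - t *\<^sub>R D x) / norm t = norm ((1 / t) *\<^sub>R (g (x + t *\<^sub>R v) - g x) - D x)"
          if "t \<noteq> 0" for t :: real
        proof -
          have "(1 / t) *\<^sub>R (g (x + t *\<^sub>R v) - g x) - D x = (1 / t) *\<^sub>R (g (x + t *\<^sub>R v) - g x - t *\<^sub>R D x)"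
            using that by (simp add: scaleR_diff_right)
          then show ?thesis by simp
        qed
        have "((\<lambda>t. norm ((1 / t) *\<^sub>R (g (x + t *\<^sub>R v) - g x) - D x)) \<longlongrightarrow> 0) (at 0)"
          by (rule Lim_transform_eventually[OF A]) (use B in \<open>auto simp: eventually_at_filter intro!: always_eventually\<close>)
        then show ?thesis
          by (simp add: LIM_zero_iff tendsto_norm_zero_iff)
      qed
      then have "(\<lambda>k. (1 / (1 / real (Suc k))) *\<^sub>R (g (x + (1 / real (Suc k)) *\<^sub>R v) - g x)) \<longlonglongrightarrow> D x"
      proof (rule filterlim_compose)
        have "(\<lambda>k. 1 / real (Suc k)) \<longlonglongrightarrow> 0"
          using LIMSEQ_inverse_real_of_nat by (simp add: inverse_eq_divide)
        then show "filterlim (\<lambda>k. 1 / real (Suc k)) (at 0) sequentially"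
          by (intro filterlim_atI) auto
      qed
      then show "(\<lambda>k. h k x) \<longlonglongrightarrow> D x"
        by (simp add: h_def scaleR_conv_of_real del: of_nat_Suc)
    qed
    show "AE x in lborel. norm (h k x) \<le> B * indicator (cball 0 (R + norm v)) x" for k
    proof (rule AE_I2)
      fix x :: 'a
      define c where "c = (1 / real (Suc k)) *\<^sub>R v"
      have norm_c: "norm c \<le> norm v" using norm_ge_zero[of v] by (simp add: c_def divide_le_eq algebra_simps)
      have "norm (g (x + 1 *\<^sub>R c) - g (x + 0 *\<^sub>R c)) \<le> (B / Suc k) * norm (1 - 0 :: real)"
      proof (rule differentiable_bound[of "{0..1}" "\<lambda>t. g (x + t *\<^sub>R c)" "\<lambda>t s. frechet_derivative g (at (x + t *\<^sub>R c)) (s *\<^sub>R c)"])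
        fix t :: real
        show "((\<lambda>t. g (x + t *\<^sub>R c)) has_derivative (\<lambda>s. frechet_derivative g (at (x + t *\<^sub>R c)) (s *\<^sub>R c))) (at t within {0..1})"
          by (rule has_derivative_compose[of "\<lambda>t. x + t *\<^sub>R c" "\<lambda>s. s *\<^sub>R c" t "{0..1}" g "frechet_derivative g (at (x + t *\<^sub>R c))"])
             (use diff frechet_derivative_works in \<open>auto intro!: derivative_eq_intros\<close>)
        have lin: "linear (frechet_derivative g (at (x + t *\<^sub>R c)))" by (rule linear_frechet_derivative[OF diff])
        have "frechet_derivative g (at (x + t *\<^sub>R c)) (s *\<^sub>R c) = (s / Suc k) *\<^sub>R D (x + t *\<^sub>R c)" for s
          using linear_scale[OF lin, of "s / Suc k" v] by (simp add: D_def c_def)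
        moreover have "norm ((s / Suc k) *\<^sub>R D (x + t *\<^sub>R c)) \<le> (B / Suc k) * norm s" for s :: real
          using mult_right_mono[OF B(2)[of "x + t *\<^sub>R c"], of "\<bar>s\<bar> / Suc k"] by (simp add: mult_ac del: of_nat_Suc)
        ultimately show "onorm (\<lambda>s. frechet_derivative g (at (x + t *\<^sub>R c)) (s *\<^sub>R c)) \<le> B / Suc k"
          by (intro onorm_le) simp
      qed auto
      then have bound: "norm (h k x) \<le> B"
        unfolding h_def c_def[symmetric] norm_mult norm_of_nat by (simp add: field_simps del: of_nat_Suc)
      show "norm (h k x) \<le> B * indicator (cball 0 (R + norm v)) x"
      proof (cases "x \<in> cball 0 (R + norm v)")
        case False
        have "x \<notin> K" using R[of x] False norm_ge_zero[of v] by (auto simp: not_le simp del: norm_ge_zero)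
        moreover have "x + c \<notin> K"
        proof
          assume "x + c \<in> K"
          then have "norm (x + c) \<le> R" by (rule R)
          moreover have "norm x \<le> norm (x + c) + norm c" by (metis add_diff_cancel norm_triangle_ineq4)
          ultimately show False using norm_c False by simp
        qed
        ultimately have "h k x = 0" by (simp add: h_def K c_def)
        then show ?thesis using B by simp
      qed (use bound in simp)
    qed
  qed
  then show ?thesis by (simp add: h_int D_def LIMSEQ_const_iff)
qed

text \<open>q is controlled on U only; its values elsewhere are arbitrary. The open sets U and the
  complement of K cover the space, and on the second the product is 0.\<close>

lemma continuous_mult_compact_support:
  fixes p q :: "'a::euclidean_space \<Rightarrow> complex"
  assumes "continuous_on UNIV p" "compact K" "\<And>x. x \<notin> K \<Longrightarrow> p x = 0"
    and "open U" "K \<subseteq> U" "continuous_on U q"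
  shows "continuous_on UNIV (\<lambda>x. p x * q x)" "integrable lborel (\<lambda>x. p x * q x)"
proof -
  have "continuous_on U (\<lambda>x. p x * q x)"
    by (intro continuous_intros assms continuous_on_subset[OF assms(1)]) auto
  moreover have "continuous_on (- K) (\<lambda>x. p x * q x)"
    using assms(3) by (subst continuous_on_cong[OF refl, of _ _ "\<lambda>_. 0"]) auto
  ultimately have "continuous_on (U \<union> - K) (\<lambda>x. p x * q x)"
    using assms(2,4) by (intro continuous_on_open_Un) (auto simp: compact_imp_closed)
  moreover have "U \<union> - K = UNIV" using assms(5) by auto
  ultimately show *: "continuous_on UNIV (\<lambda>x. p x * q x)" by simp
  show "integrable lborel (\<lambda>x. p x * q x)"
    by (rule integrable_continuous_compact_support[OF * assms(2)]) (simp add: assms(3))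
qed

text \<open>The integral of the derivative of p q is 0. Off K the product vanishes identically,
  which makes the product rule valid everywhere although nothing is known of q off U.\<close>

lemma integral_by_parts_directional:
  fixes p q :: "'a::euclidean_space \<Rightarrow> complex"
  assumes p: "\<And>x. p differentiable (at x)" "continuous_on UNIV (\<lambda>x. frechet_derivative p (at x) v)"
    and K: "compact K" "\<And>x. x \<notin> K \<Longrightarrow> p x = 0" and U: "open U" "K \<subseteq> U"
    and q: "\<And>x. x \<in> U \<Longrightarrow> q differentiable (at x)" "continuous_on U (\<lambda>x. frechet_derivative q (at x) v)"
  shows "(\<integral>x. p x * frechet_derivative q (at x) v \<partial>lborel)
       = - (\<integral>x. frechet_derivative p (at x) v * q x \<partial>lborel)"
proof -
  let ?g = "\<lambda>x. p x * q x"
  have p0: "frechet_derivative p (at x) v = 0" if "x \<notin> K" for x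
    using frechet_derivative_zero_off_support(2)[of K p x v] K that by (simp add: compact_imp_closed)
  have cont_p: "continuous_on UNIV p"
    using p(1) differentiable_imp_continuous_within continuous_at_imp_continuous_on by blast
  have cont_q: "continuous_on U q"
    using q(1) differentiable_imp_continuous_within continuous_at_imp_continuous_on by blast
  note c1 = continuous_mult_compact_support[of p K U "\<lambda>x. frechet_derivative q (at x) v", OF cont_p K U q(2)]
  note c2 = continuous_mult_compact_support[of "\<lambda>x. frechet_derivative p (at x) v" K U q, OF p(2) K(1) p0 U cont_q]
  have g_der: "?g differentiable (at x) \<and>
      frechet_derivative ?g (at x) v = p x * frechet_derivative q (at x) v + frechet_derivative p (at x) v * q x" for x
  proof (cases "x \<in> U")
    case True
    have "(p has_derivative frechet_derivative p (at x)) (at x)" "(q has_derivative frechet_derivative q (at x)) (at x)"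
      using p(1) q(1)[OF True] frechet_derivative_works by blast+
    from has_derivative_mult[OF this]
    have g: "(?g has_derivative (\<lambda>h. p x * frechet_derivative q (at x) h + frechet_derivative p (at x) h * q x)) (at x)" .
    show ?thesis unfolding frechet_derivative_at[OF g, symmetric] using g by (auto intro: differentiableI)
  next
    case False
    then have "x \<notin> K" using U by auto
    have "(?g has_derivative (\<lambda>_. 0)) (at x)" "frechet_derivative ?g (at x) v = 0"
      using frechet_derivative_zero_off_support(1)[of K ?g x] frechet_derivative_zero_off_support(2)[of K ?g x v] K \<open>x \<notin> K\<close> by (simp_all add: compact_imp_closed)
    then show ?thesis using p0 K(2) \<open>x \<notin> K\<close> by (auto intro: differentiableI)
  qed
  have "(\<integral>x. frechet_derivative ?g (at x) v \<partial>lborel) = 0"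
    by (rule integral_frechet_derivative_zero[where K = K])
       (use g_der K c1 c2 in \<open>auto intro!: continuous_on_add\<close>)
  then have "(\<integral>x. p x * frechet_derivative q (at x) v + frechet_derivative p (at x) v * q x \<partial>lborel) = 0"
    by (simp add: g_der)
  then show ?thesis using c1 c2 by (simp add: eq_neg_iff_add_eq_0)
qed

section \<open>Smooth functions and Wirtinger derivatives\<close>

lemma wirt_sum:
  assumes "finite A" "\<And>k. k \<in> A \<Longrightarrow> f k differentiable (at z)"
  shows "wirt j (\<lambda>w. \<Sum>k\<in>A. c k * f k w) z = (\<Sum>k\<in>A. c k * wirt j (f k) z)"
proof -
  have "((\<lambda>w. \<Sum>k\<in>A. c k * f k w) has_derivative
      (\<lambda>v. \<Sum>k\<in>A. c k * frechet_derivative (f k) (at z) v)) (at z)"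
    using assms(2) unfolding frechet_derivative_works
    by (intro has_derivative_sum has_derivative_mult_right) auto
  from frechet_derivative_at[OF this, symmetric] show ?thesis
    by (simp add: wirt_def sum_distrib_left sum_divide_distrib sum_subtractf[symmetric] algebra_simps diff_divide_distrib)
qed

lemma Ck_linear_combination:
  fixes f g :: "'a::euclidean_space \<Rightarrow> complex"
  shows "Ck k f \<Longrightarrow> Ck k g \<Longrightarrow> Ck k (\<lambda>x. a * f x + b * g x)"
proof (induction k arbitrary: f g)
  case 0
  then show ?case by (auto intro!: continuous_intros)
next
  case (Suc k)
  have der: "((\<lambda>w. a * f w + b * g w) has_derivative
      (\<lambda>v. a * frechet_derivative f (at z) v + b * frechet_derivative g (at z) v)) (at z)" for z
    using Suc.prems unfolding Ck.simps frechet_derivative_works by (auto intro!: derivative_eq_intros)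
  have "Ck k (\<lambda>x. a * frechet_derivative f (at x) v + b * frechet_derivative g (at x) v)" for v
    using Suc by auto
  then show ?case
    using der by (auto simp: frechet_derivative_at[OF der, symmetric] intro: differentiableI)
qed

lemma smooth_linear_combination:
  fixes f g :: "'a::euclidean_space \<Rightarrow> complex"
  shows "smooth f \<Longrightarrow> smooth g \<Longrightarrow> smooth (\<lambda>x. a * f x + b * g x)"
  by (simp add: smooth_def Ck_linear_combination)

lemma smooth_differentiable: "smooth f \<Longrightarrow> f differentiable (at x)"
  unfolding smooth_def by (metis Ck.simps(2))

lemma smooth_frechet_derivative: "smooth f \<Longrightarrow> smooth (\<lambda>x. frechet_derivative f (at x) v)"
  unfolding smooth_def by (metis Ck.simps(2))

lemma smooth_continuous: "smooth f \<Longrightarrow> continuous_on UNIV f"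
  unfolding smooth_def by (metis Ck.simps(1))

lemma Ck_zero: "Ck k (\<lambda>_ :: 'a::euclidean_space. 0 :: complex)"
proof (induction k)
  case (Suc k)
  have "frechet_derivative (\<lambda>_ :: 'a. 0 :: complex) (at x) v = 0" for x v
    by (simp add: frechet_derivative_const)
  then show ?case using Suc by simp
qed simp

lemma smooth_sum:
  fixes f :: "'k \<Rightarrow> 'a::euclidean_space \<Rightarrow> complex"
  assumes "\<And>k. k \<in> A \<Longrightarrow> smooth (f k)"
  shows "smooth (\<lambda>x. \<Sum>k\<in>A. c k * f k x)"
  using assms
proof (induction A rule: infinite_finite_induct)
  case (insert k A)
  then show ?case using smooth_linear_combination[of "f k" "\<lambda>x. \<Sum>k\<in>A. c k * f k x" "c k" 1] by simp
qed (auto simp: smooth_def Ck_zero)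

lemma smooth_wirt:
  fixes f :: "complex ^ 'n::finite \<Rightarrow> complex"
  assumes "smooth f"
  shows "smooth (wirt j f)" "smooth (wirt_bar j f)"
  using smooth_linear_combination[OF smooth_frechet_derivative[OF assms, of "axis j 1"]
      smooth_frechet_derivative[OF assms, of "axis j \<i>"], of "1/2" "- \<i>/2"]
    smooth_linear_combination[OF smooth_frechet_derivative[OF assms, of "axis j 1"]
      smooth_frechet_derivative[OF assms, of "axis j \<i>"], of "1/2" "\<i>/2"]
  by (simp_all add: wirt_def[abs_def] wirt_bar_def[abs_def] diff_divide_distrib add_divide_distrib)

lemma smooth_form_del_delbar:
  assumes "smooth_form \<phi>"
  shows "smooth_form (del \<phi>)" "smooth_form (delbar \<phi>)"
  using assms unfolding smooth_form_def del_def delbar_def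
  by (auto intro!: smooth_sum smooth_wirt)

lemma wirt_zero_off_support:
  fixes g :: "complex ^ 'n::finite \<Rightarrow> complex"
  assumes "closed K" "\<And>x. x \<notin> K \<Longrightarrow> g x = 0" "x \<notin> K"
  shows "wirt j g x = 0" "wirt_bar j g x = 0"
  using frechet_derivative_zero_off_support(2)[OF assms] by (simp_all add: wirt_def wirt_bar_def)

lemma del_delbar_zero_off_support:
  assumes "closed K" "\<And>x I J. x \<notin> K \<Longrightarrow> \<phi> x I J = 0" "x \<notin> K"
  shows "del \<phi> x I J = 0" "delbar \<phi> x I J = 0"
  using assms by (auto simp: del_def delbar_def intro!: sum.neutral wirt_zero_off_support[of K])

text \<open>Only first derivatives of q on U enter, so that q may be the potential or its gradient,
  which are singular at the boundary of the ball.\<close>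

lemma wirt_by_parts:
  fixes p q :: "complex ^ 'n::finite \<Rightarrow> complex"
  assumes p: "smooth p"
    and K: "compact K" "\<And>x. x \<notin> K \<Longrightarrow> p x = 0" and U: "open U" "K \<subseteq> U"
    and q: "\<And>x. x \<in> U \<Longrightarrow> q differentiable (at x)" "\<And>v. continuous_on U (\<lambda>x. frechet_derivative q (at x) v)"
  shows "(\<integral>x. p x * wirt j q x \<partial>lborel) = - (\<integral>x. wirt j p x * q x \<partial>lborel)"
    "(\<integral>x. p x * wirt_bar j q x \<partial>lborel) = - (\<integral>x. wirt_bar j p x * q x \<partial>lborel)"
proof -
  let ?p = "\<lambda>v x. frechet_derivative p (at x) v" and ?q = "\<lambda>v x. frechet_derivative q (at x) v"
  have p_cont: "continuous_on UNIV p" "\<And>v. continuous_on UNIV (?p v)"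
    by (intro smooth_continuous smooth_frechet_derivative p)+
  have cont_q: "continuous_on U q"
    using q(1) differentiable_imp_continuous_within continuous_at_imp_continuous_on by blast
  have p0: "?p v x = 0" if "x \<notin> K" for x v
    using frechet_derivative_zero_off_support(2)[of K p x v] K that by (simp add: compact_imp_closed)
  have i1: "integrable lborel (\<lambda>x. p x * ?q v x)" for v
    by (rule continuous_mult_compact_support(2)[OF p_cont(1) K U q(2)])
  have i2: "integrable lborel (\<lambda>x. ?p v x * q x)" for v
    by (rule continuous_mult_compact_support(2)[OF p_cont(2) K(1) p0 U cont_q])
  have parts: "(\<integral>x. p x * ?q v x \<partial>lborel) = - (\<integral>x. ?p v x * q x \<partial>lborel)" for v
    by (rule integral_by_parts_directional[OF smooth_differentiable[OF p] p_cont(2) K U q])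
  have key: "(\<integral>x. p x * ((?q u x + c * ?q v x) / 2) \<partial>lborel) = - (\<integral>x. ((?p u x + c * ?p v x) / 2) * q x \<partial>lborel)"
    for u v c
  proof -
    have "(\<integral>x. p x * ((?q u x + c * ?q v x) / 2) \<partial>lborel)
        = (\<integral>x. p x * ?q u x / 2 + (c / 2) * (p x * ?q v x) \<partial>lborel)"
      by (intro Bochner_Integration.integral_cong) (auto simp: field_simps)
    also have "\<dots> = (\<integral>x. p x * ?q u x \<partial>lborel) / 2 + (c / 2) * (\<integral>x. p x * ?q v x \<partial>lborel)"
      using i1 by simp
    also have "\<dots> = - ((\<integral>x. ?p u x * q x \<partial>lborel) / 2 + (c / 2) * (\<integral>x. ?p v x * q x \<partial>lborel))"
      by (simp add: parts)
    also have "\<dots> = - (\<integral>x. ?p u x * q x / 2 + (c / 2) * (?p v x * q x) \<partial>lborel)"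
      using i2 by simp
    also have "\<dots> = - (\<integral>x. ((?p u x + c * ?p v x) / 2) * q x \<partial>lborel)"
      by (intro arg_cong[where f = uminus] Bochner_Integration.integral_cong) (auto simp: field_simps)
    finally show ?thesis .
  qed
  show "(\<integral>x. p x * wirt j q x \<partial>lborel) = - (\<integral>x. wirt j p x * q x \<partial>lborel)"
    using key[of "axis j 1" "- \<i>" "axis j \<i>"] by (simp add: wirt_def)
  show "(\<integral>x. p x * wirt_bar j q x \<partial>lborel) = - (\<integral>x. wirt_bar j p x * q x \<partial>lborel)"
    using key[of "axis j 1" "\<i>" "axis j \<i>"] by (simp add: wirt_bar_def)
qed

section \<open>The potential of the Bergman form\<close>

text \<open>\<open>L * hyp_potential z\<close> is the logarithm of the covariance kernel at (z,
  z).\<close>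

definition hyp_potential :: "complex ^ 'n::finite \<Rightarrow> real" where
  "hyp_potential z = - ln (1 - (norm z)\<^sup>2)"

lemma has_derivative_hyp_potential:
  fixes z :: "complex ^ 'n::finite"
  assumes "norm z < 1"
  shows "((\<lambda>w. complex_of_real (hyp_potential w)) has_derivative (\<lambda>v. of_real (2 * (z \<bullet> v) / (1 - (norm z)\<^sup>2)))) (at z)"
proof -
  have pos: "1 - z \<bullet> z > 0"
    using assms power_strict_mono[of "norm z" 1 2] by (simp add: power2_norm_eq_inner)
  have "((\<lambda>w. - ln (1 - w \<bullet> w)) has_derivative (\<lambda>v. 2 * (z \<bullet> v) / (1 - z \<bullet> z))) (at z)"
    using pos by (auto intro!: derivative_eq_intros simp: inner_commute field_simps)
  then show ?thesis
    unfolding hyp_potential_def power2_norm_eq_inner by (rule has_derivative_of_real)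
qed

lemma has_derivative_quotient_one_minus_norm_sq:
  fixes z :: "complex ^ 'n::finite" and l :: "complex ^ 'n \<Rightarrow> complex"
  assumes "norm z < 1" and l: "bounded_linear l"
  shows "((\<lambda>w. l w / of_real (1 - (norm w)\<^sup>2)) has_derivative
    (\<lambda>v. l v / of_real (1 - (norm z)\<^sup>2) + l z * of_real (2 * (z \<bullet> v) / (1 - (norm z)\<^sup>2)\<^sup>2))) (at z)"
proof -
  have pos: "1 - z \<bullet> z > 0"
    using assms power_strict_mono[of "norm z" 1 2] by (simp add: power2_norm_eq_inner)
  have "((\<lambda>w. inverse (1 - w \<bullet> w)) has_derivative (\<lambda>v. 2 * (z \<bullet> v) / (1 - z \<bullet> z)\<^sup>2)) (at z)"
    using pos by (auto intro!: derivative_eq_intros simp: inner_commute field_simps power2_eq_square)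
  from has_derivative_mult[OF bounded_linear_imp_has_derivative[OF l] has_derivative_of_real[OF this]]
  show ?thesis
    unfolding power2_norm_eq_inner by (simp add: divide_inverse add.commute)
qed

lemma bounded_linear_vec_nth_cnj: "bounded_linear (\<lambda>w :: complex ^ 'n. cnj (w $ i))"
  by (rule bounded_linear_compose[OF bounded_linear_cnj bounded_linear_vec_nth])

lemma continuous_on_one_minus_norm_sq:
  fixes l :: "complex ^ 'n::finite \<Rightarrow> complex"
  assumes "continuous_on (ball 0 1) l" "continuous_on (ball 0 1) g"
  shows "continuous_on (ball 0 1) (\<lambda>x. l x * of_real (g x / (1 - (norm x)\<^sup>2) ^ k))"
proof -
  have "(norm x)\<^sup>2 \<noteq> 1" if "norm x < 1" for x :: "complex ^ 'n"
    using that power_strict_mono[of "norm x" 1 2] by simp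
  then have "(complex_of_real (norm x))\<^sup>2 \<noteq> 1" if "norm x < 1" for x :: "complex ^ 'n"
    using that by (metis of_real_eq_1_iff of_real_power)
  then show ?thesis using assms by (auto intro!: continuous_intros)
qed

text \<open>The derivatives are moved in the order bar k, then i, so that they land on p in the
  order in which \<open>del (delbar \<phi>)\<close> produces them. Symmetry of second derivatives is
  then needed only for the explicit potential and not for p.\<close>

lemma integral_by_parts_potential:
  fixes p :: "complex ^ 'n::finite \<Rightarrow> complex"
  assumes p: "smooth p" and K: "compact K" "\<And>x. x \<notin> K \<Longrightarrow> p x = 0" "K \<subseteq> ball 0 1"
  shows "(\<integral>x. p x * wirt i (wirt_bar k (\<lambda>w. of_real (hyp_potential w))) x \<partial>lborel)
       = (\<integral>x. wirt i (wirt_bar k p) x * of_real (hyp_potential x) \<partial>lborel)"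
    and "integrable lborel (\<lambda>x. p x * wirt i (wirt_bar k (\<lambda>w. of_real (hyp_potential w))) x)"
proof -
  let ?\<psi> = "\<lambda>w :: complex ^ 'n. complex_of_real (hyp_potential w)"
  define e where "e w = cnj (w $ i) / of_real (1 - (norm w)\<^sup>2)" for w :: "complex ^ 'n"
  define q where "q w = w $ k / of_real (1 - (norm w)\<^sup>2)" for w :: "complex ^ 'n"
  note psi_der = has_derivative_hyp_potential
  note e_der = has_derivative_quotient_one_minus_norm_sq[OF _ bounded_linear_vec_nth_cnj[of i], folded e_def]
  note q_der = has_derivative_quotient_one_minus_norm_sq[OF _ bounded_linear_vec_nth[of k], folded q_def]
  note fr = frechet_derivative_at[symmetric]
  have inner_ax: "z \<bullet> axis j 1 = Re (z $ j)" "z \<bullet> axis j \<i> = Im (z $ j)" for z :: "complex ^ 'n" and j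
    by (simp_all add: inner_axis)
  have wbar_psi: "wirt_bar k ?\<psi> z = q z" if "norm z < 1" for z
  proof -
    define s where "s = 1 - (norm z)\<^sup>2"
    show ?thesis unfolding wirt_bar_def fr[OF psi_der[OF that]] inner_ax q_def s_def[symmetric]
      by (simp add: complex_eq_iff)
  qed
  have w_psi: "wirt i ?\<psi> z = e z" if "norm z < 1" for z
  proof -
    define s where "s = 1 - (norm z)\<^sup>2"
    show ?thesis unfolding wirt_def fr[OF psi_der[OF that]] inner_ax e_def s_def[symmetric]
      by (simp add: complex_eq_iff)
  qed
  \<comment> \<open>Both sides are \<delta>_ik / s + conj(z_i) z_k / s^2 with s = 1 - |z|^2.\<close>
  have w_q: "wirt i q z = wirt_bar k e z" if "norm z < 1" for z
  proof -
    define s where "s = 1 - (norm z)\<^sup>2"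
    show ?thesis
      unfolding wirt_def wirt_bar_def fr[OF q_der[OF that]] fr[OF e_der[OF that]] inner_ax s_def[symmetric]
      by (cases "i = k") (simp_all add: axis_def complex_eq_iff add_divide_distrib diff_divide_distrib algebra_simps)
  qed
  have w_wbar_psi: "wirt i (wirt_bar k ?\<psi>) z = wirt_bar k e z" if z: "norm z < 1" for z
  proof -
    have "(wirt_bar k ?\<psi> has_derivative frechet_derivative q (at z)) (at z)"
      by (rule has_derivative_transform_within_open[of q _ _ _ "ball 0 1"])
         (use z q_der[OF z] wbar_psi fr[OF q_der[OF z]] in auto)
    from fr[OF this] show ?thesis using w_q[OF z] by (simp add: wirt_def)
  qed
  have in_ball: "norm x < 1" if "x \<in> K" for x using K(3) that by auto
  have e_cont: "continuous_on (ball 0 1) (\<lambda>x. frechet_derivative e (at x) v)" for v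
  proof -
    have "continuous_on (ball 0 1) (\<lambda>z :: complex ^ 'n. cnj (v $ i) * of_real (1 / (1 - (norm z)\<^sup>2) ^ 1)
        + cnj (z $ i) * of_real (2 * (z \<bullet> v) / (1 - (norm z)\<^sup>2) ^ 2))"
      by (intro continuous_on_add continuous_on_one_minus_norm_sq continuous_intros)
    then show ?thesis
      by (rule continuous_on_eq) (auto simp: fr[OF e_der])
  qed
  have psi_cont: "continuous_on (ball 0 1) (\<lambda>x. frechet_derivative ?\<psi> (at x) v)" for v
  proof -
    have "continuous_on (ball 0 1) (\<lambda>z :: complex ^ 'n. 1 * complex_of_real (2 * (z \<bullet> v) / (1 - (norm z)\<^sup>2) ^ 1))"
      by (intro continuous_on_one_minus_norm_sq continuous_intros)
    then show ?thesis
      by (rule continuous_on_eq) (auto simp: fr[OF psi_der])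
  qed
  have p_eq: "p x * wirt i (wirt_bar k ?\<psi>) x = p x * wirt_bar k e x" for x
    using K(2)[of x] in_ball[of x] w_wbar_psi[of x] by (cases "x \<in> K") auto
  have e_wirt_cont: "continuous_on (ball 0 1) (wirt_bar k e)"
    unfolding wirt_bar_def by (intro continuous_intros e_cont) auto
  show "integrable lborel (\<lambda>x. p x * wirt i (wirt_bar k ?\<psi>) x)"
    unfolding p_eq
    by (rule continuous_mult_compact_support(2)[OF smooth_continuous[OF p] K(1) _ open_ball K(3) e_wirt_cont]) (rule K(2))
  have "(\<integral>x. p x * wirt i (wirt_bar k ?\<psi>) x \<partial>lborel) = (\<integral>x. p x * wirt_bar k e x \<partial>lborel)"
    unfolding p_eq ..
  also have "\<dots> = - (\<integral>x. wirt_bar k p x * e x \<partial>lborel)"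
    by (rule wirt_by_parts[OF p K(1,2) open_ball K(3) _ e_cont]) (use e_der in \<open>auto intro: differentiableI\<close>)
  also have "\<dots> = - (\<integral>x. wirt_bar k p x * wirt i ?\<psi> x \<partial>lborel)"
  proof (rule arg_cong[where f = uminus], rule Bochner_Integration.integral_cong[OF refl])
    fix x show "wirt_bar k p x * e x = wirt_bar k p x * wirt i ?\<psi> x"
      using wirt_zero_off_support(2)[of K p x k] compact_imp_closed[OF K(1)] K(2) in_ball[of x] w_psi[of x]
      by (cases "x \<in> K") auto
  qed
  also have "\<dots> = - (- (\<integral>x. wirt i (wirt_bar k p) x * ?\<psi> x \<partial>lborel))"
  proof (rule arg_cong[where f = uminus])
    have w0: "wirt_bar k p x = 0" if "x \<notin> K" for x
      by (rule wirt_zero_off_support(2)[OF compact_imp_closed[OF K(1)] K(2) that])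
    have d: "?\<psi> differentiable (at x)" if "x \<in> ball 0 1" for x
      using that by (intro differentiableI[OF psi_der]) simp
    show "(\<integral>x. wirt_bar k p x * wirt i ?\<psi> x \<partial>lborel) = - (\<integral>x. wirt i (wirt_bar k p) x * ?\<psi> x \<partial>lborel)"
      by (rule wirt_by_parts(1)[OF smooth_wirt(2)[OF p] K(1) w0 open_ball K(3) d psi_cont])
  qed
  finally show "(\<integral>x. p x * wirt i (wirt_bar k ?\<psi>) x \<partial>lborel) = (\<integral>x. wirt i (wirt_bar k p) x * ?\<psi> x \<partial>lborel)"
    by simp
qed

section \<open>Signs and top-degree components\<close>

text \<open>One sign counts the indices above i and the other those below; together these are all n
  - 1 remaining indices.\<close>

lemma shuffle_sign_singletons:
  fixes i :: "'n::{finite,linorder}"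
  shows "shuffle_sign (UNIV - {i}) {i} = (- 1) ^ (CARD('n) - 1) * shuffle_sign {i} (UNIV - {i})"
    "shuffle_sign {i} {} = 1"
proof -
  have 1: "{(a, b). a \<in> UNIV - {i} \<and> b \<in> {i} \<and> b < a} = (\<lambda>a. (a, i)) ` {i<..}"
    and 2: "{(a, b). a \<in> {i} \<and> b \<in> UNIV - {i} \<and> b < a} = Pair i ` {..<i}" by auto
  have c: "card {(a, b). a \<in> UNIV - {i} \<and> b \<in> {i} \<and> b < a} = card {i<..}"
    "card {(a, b). a \<in> {i} \<and> b \<in> UNIV - {i} \<and> b < a} = card {..<i}"
    unfolding 1 2 by (intro card_image inj_onI; simp)+
  have "CARD('n) = card (insert i ({i<..} \<union> {..<i}))"
    by (rule arg_cong[where f = card]) (auto simp: not_less_iff_gr_or_eq)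
  also have "\<dots> = Suc (card {i<..} + card {..<i})"
  proof -
    have "i \<notin> {i<..} \<union> {..<i}" "{i<..} \<inter> {..<i} = {}" by auto
    then show ?thesis
      using card_insert_disjoint[OF finite, of i "{i<..} \<union> {..<i}"] card_Un_disjoint[OF finite finite, of "{i<..}" "{..<i}"]
      by metis
  qed
  finally have n: "CARD('n) - 1 = card {i<..} + card {..<i}" by simp
  have "(- 1 :: complex) ^ card {..<i} * (- 1) ^ card {..<i} = 1"
    by (simp flip: power_add mult_2)
  then show "shuffle_sign (UNIV - {i}) {i} = (- 1) ^ (CARD('n) - 1) * shuffle_sign {i} (UNIV - {i})"
    unfolding shuffle_sign_def c n power_add by (simp add: mult.assoc)
  show "shuffle_sign {i} {} = 1" by (simp add: shuffle_sign_def)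
qed

lemma sum_Pow_codim_1:
  fixes g :: "'n::finite set \<Rightarrow> complex"
  assumes "\<And>I. card I \<noteq> CARD('n) - 1 \<Longrightarrow> g I = 0"
  shows "(\<Sum>I\<in>Pow UNIV. g I) = (\<Sum>i\<in>UNIV. g (UNIV - {i}))"
proof -
  have "(\<Sum>I\<in>Pow UNIV. g I) = (\<Sum>I\<in>range (\<lambda>i. UNIV - {i}). g I)"
  proof (rule sum.mono_neutral_right)
    show "\<forall>I\<in>Pow UNIV - range (\<lambda>i. UNIV - {i}). g I = 0"
    proof
      fix I :: "'n set" assume I: "I \<in> Pow UNIV - range (\<lambda>i. UNIV - {i})"
      have "card I \<noteq> CARD('n) - 1"
      proof
        assume "card I = CARD('n) - 1"
        then have "card (- I) = 1"
          using card_Diff_subset[OF finite subset_UNIV, of I] zero_less_card_finite[where 'a='n]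
          by (simp add: Compl_eq_Diff_UNIV)
        then obtain i where "- I = {i}" by (auto simp: card_1_singleton_iff)
        then have "I = UNIV - {i}" by auto
        then show False using I by auto
      qed
      then show "g I = 0" by (rule assms)
    qed
  qed auto
  also have "\<dots> = (\<Sum>i\<in>UNIV. g (UNIV - {i}))"
    by (subst sum.reindex) (auto simp: inj_on_def)
  finally show ?thesis .
qed

lemma del_delbar_top:
  fixes \<phi> :: "'n::{finite,linorder} form"
  assumes "smooth_form \<phi>"
  shows "del (delbar \<phi>) z UNIV UNIV = (\<Sum>i\<in>UNIV. \<Sum>k\<in>UNIV.
      (- 1) ^ (CARD('n) - 1) * shuffle_sign {i} (UNIV - {i}) * shuffle_sign {k} (UNIV - {k})
      * wirt i (wirt_bar k (\<lambda>w. \<phi> w (UNIV - {i}) (UNIV - {k}))) z)"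
proof -
  have card: "card (UNIV - {i}) = CARD('n) - 1" for i :: 'n by (simp add: card_Diff_singleton)
  have "wirt i (\<lambda>w. delbar \<phi> w (UNIV - {i}) UNIV) z = (\<Sum>k\<in>UNIV.
      (- 1) ^ (CARD('n) - 1) * shuffle_sign {k} (UNIV - {k}) * wirt i (wirt_bar k (\<lambda>w. \<phi> w (UNIV - {i}) (UNIV - {k}))) z)" for i
    unfolding delbar_def card using assms
    by (intro wirt_sum smooth_differentiable smooth_wirt) (auto simp: smooth_form_def)
  then show ?thesis
    unfolding del_def by (simp add: sum_distrib_left mult_ac)
qed

text \<open>With e = \<open>(- 1) ^ (CARD('n) - 1)\<close>, the wedge contributes one e and each of
  the two reversed shuffle signs another. As e squared is 1, a single e remains, and the sign agrees
  with that in \<open>del_delbar_top\<close>; the two expansions can be compared term by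
  term.\<close>

lemma wedge_bergman_top:
  fixes \<phi> :: "'n::{finite,linorder} form"
  assumes "of_bidegree (CARD('n) - 1) (CARD('n) - 1) \<phi>"
  shows "wedge \<phi> bergman_form z UNIV UNIV = (\<Sum>i\<in>UNIV. \<Sum>k\<in>UNIV.
      (- 1) ^ (CARD('n) - 1) * shuffle_sign {i} (UNIV - {i}) * shuffle_sign {k} (UNIV - {k})
      * \<phi> z (UNIV - {i}) (UNIV - {k}) * (\<i> / (2 * of_real pi) * wirt i (wirt_bar k (\<lambda>w. of_real (hyp_potential w))) z))"
proof -
  have co: "UNIV - (UNIV - {i}) = {i}" for i :: 'n by auto
  have card: "card (UNIV - {i}) = CARD('n) - 1" for i :: 'n by (simp add: card_Diff_singleton)
  have zero: "\<phi> z I J = 0" if "card I \<noteq> CARD('n) - 1 \<or> card J \<noteq> CARD('n) - 1" for I J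
    using assms that by (auto simp: of_bidegree_def)
  have pot: "ln (1 / (1 - (norm w)\<^sup>2)) = hyp_potential w" for w :: "complex ^ 'n::{finite,linorder}"
    by (simp add: hyp_potential_def ln_div ln_inverse[symmetric] inverse_eq_divide)
  have berg: "bergman_form z {i} {k} = \<i> / (2 * of_real pi) * wirt i (wirt_bar k (\<lambda>w. of_real (hyp_potential w))) z" for i k :: 'n
    by (simp add: bergman_form_def del_def delbar_def shuffle_sign_singletons scalar_form_def pot)
  have sq: "e * (e * a) * (e * b) = e * a * b" if "e * e = 1" for e a b :: complex
  proof -
    have "e * (e * a) * (e * b) = (e * e) * (e * a * b)" by (simp only: mult_ac)
    then show ?thesis by (simp add: that)
  qed
  have e: "(- 1 :: complex) ^ (CARD('n) - 1) * (- 1) ^ (CARD('n) - 1) = 1" by (simp flip: power_add mult_2)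
  have "wedge \<phi> bergman_form z UNIV UNIV = (\<Sum>i\<in>UNIV. \<Sum>k\<in>UNIV.
      (- 1) ^ (CARD('n) - 1) * shuffle_sign (UNIV - {i}) {i} * shuffle_sign (UNIV - {k}) {k}
      * \<phi> z (UNIV - {i}) (UNIV - {k}) * bergman_form z {i} {k})"
  proof -
    define g where "g I J = (- 1) ^ (card J * card (UNIV - I)) * shuffle_sign I (UNIV - I) * shuffle_sign J (UNIV - J)
      * \<phi> z I J * bergman_form z (UNIV - I) (UNIV - J)" for I J
    have g0: "g I J = 0" if "card I \<noteq> CARD('n) - 1 \<or> card J \<noteq> CARD('n) - 1" for I J
      using zero[OF that] by (simp add: g_def)
    have "wedge \<phi> bergman_form z UNIV UNIV = (\<Sum>I\<in>Pow UNIV. \<Sum>J\<in>Pow UNIV. g I J)"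
      unfolding wedge_def g_def ..
    also have "\<dots> = (\<Sum>i\<in>UNIV. \<Sum>J\<in>Pow UNIV. g (UNIV - {i}) J)"
      by (rule sum_Pow_codim_1) (simp add: g0)
    also have "\<dots> = (\<Sum>i\<in>UNIV. \<Sum>k\<in>UNIV. g (UNIV - {i}) (UNIV - {k}))"
      by (intro sum.cong refl sum_Pow_codim_1) (simp add: g0)
    also have "\<dots> = (\<Sum>i\<in>UNIV. \<Sum>k\<in>UNIV.
      (- 1) ^ (CARD('n) - 1) * shuffle_sign (UNIV - {i}) {i} * shuffle_sign (UNIV - {k}) {k}
      * \<phi> z (UNIV - {i}) (UNIV - {k}) * bergman_form z {i} {k})"
      unfolding g_def co card by simp
    finally show ?thesis .
  qed
  then show ?thesis
    unfolding berg shuffle_sign_singletons sq[OF e] .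
qed

text \<open>The density with respect to Lebesgue measure of the top-degree form (i / 2 pi) del
  delbar \<phi>, including the orientation constant of \<open>form_integral\<close>.\<close>

definition current_density :: "'n::{finite,linorder} form \<Rightarrow> complex ^ 'n::{finite,linorder} \<Rightarrow> complex" where
  "current_density \<phi> z = \<i> / (2 * of_real pi) * ((- 1) ^ (CARD('n) * (CARD('n) - 1) div 2)
     * (- 2 * \<i>) ^ CARD('n) * del (delbar \<phi>) z UNIV UNIV)"

lemma zero_current_eq_integral:
  fixes \<phi> :: "'n::{finite,linorder} form"
  shows "zero_current f \<phi> = (LINT z:unit_ball|lborel. of_real (ln ((cmod (f z))\<^sup>2)) * current_density \<phi> z)"
proof -
  let ?C = "\<i> / (2 * of_real pi) * ((- 1) ^ (CARD('n) * (CARD('n) - 1) div 2) * (- 2 * \<i>) ^ CARD('n)) :: complex"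
  have "(LINT z:unit_ball|lborel. of_real (ln ((cmod (f z))\<^sup>2)) * current_density \<phi> z)
      = (LINT z:unit_ball|lborel. ?C * (of_real (ln ((cmod (f z))\<^sup>2)) * del (delbar \<phi>) z UNIV UNIV))"
    by (simp add: current_density_def mult_ac)
  also have "\<dots> = ?C * (LINT z:unit_ball|lborel. of_real (ln ((cmod (f z))\<^sup>2)) * del (delbar \<phi>) z UNIV UNIV)"
    by (rule set_integral_mult_right)
  finally show ?thesis
    by (simp add: zero_current_def ddbar_current_def form_integral_def mult.assoc)
qed

lemma current_density_continuous:
  assumes "smooth_form \<phi>"
  shows "continuous_on UNIV (current_density \<phi>)"
proof -
  have "smooth_form (del (delbar \<phi>))"
    by (intro smooth_form_del_delbar assms)
  then have "continuous_on UNIV (\<lambda>z. del (delbar \<phi>) z UNIV UNIV)"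
    by (simp add: smooth_form_def smooth_continuous)
  then show ?thesis
    unfolding current_density_def by (intro continuous_on_mult continuous_on_const)
qed

lemma current_density_zero_off_support:
  assumes "closed K" "\<And>x I J. x \<notin> K \<Longrightarrow> \<phi> x I J = 0" "x \<notin> K"
  shows "current_density \<phi> x = 0"
proof -
  have "delbar \<phi> y I J = 0" if "y \<notin> K" for y I J
    by (rule del_delbar_zero_off_support(2)[OF assms(1,2) that])
  then have "del (delbar \<phi>) x UNIV UNIV = 0"
    by (rule del_delbar_zero_off_support(1)[OF assms(1) _ assms(3)])
  then show ?thesis by (simp add: current_density_def)
qed

text \<open>Stokes' theorem in coordinates: each summand of the top coefficient is integrated by
  parts twice. Hence L times the integral of \<phi> \<and> \<omega> is what the statistic would be
  if ln |f|^2 were replaced by L \<psi>.\<close>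

lemma form_integral_wedge_bergman:
  fixes \<phi> :: "'n::{finite,linorder} form"
  assumes \<phi>: "smooth_form \<phi>" "of_bidegree (CARD('n) - 1) (CARD('n) - 1) \<phi>"
    and K: "compact K" "K \<subseteq> unit_ball" "\<And>z I J. z \<notin> K \<Longrightarrow> \<phi> z I J = 0"
  shows "form_integral unit_ball (wedge \<phi> bergman_form)
       = (LINT z:unit_ball|lborel. of_real (hyp_potential z) * current_density \<phi> z)"
proof -
  define C where "C = ((- 1) ^ (CARD('n) * (CARD('n) - 1) div 2) * (- 2 * \<i>) ^ CARD('n) :: complex)"
  define \<kappa> where "\<kappa> = (\<i> / (2 * of_real pi) :: complex)"
  define t where "t i k = (- 1) ^ (CARD('n) - 1) * shuffle_sign {i} (UNIV - {i}) * shuffle_sign {k} (UNIV - {k})" for i k :: 'n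
  let ?\<psi> = "\<lambda>w :: complex ^ 'n::{finite,linorder}. complex_of_real (hyp_potential w)"
  define p where "p i k = (\<lambda>w. \<phi> w (UNIV - {i}) (UNIV - {k}))" for i k
  have p: "smooth (p i k)" for i k using \<phi>(1) by (simp add: p_def smooth_form_def)
  have p0: "p i k z = 0" if "z \<notin> K" for i k z using K(3) that by (simp add: p_def)
  note cl = compact_imp_closed[OF K(1)]
  have w1: "wirt_bar k (p i k) z = 0" if "z \<notin> K" for i k z
    using wirt_zero_off_support(2)[of K "p i k" z k] cl p0 that by simp
  have w0: "wirt i (wirt_bar k (p i k)) z = 0" if "z \<notin> K" for i k z
    using wirt_zero_off_support(1)[of K "wirt_bar k (p i k)" z i] cl w1 that by simp
  have psi_cont: "continuous_on (ball 0 1) ?\<psi>"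
    by (intro continuous_at_imp_continuous_on ballI has_derivative_continuous[OF has_derivative_hyp_potential]) simp
  have full: "(LINT z:unit_ball|lborel. h z) = (\<integral>z. h z \<partial>lborel)" if "\<And>z. z \<notin> K \<Longrightarrow> h z = 0" for h :: "complex ^ 'n::{finite,linorder} \<Rightarrow> complex"
    unfolding set_lebesgue_integral_def
  proof (rule Bochner_Integration.integral_cong[OF refl])
    fix x show "indicat_real unit_ball x *\<^sub>R h x = h x"
      using subsetD[OF K(2), of x] that[of x] by (cases "x \<in> K") (auto simp: indicator_def)
  qed
  have i1: "integrable lborel (\<lambda>z. p i k z * wirt i (wirt_bar k ?\<psi>) z)" for i k
    using integral_by_parts_potential(2)[of "p i k" K i k] p K(1,2) p0 by simp
  have parts: "(\<integral>z. p i k z * wirt i (wirt_bar k ?\<psi>) z \<partial>lborel) = (\<integral>z. wirt i (wirt_bar k (p i k)) z * ?\<psi> z \<partial>lborel)" for i k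
    using integral_by_parts_potential(1)[of "p i k" K i k] p K(1,2) p0 by simp
  have i2: "integrable lborel (\<lambda>z. wirt i (wirt_bar k (p i k)) z * ?\<psi> z)" for i k
    using continuous_mult_compact_support(2)[of "wirt i (wirt_bar k (p i k))" K "ball 0 1" ?\<psi>]
      smooth_continuous[OF smooth_wirt(1)[OF smooth_wirt(2)[OF p]]] K w0 psi_cont by simp
  have r1: "A * x * (c * y) = A * c * (x * y)" for A x c y :: complex by (simp only: mult_ac)
  have r2: "A * c * (x * y) = A * x * (c * y)" for A x c y :: complex by (simp only: mult_ac)
  have r3: "C * (x * (\<kappa> * y)) = y * (\<kappa> * (C * x))" for x y by (simp only: mult_ac)
  have w0': "wedge \<phi> bergman_form z UNIV UNIV = 0" if "z \<notin> K" for z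
    using that by (simp add: wedge_def K(3))
  have "form_integral unit_ball (wedge \<phi> bergman_form)
      = C * (\<integral>z. wedge \<phi> bergman_form z UNIV UNIV \<partial>lborel)"
    using full[of "\<lambda>z. wedge \<phi> bergman_form z UNIV UNIV"] w0' by (simp add: form_integral_def C_def)
  also have "(\<integral>z. wedge \<phi> bergman_form z UNIV UNIV \<partial>lborel)
      = (\<integral>z. (\<Sum>i\<in>UNIV. \<Sum>k\<in>UNIV. t i k * \<kappa> * (p i k z * wirt i (wirt_bar k ?\<psi>) z)) \<partial>lborel)"
    unfolding wedge_bergman_top[OF \<phi>(2)] p_def t_def[symmetric] \<kappa>_def[symmetric]
    by (intro Bochner_Integration.integral_cong sum.cong refl r1)
  also have "\<dots> = (\<Sum>i\<in>UNIV. \<Sum>k\<in>UNIV. t i k * \<kappa> * (\<integral>z. p i k z * wirt i (wirt_bar k ?\<psi>) z \<partial>lborel))"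
    using i1 by (simp add: Bochner_Integration.integral_sum)
  also have "\<dots> = (\<Sum>i\<in>UNIV. \<Sum>k\<in>UNIV. t i k * \<kappa> * (\<integral>z. wirt i (wirt_bar k (p i k)) z * ?\<psi> z \<partial>lborel))"
    by (simp only: parts)
  also have "\<dots> = (\<integral>z. (\<Sum>i\<in>UNIV. \<Sum>k\<in>UNIV. t i k * \<kappa> * (wirt i (wirt_bar k (p i k)) z * ?\<psi> z)) \<partial>lborel)"
    using i2 by (simp add: Bochner_Integration.integral_sum)
  also have "\<dots> = (\<integral>z. (\<Sum>i\<in>UNIV. \<Sum>k\<in>UNIV. t i k * wirt i (wirt_bar k (p i k)) z) * (\<kappa> * ?\<psi> z) \<partial>lborel)"
    unfolding sum_distrib_right by (intro Bochner_Integration.integral_cong sum.cong refl r2)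
  also have "\<dots> = (\<integral>z. del (delbar \<phi>) z UNIV UNIV * (\<kappa> * ?\<psi> z) \<partial>lborel)"
    unfolding del_delbar_top[OF \<phi>(1)] t_def p_def ..
  also have "C * \<dots> = (\<integral>z. C * (del (delbar \<phi>) z UNIV UNIV * (\<kappa> * ?\<psi> z)) \<partial>lborel)"
    by (rule integral_mult_right_zero[symmetric])
  also have "\<dots> = (\<integral>z. ?\<psi> z * current_density \<phi> z \<partial>lborel)"
    unfolding r3 unfolding C_def \<kappa>_def current_density_def ..
  also have "\<dots> = (LINT z:unit_ball|lborel. ?\<psi> z * current_density \<phi> z)"
    using full[of "\<lambda>z. ?\<psi> z * current_density \<phi> z"] current_density_zero_off_support[of K \<phi>] cl K(3) by simp
  finally show ?thesis .
qed

section \<open>The coefficients of the hyperbolic series\<close>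

abbreviation mdeg :: "('n::finite \<Rightarrow> nat) \<Rightarrow> nat" where
  "mdeg \<alpha> \<equiv> \<Sum>j\<in>UNIV. \<alpha> j"

definition hcoef :: "real \<Rightarrow> ('n::finite \<Rightarrow> nat) \<Rightarrow> real" where
  "hcoef L \<alpha> = Gamma (L + real (mdeg \<alpha>)) / ((\<Prod>j\<in>UNIV. fact (\<alpha> j)) * Gamma L)"

text \<open>Multi-indices supported in A are encoded as functions vanishing off A, so that an
  induction over the set of coordinates stays within one type. Nonnegativity supplies the joint
  summability that iterated sums alone would not give.\<close>

lemma has_sum_insert_coordinate:
  fixes f :: "('n \<Rightarrow> nat) \<Rightarrow> real"
  assumes b: "b \<notin> A" and nonneg: "\<And>\<alpha>. f \<alpha> \<ge> 0"
    and inner: "\<And>k. ((\<lambda>\<alpha>. f (\<alpha>(b := k))) has_sum g k) {\<alpha>. \<forall>j. j \<notin> A \<longrightarrow> \<alpha> j = 0}"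
    and outer: "(g has_sum S) UNIV"
  shows "(f has_sum S) {\<alpha>. \<forall>j. j \<notin> insert b A \<longrightarrow> \<alpha> j = 0}"
proof -
  let ?S = "\<lambda>A. {\<alpha> :: 'n \<Rightarrow> nat. \<forall>j. j \<notin> A \<longrightarrow> \<alpha> j = 0}"
  let ?h = "\<lambda>(k :: nat, \<alpha> :: 'n \<Rightarrow> nat). \<alpha>(b := k)"
  have "bij_betw ?h (UNIV \<times> ?S A) (?S (insert b A))"
    by (rule bij_betw_byWitness[where f' = "\<lambda>\<alpha>. (\<alpha> b, \<alpha>(b := 0))"]) (use b in \<open>auto simp: fun_eq_iff\<close>)
  moreover have "((\<lambda>x. f (?h x)) has_sum S) (UNIV \<times> ?S A)"
  proof (rule has_sum_SigmaI[OF _ outer])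
    show "((\<lambda>\<alpha>. f (?h (k, \<alpha>))) has_sum g k) (?S A)" for k using inner[of k] by simp
    show "(\<lambda>x. f (?h x)) summable_on (UNIV \<times> ?S A)"
      by (rule summable_on_SigmaI[where g = g]) (use inner outer nonneg in \<open>auto simp: summable_on_def\<close>)
  qed
  ultimately show ?thesis by (simp add: has_sum_reindex_bij_betw)
qed

lemma has_sum_singleton: "(f has_sum f a) {a}"
  using has_sum_finite[of "{a}" f] by simp

lemma sum_insert_fun_upd:
  "finite A \<Longrightarrow> b \<notin> A \<Longrightarrow> (\<Sum>j\<in>insert b A. (\<alpha>(b := k)) j) = k + (\<Sum>j\<in>A. \<alpha> j)"
  by (subst sum.insert) (auto intro!: sum.cong arg_cong2[where f = "(+)"])

lemma prod_insert_fun_upd: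
  "finite A \<Longrightarrow> b \<notin> A \<Longrightarrow> (\<Prod>j\<in>insert b A. F j ((\<alpha>(b := k)) j)) = F b k * (\<Prod>j\<in>A. F j (\<alpha> j))"
  by (subst prod.insert) (auto intro!: prod.cong arg_cong2[where f = times])

lemma has_sum_geometric_multi_index:
  fixes q :: real
  assumes "0 \<le> q" "q < 1"
  shows "((\<lambda>\<alpha> :: 'n::finite \<Rightarrow> nat. q ^ (mdeg \<alpha>)) has_sum (1 / (1 - q)) ^ CARD('n)) UNIV"
proof -
  have geo: "((\<lambda>k. q ^ k) has_sum (1 / (1 - q))) UNIV"
    using assms by (intro sums_nonneg_imp_has_sum geometric_sums) auto
  have "((\<lambda>\<alpha>. q ^ (\<Sum>j\<in>A. \<alpha> j)) has_sum (1 / (1 - q)) ^ card A) {\<alpha>. \<forall>j. j \<notin> A \<longrightarrow> \<alpha> j = 0}"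
    if "finite A" for A :: "'n set"
    using that
  proof (induction A)
    case empty
    have "{\<alpha>. \<forall>j. \<alpha> j = 0} = {\<lambda>_ :: 'n. 0 :: nat}" by auto
    then show ?case using has_sum_singleton[of "\<lambda>_. 1 :: real" "\<lambda>_ :: 'n. 0 :: nat"] by simp
  next
    case (insert b A)
    show ?case
    proof (rule has_sum_insert_coordinate[where g = "\<lambda>k. q ^ k * (1 / (1 - q)) ^ card A"])
      fix k
      show "((\<lambda>\<alpha>. q ^ (\<Sum>j\<in>insert b A. (\<alpha>(b := k)) j)) has_sum q ^ k * (1 / (1 - q)) ^ card A)
          {\<alpha>. \<forall>j. j \<notin> A \<longrightarrow> \<alpha> j = 0}"
        unfolding sum_insert_fun_upd[OF insert.hyps]
        using has_sum_cmult_right[OF insert.IH, of "q ^ k"] by (simp add: power_add)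
    next
      show "((\<lambda>k. q ^ k * (1 / (1 - q)) ^ card A) has_sum (1 / (1 - q)) ^ card (insert b A)) UNIV"
        using has_sum_cmult_left[OF geo, of "(1 / (1 - q)) ^ card A"] insert by simp
    qed (use insert assms in auto)
  qed
  from this[OF finite, of UNIV] show ?thesis by simp
qed

text \<open>Newton's binomial series with exponent -L at -t; the signs cancel, and the Pochhammer
  symbol is a quotient of Gamma values.\<close>

lemma has_sum_negative_binomial:
  fixes t L :: real
  assumes "0 \<le> t" "t < 1" "L > 0"
  shows "((\<lambda>k. Gamma (L + real k) / (fact k * Gamma L) * t ^ k) has_sum (1 - t) powr (- L)) UNIV"
proof (rule sums_nonneg_imp_has_sum)
  have L: "L \<notin> \<int>\<^sub>\<le>\<^sub>0" using assms(3) by (auto elim!: nonpos_Ints_cases)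
  have "(\<lambda>k. ((- L) gchoose k) * (- t) ^ k) sums (1 + - t) powr (- L)"
    using assms by (intro gen_binomial_real) auto
  moreover have "((- L) gchoose k) * (- t) ^ k = Gamma (L + real k) / (fact k * Gamma L) * t ^ k" for k
  proof -
    have "(- 1 :: real) ^ k * (- 1) ^ k = 1" by (simp flip: power_add mult_2)
    moreover have "((- L) gchoose k) * (- t) ^ k = ((- 1) ^ k * (- 1) ^ k) * (pochhammer L k / fact k * t ^ k)"
      by (simp add: gbinomial_pochhammer power_minus[of t] mult_ac)
    ultimately show ?thesis using pochhammer_Gamma[OF L, of k] by (simp add: mult_ac)
  qed
  ultimately show "(\<lambda>k. Gamma (L + real k) / (fact k * Gamma L) * t ^ k) sums (1 - t) powr (- L)" by simp
  show "0 \<le> Gamma (L + real k) / (fact k * Gamma L) * t ^ k" for k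
    using assms by (intro mult_nonneg_nonneg divide_nonneg_nonneg) (auto intro!: Gamma_real_nonneg add_pos_nonneg less_imp_le)
qed

text \<open>The covariance kernel on the diagonal, with x_j in the role of |z_j|^2. Summing over the
  coordinates of A with the entry k at b fixed is the same problem with parameter L + k, hence the
  induction for arbitrary L; the sum over k is then a negative binomial series at x_b / (1 -
  s).\<close>

lemma has_sum_hcoef:
  fixes x :: "'n::finite \<Rightarrow> real"
  assumes "\<And>j. x j \<ge> 0" "(\<Sum>j\<in>UNIV. x j) < 1" "L > 0"
  shows "((\<lambda>\<alpha>. hcoef L \<alpha> * (\<Prod>j\<in>UNIV. x j ^ \<alpha> j)) has_sum (1 - (\<Sum>j\<in>UNIV. x j)) powr (- L)) UNIV"
proof -
  have G: "Gamma (K + real m) > 0" if "K > 0" for K :: real and m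
    using that by (intro Gamma_real_pos add_pos_nonneg) auto
  have G0: "Gamma K > 0" if "K > 0" for K :: real using that by (rule Gamma_real_pos)
  have "((\<lambda>\<alpha>. Gamma (L + real (\<Sum>j\<in>A. \<alpha> j)) / ((\<Prod>j\<in>A. fact (\<alpha> j)) * Gamma L) * (\<Prod>j\<in>A. x j ^ \<alpha> j))
      has_sum (1 - (\<Sum>j\<in>A. x j)) powr (- L)) {\<alpha>. \<forall>j. j \<notin> A \<longrightarrow> \<alpha> j = 0}"
    if "finite A" "L > 0" for A and L :: real
    using that
  proof (induction A arbitrary: L)
    case empty
    have "{\<alpha>. \<forall>j. \<alpha> j = 0} = {\<lambda>_ :: 'n. 0 :: nat}" by auto
    then show ?case
      using G0[OF empty] has_sum_singleton[of "\<lambda>_. 1 :: real" "\<lambda>_ :: 'n. 0 :: nat"] by simp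
  next
    case (insert b A)
    define s where "s = (\<Sum>j\<in>A. x j)"
    have "(\<Sum>j\<in>insert b A. x j) \<le> (\<Sum>j\<in>UNIV. x j)"
      by (rule sum_mono2) (use assms in auto)
    then have s: "s \<ge> 0" "x b + s < 1"
      using insert assms by (auto simp: s_def intro!: sum_nonneg)
    have s1: "s < 1" using s assms(1)[of b] by linarith
    show ?case
    proof (rule has_sum_insert_coordinate[where g = "\<lambda>k. (1 - s) powr (- L) * (Gamma (L + real k) / (fact k * Gamma L) * (x b / (1 - s)) ^ k)"])
      fix k
      have upd: "(\<Sum>j\<in>insert b A. (\<alpha>(b := k)) j) = k + (\<Sum>j\<in>A. \<alpha> j)"
        "(\<Prod>j\<in>insert b A. fact ((\<alpha>(b := k)) j)) = (fact k * (\<Prod>j\<in>A. fact (\<alpha> j)) :: real)"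
        "(\<Prod>j\<in>insert b A. x j ^ (\<alpha>(b := k)) j) = x b ^ k * (\<Prod>j\<in>A. x j ^ \<alpha> j)" for \<alpha> :: "'n \<Rightarrow> nat"
        using sum_insert_fun_upd[OF insert.hyps, of \<alpha> k]
          prod_insert_fun_upd[OF insert.hyps, of "\<lambda>_. fact" \<alpha> k]
          prod_insert_fun_upd[OF insert.hyps, of "\<lambda>j m. x j ^ m" \<alpha> k] by auto
      have "((\<lambda>\<alpha>. (Gamma (L + real k) / (fact k * Gamma L) * x b ^ k) *
          (Gamma (L + real k + real (\<Sum>j\<in>A. \<alpha> j)) / ((\<Prod>j\<in>A. fact (\<alpha> j)) * Gamma (L + real k)) * (\<Prod>j\<in>A. x j ^ \<alpha> j)))
        has_sum (Gamma (L + real k) / (fact k * Gamma L) * x b ^ k) * (1 - s) powr (- (L + real k))) {\<alpha>. \<forall>j. j \<notin> A \<longrightarrow> \<alpha> j = 0}"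
        unfolding s_def by (intro has_sum_cmult_right insert.IH) (use insert.prems in auto)
      also have "(Gamma (L + real k) / (fact k * Gamma L) * x b ^ k) * (1 - s) powr (- (L + real k))
          = (1 - s) powr (- L) * (Gamma (L + real k) / (fact k * Gamma L) * (x b / (1 - s)) ^ k)"
        using s1 by (simp add: powr_diff powr_realpow power_divide)
      also have "(\<lambda>\<alpha>. (Gamma (L + real k) / (fact k * Gamma L) * x b ^ k) *
          (Gamma (L + real k + real (\<Sum>j\<in>A. \<alpha> j)) / ((\<Prod>j\<in>A. fact (\<alpha> j)) * Gamma (L + real k)) * (\<Prod>j\<in>A. x j ^ \<alpha> j)))
        = (\<lambda>\<alpha>. Gamma (L + real (\<Sum>j\<in>insert b A. (\<alpha>(b := k)) j)) / ((\<Prod>j\<in>insert b A. fact ((\<alpha>(b := k)) j)) * Gamma L)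
            * (\<Prod>j\<in>insert b A. x j ^ (\<alpha>(b := k)) j))"
        unfolding upd using G[OF insert.prems, of k] by (simp add: add.assoc mult_ac)
      finally show "((\<lambda>\<alpha>. Gamma (L + real (\<Sum>j\<in>insert b A. (\<alpha>(b := k)) j)) / ((\<Prod>j\<in>insert b A. fact ((\<alpha>(b := k)) j)) * Gamma L)
            * (\<Prod>j\<in>insert b A. x j ^ (\<alpha>(b := k)) j))
          has_sum (1 - s) powr (- L) * (Gamma (L + real k) / (fact k * Gamma L) * (x b / (1 - s)) ^ k)) {\<alpha>. \<forall>j. j \<notin> A \<longrightarrow> \<alpha> j = 0}" .
    next
      have xb: "0 \<le> x b / (1 - s)" "x b / (1 - s) < 1" using s s1 assms(1)[of b] by (auto simp: field_simps)
      have "(1 - s) * (1 - x b / (1 - s)) = 1 - (x b + s)" using s1 by (simp add: field_simps)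
      then have "(1 - s) powr (- L) * (1 - x b / (1 - s)) powr (- L) = (1 - (\<Sum>j\<in>insert b A. x j)) powr (- L)"
        using s1 xb insert.hyps by (subst powr_mult[symmetric]) (auto simp: s_def)
      with has_sum_cmult_right[OF has_sum_negative_binomial[OF xb insert.prems], of "(1 - s) powr (- L)"]
      show "((\<lambda>k. (1 - s) powr (- L) * (Gamma (L + real k) / (fact k * Gamma L) * (x b / (1 - s)) ^ k))
          has_sum (1 - (\<Sum>j\<in>insert b A. x j)) powr (- L)) UNIV" by simp
    next
      show "0 \<le> Gamma (L + real (\<Sum>j\<in>insert b A. \<alpha> j)) / ((\<Prod>j\<in>insert b A. fact (\<alpha> j)) * Gamma L) * (\<Prod>j\<in>insert b A. x j ^ \<alpha> j)" for \<alpha>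
        using G[OF insert.prems, THEN less_imp_le] G0[OF insert.prems] assms(1)
        by (intro mult_nonneg_nonneg divide_nonneg_nonneg prod_nonneg) (auto intro: prod_nonneg simp del: of_nat_sum)
    qed (use insert in auto)
  qed
  from this[OF finite assms(3), of UNIV] show ?thesis by (simp add: hcoef_def)
qed

lemma hcoef_pos: "L > 0 \<Longrightarrow> hcoef L \<alpha> > 0"
  unfolding hcoef_def by (intro divide_pos_pos mult_pos_pos prod_pos Gamma_real_pos add_pos_nonneg) (auto simp del: of_nat_sum)

lemma hcoef_term_le:
  fixes x :: "'n::finite \<Rightarrow> real"
  assumes "\<And>j. x j \<ge> 0" "(\<Sum>j\<in>UNIV. x j) < 1" "L > 0"
  shows "hcoef L \<alpha> * (\<Prod>j\<in>UNIV. x j ^ \<alpha> j) \<le> (1 - (\<Sum>j\<in>UNIV. x j)) powr (- L)"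
proof -
  have "hcoef L \<beta> * (\<Prod>j\<in>UNIV. x j ^ \<beta> j) \<ge> 0" for \<beta>
    using hcoef_pos[OF assms(3), of \<beta>] assms(1) by (intro mult_nonneg_nonneg prod_nonneg) auto
  then show ?thesis
    by (intro has_sum_mono_neutral[OF has_sum_singleton has_sum_hcoef[OF assms]]) auto
qed

text \<open>Raising one entry by 1 multiplies the coefficient by (L + |\<alpha>|) / (\<alpha>_b +
  1), which is at least 1 as \<alpha>_b \<le> |\<alpha>| and L \<ge> 1. All coefficients in a box
  above the dominant index are therefore at least as large as its own.\<close>

lemma hcoef_mono:
  fixes \<alpha> \<gamma> :: "'n::finite \<Rightarrow> nat"
  assumes "L \<ge> 1"
  shows "hcoef L \<alpha> \<le> hcoef L (\<lambda>j. \<alpha> j + \<gamma> j)"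
proof -
  have step: "hcoef L \<alpha> \<le> hcoef L (\<alpha>(b := Suc (\<alpha> b)))" for \<alpha> :: "'n \<Rightarrow> nat" and b
  proof -
    define m where "m = (mdeg \<alpha>)"
    have S: "(\<Sum>j\<in>UNIV. (\<alpha>(b := Suc (\<alpha> b))) j) = Suc m"
      using sum_insert_fun_upd[of "UNIV - {b}" b \<alpha> "Suc (\<alpha> b)"] sum.remove[of UNIV b \<alpha>]
      by (simp add: m_def insert_absorb)
    have P: "(\<Prod>j\<in>UNIV. fact ((\<alpha>(b := Suc (\<alpha> b))) j)) = (real (Suc (\<alpha> b)) * (\<Prod>j\<in>UNIV. fact (\<alpha> j)) :: real)"
      using prod_insert_fun_upd[of "UNIV - {b}" b "\<lambda>_. fact :: nat \<Rightarrow> real" \<alpha> "Suc (\<alpha> b)"]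
        prod.remove[of UNIV b "\<lambda>j. fact (\<alpha> j) :: real"]
      by (simp add: insert_absorb)
    have Lm: "L + real m > 0" using assms by (simp add: add_pos_nonneg)
    have Gam: "Gamma (L + real (Suc m)) = (L + real m) * Gamma (L + real m)"
    proof -
      have "L + real m \<notin> \<int>\<^sub>\<le>\<^sub>0" using Lm by (auto elim!: nonpos_Ints_cases)
      from Gamma_plus1[OF this] show ?thesis by (simp add: add_ac)
    qed
    have "\<alpha> b \<le> m" unfolding m_def by (rule member_le_sum) auto
    then have q: "1 \<le> (L + real m) / real (Suc (\<alpha> b))" using assms by (simp add: field_simps)
    have "hcoef L (\<alpha>(b := Suc (\<alpha> b))) = ((L + real m) / real (Suc (\<alpha> b))) * hcoef L \<alpha>"
      unfolding hcoef_def S P Gam m_def[symmetric] by (simp del: of_nat_Suc)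
    moreover have "1 * hcoef L \<alpha> \<le> \<dots>"
      using q hcoef_pos[of L \<alpha>] assms by (intro mult_right_mono) auto
    ultimately show ?thesis by simp
  qed
  have iter: "hcoef L \<alpha> \<le> hcoef L (\<alpha>(b := \<alpha> b + k))" for \<alpha> :: "'n \<Rightarrow> nat" and b k
  proof (induction k)
    case (Suc k)
    have "hcoef L (\<alpha>(b := \<alpha> b + k)) \<le> hcoef L (\<alpha>(b := \<alpha> b + Suc k))"
      using step[of "\<alpha>(b := \<alpha> b + k)" b] by (simp del: fun_upd_apply add: fun_upd_same)
    with Suc show ?case by (rule order_trans)
  qed simp
  have "hcoef L \<alpha> \<le> hcoef L (\<lambda>j. \<alpha> j + (if j \<in> A then \<gamma> j else 0))" if "finite A" for A
    using that
  proof (induction A)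
    case (insert b A)
    have "(\<lambda>j. \<alpha> j + (if j \<in> A then \<gamma> j else 0))(b := \<alpha> b + (if b \<in> A then \<gamma> b else 0) + \<gamma> b)
        = (\<lambda>j. \<alpha> j + (if j \<in> insert b A then \<gamma> j else 0))"
      using insert by (auto simp: fun_eq_iff)
    then show ?case using insert.IH iter[of "\<lambda>j. \<alpha> j + (if j \<in> A then \<gamma> j else 0)" b "\<gamma> b"] by simp
  qed simp
  from this[OF finite, of UNIV] show ?thesis by simp
qed

(* If every term were below a = exp(-eps L) (1-X)^(-L), then interpolating between a and the geometric bound b (obtained from the series at the dilated point s x) would make the whole series smaller than its value. *)
lemma exists_dominant_multi_index:
  fixes x :: "'n::finite \<Rightarrow> real"
  assumes x: "\<And>j. x j \<ge> 0" "(\<Sum>j\<in>UNIV. x j) < 1" and \<epsilon>: "\<epsilon> > 0"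
  obtains C L0 where "C > 0" "L0 \<ge> 1"
    "\<And>L. L \<ge> L0 \<Longrightarrow> \<exists>\<alpha>. real (mdeg \<alpha>) \<le> C * L \<and>
        exp (- \<epsilon> * L) * (1 - (\<Sum>j\<in>UNIV. x j)) powr (- L) \<le> hcoef L \<alpha> * (\<Prod>j\<in>UNIV. x j ^ \<alpha> j)"
proof -
  define X where "X = (\<Sum>j\<in>UNIV. x j)"
  have X: "0 \<le> X" "X < 1" using x by (auto simp: X_def intro!: sum_nonneg)
  \<comment> \<open>1 / s is the midpoint of X and 1. The value of the series at s x exceeds that at
    x by exactly the factor (1 + X)^L, which is at most exp L.\<close>
  define s where "s = 2 / (1 + X)"
  have s: "s > 1" "s * X < 1" "1 - s * X = (1 - X) / (1 + X)" using X by (auto simp: s_def field_simps)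
  define p where "p = - ln (1 - X)"
  define l where "l = ln (1 + X)"
  have l: "0 \<le> l" "l \<le> 1" using X ln_add_one_self_le_self[of X] by (auto simp: l_def)
  \<comment> \<open>The weight of the interpolation: (1 - \<theta>)(p - \<epsilon>) + \<theta>(p +
    l) = p - \<epsilon> + \<theta>(\<epsilon> + l), and
    \<open>\<theta> * (\<epsilon> + 1) = \<epsilon> / 2\<close> keeps half of the gain.\<close>
  define \<theta> where "\<theta> = \<epsilon> / (2 * (\<epsilon> + 1))"
  have \<theta>: "0 < \<theta>" "\<theta> < 1" using \<epsilon> by (auto simp: \<theta>_def field_simps)
  define q where "q = s powr (- \<theta>)"
  have q: "0 < q" "q < 1" using s \<theta> by (auto simp: q_def powr_less_one)
  define G where "G = (1 / (1 - q)) ^ CARD('n)"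
  have "G > 0" using q by (simp add: G_def)
  define C where "C = (1 + \<epsilon>) / ln s"
  define L0 where "L0 = max 1 (2 * ln G / \<epsilon> + 1)"
  have main: "\<exists>\<alpha>. real (mdeg \<alpha>) \<le> C * L \<and> exp (- \<epsilon> * L) * (1 - X) powr (- L) \<le> hcoef L \<alpha> * (\<Prod>j\<in>UNIV. x j ^ \<alpha> j)"
    if L: "L \<ge> L0" for L
  proof -
    have L1: "L \<ge> 1" "L * \<epsilon> > 2 * ln G" using L \<epsilon> by (auto simp: L0_def field_simps)
    define T where "T \<alpha> = hcoef L \<alpha> * (\<Prod>j\<in>UNIV. x j ^ \<alpha> j)" for \<alpha> :: "'n \<Rightarrow> nat"
    have T_nonneg: "T \<alpha> \<ge> 0" for \<alpha>
      unfolding T_def using hcoef_pos[of L \<alpha>] L1 x(1) by (intro mult_nonneg_nonneg prod_nonneg) auto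
    define a where "a = exp (L * (p - \<epsilon>))"
    have X_powr: "(1 - X) powr (- L) = exp (L * p)" using X by (simp add: powr_def p_def)
    have a_eq: "exp (- \<epsilon> * L) * (1 - X) powr (- L) = a"
      unfolding X_powr a_def by (simp add: algebra_simps flip: exp_add)
    have sX_powr: "(1 - s * X) powr (- L) = exp (L * (p + l))"
      using X unfolding s(3) powr_def by (simp add: p_def l_def ln_div algebra_simps)
    have T_le: "T \<alpha> * s ^ (mdeg \<alpha>) \<le> exp (L * (p + l))" for \<alpha>
    proof -
      have "T \<alpha> * s ^ (mdeg \<alpha>) = hcoef L \<alpha> * (\<Prod>j\<in>UNIV. (s * x j) ^ \<alpha> j)"
        by (simp add: T_def power_mult_distrib prod.distrib power_sum mult_ac)
      also have "\<dots> \<le> (1 - (\<Sum>j\<in>UNIV. s * x j)) powr (- L)"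
        using s x L1 by (intro hcoef_term_le) (auto simp: X_def sum_distrib_left)
      also have "\<dots> = exp (L * (p + l))"
        using sX_powr by (simp add: X_def sum_distrib_left)
      finally show ?thesis .
    qed
    have "\<exists>\<alpha>. a \<le> T \<alpha>"
    proof (rule ccontr)
      assume "\<not> (\<exists>\<alpha>. a \<le> T \<alpha>)"
      then have small: "T \<alpha> \<le> a" for \<alpha> by (meson not_le less_imp_le)
      have T_bound: "T \<alpha> \<le> exp (L * p - L * \<epsilon> / 2) * q ^ (mdeg \<alpha>)" for \<alpha>
      proof (cases "T \<alpha> = 0")
        case False
        define k where "k = (mdeg \<alpha>)"
        have T_pos: "T \<alpha> > 0" using T_nonneg[of \<alpha>] False by simp
        have T2: "T \<alpha> \<le> exp (L * (p + l)) * s powr (- real k)"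
          using T_le[of \<alpha>, folded k_def] s(1) by (simp add: powr_minus powr_realpow field_simps)
        have "T \<alpha> = T \<alpha> powr (1 - \<theta>) * T \<alpha> powr \<theta>"
          using T_pos by (simp flip: powr_add)
        also have "\<dots> \<le> a powr (1 - \<theta>) * (exp (L * (p + l)) * s powr (- real k)) powr \<theta>"
          using T_pos small[of \<alpha>] T2 \<theta> by (intro mult_mono powr_mono2) auto
        also have "\<dots> = exp ((1 - \<theta>) * (L * (p - \<epsilon>)) + \<theta> * (L * (p + l))) * q ^ k"
          using s q by (simp add: a_def powr_mult powr_powr exp_powr_real exp_add q_def mult_ac flip: powr_realpow)
        also have "\<dots> \<le> exp (L * p - L * \<epsilon> / 2) * q ^ k"
        proof -
          have "\<theta> * (\<epsilon> + l) \<le> \<theta> * (\<epsilon> + 1)" using \<theta> l by (intro mult_left_mono) auto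
          also have "\<dots> = \<epsilon> / 2" using \<epsilon> by (simp add: \<theta>_def field_simps)
          finally have "L * (\<theta> * (\<epsilon> + l)) \<le> L * (\<epsilon> / 2)" using L1 by (intro mult_left_mono) auto
          then have "(1 - \<theta>) * (L * (p - \<epsilon>)) + \<theta> * (L * (p + l)) \<le> L * p - L * \<epsilon> / 2"
            by (simp add: algebra_simps)
          then show ?thesis using q by (intro mult_right_mono) auto
        qed
        finally show ?thesis by (simp add: k_def)
      qed (use q in simp)
      have sum1: "(T has_sum exp (L * p)) UNIV"
        using has_sum_hcoef[of x L] x L1 unfolding T_def[abs_def] X_powr[symmetric] X_def by simp
      have sum2: "((\<lambda>\<alpha> :: 'n \<Rightarrow> nat. exp (L * p - L * \<epsilon> / 2) * q ^ (mdeg \<alpha>)) has_sum exp (L * p - L * \<epsilon> / 2) * G) UNIV"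
        unfolding G_def using q by (intro has_sum_cmult_right has_sum_geometric_multi_index) auto
      have "exp (L * p) \<le> exp (L * p - L * \<epsilon> / 2) * G"
        by (rule has_sum_mono[OF sum1 sum2 T_bound])
      also have "\<dots> = exp (L * p - L * \<epsilon> / 2 + ln G)" using \<open>G > 0\<close> by (simp add: exp_add)
      finally show False using L1 by simp
    qed
    then obtain \<alpha> where \<alpha>: "a \<le> T \<alpha>" by auto
    \<comment> \<open>The degree bound: at the dilated point the dominant term is multiplied by s^k
      and still cannot exceed the whole series there.\<close>
    define k where "k = (mdeg \<alpha>)"
    have "a * s ^ k \<le> exp (L * (p + l))"
      using \<alpha> s T_le[of \<alpha>] by (intro order_trans[OF mult_right_mono T_le[of \<alpha>, folded k_def]]) auto
    also have "a * s ^ k = exp (L * (p - \<epsilon>) + real k * ln s)"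
      using s by (simp add: a_def exp_add exp_of_nat_mult)
    finally have "real k * ln s \<le> L * (l + \<epsilon>)" by (simp add: algebra_simps)
    also have "\<dots> \<le> L * (1 + \<epsilon>)" using l L1 by (intro mult_left_mono) auto
    finally have "real k \<le> C * L" using s by (simp add: C_def field_simps)
    then show ?thesis using \<alpha> unfolding a_eq by (auto simp: T_def k_def)
  qed
  show ?thesis
  proof (rule that[of C L0])
    show "C > 0" using s \<epsilon> by (simp add: C_def)
    show "L0 \<ge> 1" by (simp add: L0_def)
  qed (use main in \<open>simp add: X_def\<close>)
qed

(* The weights compute the coefficient of degree d of a polynomial of degree at most m: discretised Cauchy integrals over the roots of unity give its Taylor coefficients at w, and the binomial theorem translates them back to the origin. *)
lemma interpolation_weights:
  fixes w :: complex and r :: real and m :: nat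
  assumes "cmod w \<le> 1" "0 < r" "r \<le> 1"
  obtains x :: "nat \<Rightarrow> complex" and \<Lambda> :: "nat \<Rightarrow> nat \<Rightarrow> complex" where
    "\<And>k. cmod (x k - w) = r" "\<And>d k. cmod (\<Lambda> d k) \<le> (2 / r) ^ m"
    "\<And>d e. d \<le> m \<Longrightarrow> e \<le> m \<Longrightarrow> (\<Sum>k\<le>m. \<Lambda> d k * x k ^ e) = (if d = e then 1 else 0)"
proof -
  define \<zeta> where "\<zeta> = cis (2 * pi / real (Suc m))"
  define u where "u k = of_real r * \<zeta> ^ k" for k
  \<comment> \<open>\<open>A d i\<close> is the coefficient of z^d in (z - w)^i. For i < d the
    truncated exponent is harmless, as the binomial coefficient is 0.\<close>
  define A where "A d i = of_nat (i choose d) * (- w) ^ (i - d)" for d i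
  define \<Lambda> where "\<Lambda> d k = (\<Sum>i\<le>m. A d i * inverse (u k ^ i)) / of_nat (Suc m)" for d k
  have \<zeta>_norm: "cmod \<zeta> = 1" by (simp add: \<zeta>_def)
  then have \<zeta>0: "\<zeta> \<noteq> 0" by auto
  have u_norm: "cmod (u k) = r" for k using assms by (simp add: u_def norm_mult norm_power \<zeta>_norm)
  have \<zeta>_pow: "\<zeta> ^ Suc m = 1" by (simp add: \<zeta>_def Complex.DeMoivre del: power_Suc of_nat_Suc)
  have \<zeta>_inj: "p = i" if "\<zeta> ^ p = \<zeta> ^ i" "p \<le> m" "i \<le> m" for p i
  proof -
    have eq: "\<zeta> ^ k = cis (2 * pi * real k / real (Suc m))" for k
      by (simp add: \<zeta>_def Complex.DeMoivre mult_ac del: of_nat_Suc)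
    have "inj_on (\<lambda>k. cis (2 * pi * real k / real (Suc m))) {..<Suc m}"
      using Complex.bij_betw_roots_unity[of "Suc m"] by (simp add: bij_betw_def)
    then show ?thesis using that unfolding eq by (auto dest!: inj_onD)
  qed
  \<comment> \<open>The \<open>Suc m\<close> roots of unity separate the exponents 0 to m exactly:
    two of these differ by less than \<open>Suc m\<close>, so no aliasing occurs.\<close>
  have orth: "(\<Sum>k\<le>m. u k ^ p * inverse (u k ^ i)) = (if p = i then of_nat (Suc m) else 0)"
    if "p \<le> m" "i \<le> m" for p i
  proof (cases "p = i")
    case True
    have "u k \<noteq> 0" for k using u_norm[of k] assms by auto
    then show ?thesis using True by simp
  next
    case False
    define t where "t = \<zeta> ^ p * inverse (\<zeta> ^ i)"
    have "t \<noteq> 1" using \<zeta>_inj[OF _ that] False \<zeta>0 by (auto simp: t_def field_simps)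
    have "\<zeta> ^ (k * Suc m) = 1" for k by (simp add: power_mult[symmetric] mult.commute[of k] power_mult \<zeta>_pow del: power_Suc mult_Suc mult_Suc_right)
    then have "t ^ Suc m = 1"
      unfolding t_def power_mult_distrib power_inverse power_mult[symmetric] by (simp del: power_Suc mult_Suc mult_Suc_right)
    then have "(\<Sum>k<Suc m. t ^ k) = 0"
      using geometric_sum[OF \<open>t \<noteq> 1\<close>, of "Suc m"] by simp
    moreover have "u k ^ p * inverse (u k ^ i) = (of_real r ^ p * inverse (of_real r ^ i)) * t ^ k" for k
      by (simp add: u_def t_def power_mult_distrib power_inverse mult_ac flip: power_mult)
    ultimately show ?thesis
      using False by (simp add: lessThan_Suc_atMost flip: sum_distrib_left)
  qed
  have bound: "cmod (\<Lambda> d k) \<le> (2 / r) ^ m" for d k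
  proof -
    have weight: "cmod (A d i * inverse (u k ^ i)) \<le> (2 / r) ^ m" if "i \<le> m" for i
    proof -
      have "real (i choose d) \<le> 2 ^ i"
        by (metis binomial_le_pow2 of_nat_le_iff of_nat_numeral of_nat_power)
      then have "real (i choose d) * cmod w ^ (i - d) \<le> 2 ^ i * 1"
        using assms by (intro mult_mono power_le_one) auto
      then have "cmod (A d i * inverse (u k ^ i)) \<le> 2 ^ i * inverse (r ^ i)"
        using assms by (simp add: A_def norm_mult norm_power norm_inverse u_norm mult_right_mono)
      also have "\<dots> = (2 / r) ^ i" by (simp add: power_divide divide_inverse power_inverse)
      also have "\<dots> \<le> (2 / r) ^ m" using assms that by (intro power_increasing) (auto simp: field_simps)
      finally show ?thesis .
    qed
    have "cmod (\<Sum>i\<le>m. A d i * inverse (u k ^ i)) \<le> (\<Sum>i\<le>m. (2 / r) ^ m)"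
      by (intro sum_norm_le weight) auto
    then show ?thesis
      by (simp add: \<Lambda>_def norm_divide divide_le_eq mult.commute del: of_nat_Suc)
  qed
  have interp: "(\<Sum>k\<le>m. \<Lambda> d k * (w + u k) ^ e) = (if d = e then 1 else 0)" if de: "d \<le> m" "e \<le> m" for d e
  proof -
    have "of_nat (Suc m) * (\<Sum>k\<le>m. \<Lambda> d k * (w + u k) ^ e)
        = (\<Sum>k\<le>m. (\<Sum>i\<le>m. A d i * inverse (u k ^ i)) * (\<Sum>p\<le>e. of_nat (e choose p) * u k ^ p * w ^ (e - p)))"
    proof -
      have binom: "(w + u k) ^ e = (\<Sum>p\<le>e. of_nat (e choose p) * u k ^ p * w ^ (e - p))" for k
        unfolding add.commute[of w] by (rule binomial_ring)
      show ?thesis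
        unfolding \<Lambda>_def binom[symmetric] sum_distrib_left[of "of_nat (Suc m)"]
        by (intro sum.cong refl) (simp del: of_nat_Suc)
    qed
    also have "\<dots> = (\<Sum>k\<le>m. \<Sum>p\<le>e. \<Sum>i\<le>m. (of_nat (e choose p) * w ^ (e - p) * A d i) * (u k ^ p * inverse (u k ^ i)))"
      unfolding sum_product by (subst sum.swap) (intro sum.cong refl, simp only: mult_ac)
    also have "\<dots> = (\<Sum>p\<le>e. \<Sum>k\<le>m. \<Sum>i\<le>m. (of_nat (e choose p) * w ^ (e - p) * A d i) * (u k ^ p * inverse (u k ^ i)))"
      by (rule sum.swap)
    also have "\<dots> = (\<Sum>p\<le>e. \<Sum>i\<le>m. (of_nat (e choose p) * w ^ (e - p) * A d i) * (\<Sum>k\<le>m. u k ^ p * inverse (u k ^ i)))"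
      unfolding sum_distrib_left by (intro sum.cong refl sum.swap)
    also have "\<dots> = (\<Sum>p\<le>e. \<Sum>i\<le>m. if p = i then (of_nat (e choose p) * w ^ (e - p) * A d i) * of_nat (Suc m) else 0)"
      using de by (intro sum.cong refl) (simp add: orth del: of_nat_Suc)
    also have "\<dots> = (\<Sum>p\<le>e. (of_nat (e choose p) * w ^ (e - p) * A d p) * of_nat (Suc m))"
      using de by (intro sum.cong refl) simp
    also have "\<dots> = of_nat (Suc m) * (\<Sum>p\<le>e. of_nat (e choose p) * w ^ (e - p) * A d p)"
      by (simp add: sum_distrib_left mult_ac del: of_nat_Suc)
    \<comment> \<open>The right-hand side is the coefficient of z^d in ((z - w) + w)^e, that is, in
      z^e.\<close>
    finally have 1: "(\<Sum>k\<le>m. \<Lambda> d k * (w + u k) ^ e) = (\<Sum>p\<le>e. of_nat (e choose p) * w ^ (e - p) * A d p)"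
      unfolding mult_cancel_left by (simp del: of_nat_Suc)
    show ?thesis
    proof (cases "d \<le> e")
      case False
      then show ?thesis unfolding 1 by (auto simp: A_def intro!: sum.neutral)
    next
      case True
      have "(\<Sum>p\<le>e. of_nat (e choose p) * w ^ (e - p) * A d p) = (\<Sum>p\<in>{d..e}. of_nat (e choose p) * w ^ (e - p) * A d p)"
        by (rule sum.mono_neutral_right) (auto simp: A_def)
      also have "\<dots> = (\<Sum>p\<in>{d..e}. of_nat (e choose d) * (of_nat ((e - d) choose (p - d)) * (- w) ^ (p - d) * w ^ ((e - d) - (p - d))))"
      proof (rule sum.cong[OF refl])
        fix p assume p: "p \<in> {d..e}"
        have "of_nat (e choose p) * of_nat (p choose d) = (of_nat (e choose d) * of_nat ((e - d) choose (p - d)) :: complex)"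
          using choose_mult[of d p e] p by (metis atLeastAtMost_iff of_nat_mult)
        then show "of_nat (e choose p) * w ^ (e - p) * A d p
            = of_nat (e choose d) * (of_nat ((e - d) choose (p - d)) * (- w) ^ (p - d) * w ^ ((e - d) - (p - d)))"
          using p by (simp add: A_def mult_ac)
      qed
      also have "\<dots> = (\<Sum>l\<le>e - d. of_nat (e choose d) * (of_nat ((e - d) choose l) * (- w) ^ l * w ^ ((e - d) - l)))"
        by (rule sum.reindex_bij_witness[of _ "\<lambda>l. l + d" "\<lambda>p. p - d"]) (use True in auto)
      also have "\<dots> = of_nat (e choose d) * (- w + w) ^ (e - d)"
        unfolding binomial_ring sum_distrib_left ..
      finally show ?thesis unfolding 1 using True by (auto simp: power_0_left)
    qed
  qed
  show ?thesis
  proof (rule that[of "\<lambda>k. w + u k" \<Lambda>])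
    show "cmod (w + u k - w) = r" for k by (simp add: u_norm)
  qed (use bound interp in auto)
qed

section \<open>Gaussian estimates and measurability\<close>

abbreviation std_gaussian_density :: "complex \<Rightarrow> ennreal" where
  "std_gaussian_density \<equiv> \<lambda>z. ennreal (exp (- (cmod z)\<^sup>2) / pi)"

text \<open>The factor halves the exponent of the density; the substitution of sqrt 2 z for z
  restores it with Jacobian 2, the plane having real dimension 2.\<close>

lemma (in prob_space) nn_integral_exp_half_norm_sq_gaussian:
  assumes X: "distributed M lborel X std_gaussian_density"
  shows "(\<integral>\<^sup>+\<omega>. ennreal (exp ((cmod (X \<omega>))\<^sup>2 / 2)) \<partial>M) = 2"
proof -
  have one: "(\<integral>\<^sup>+z. std_gaussian_density z \<partial>lborel) = 1"
  proof -
    have "(\<integral>\<^sup>+z. std_gaussian_density z * 1 \<partial>lborel) = (\<integral>\<^sup>+\<omega>. 1 \<partial>M)"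
      by (rule distributed_nn_integral[OF X]) simp
    then show ?thesis by (simp add: emeasure_space_1)
  qed
  have two: "(sqrt 2)\<^sup>2 = (2 :: real)" by simp
  have "(\<integral>\<^sup>+\<omega>. ennreal (exp ((cmod (X \<omega>))\<^sup>2 / 2)) \<partial>M)
      = (\<integral>\<^sup>+z. std_gaussian_density z * ennreal (exp ((cmod z)\<^sup>2 / 2)) \<partial>lborel)"
    by (rule distributed_nn_integral[OF X, symmetric]) measurable
  also have "\<dots> = (\<integral>\<^sup>+z. ennreal (exp (- (cmod z)\<^sup>2 / 2) / pi) \<partial>lborel)"
    by (intro nn_integral_cong) (simp add: ennreal_mult[symmetric] field_simps flip: exp_add)
  also have "\<dots> = (\<integral>\<^sup>+z. ennreal (exp (- (cmod z)\<^sup>2 / 2) / pi) \<partial>(density (distr lborel borel (\<lambda>x. 0 + sqrt 2 *\<^sub>R x)) (\<lambda>_. \<bar>sqrt 2\<bar> ^ DIM(complex))))"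
    by (subst lborel_affine[of "sqrt 2" 0]) auto
  also have "\<dots> = (\<integral>\<^sup>+z. 2 * std_gaussian_density z \<partial>lborel)"
    by (subst nn_integral_density, simp, simp, subst nn_integral_distr)
       (auto intro!: nn_integral_cong simp: power_mult_distrib two)
  also have "\<dots> = 2" by (subst nn_integral_cmult) (auto simp: one)
  finally show ?thesis .
qed

text \<open>Markov's inequality for exp (|X|^2 / 2), whose mean is 2.\<close>

lemma (in prob_space) gaussian_tail:
  assumes X: "distributed M lborel X std_gaussian_density" and "t \<ge> 0"
  shows "emeasure M {\<omega>\<in>space M. cmod (X \<omega>) > t} \<le> ennreal (2 * exp (- t\<^sup>2 / 2))"
proof -
  have [measurable]: "X \<in> borel_measurable M" using distributed_measurable[OF X] by simp
  have "emeasure M {\<omega>\<in>space M. cmod (X \<omega>) > t} = (\<integral>\<^sup>+\<omega>. indicator {\<omega>\<in>space M. cmod (X \<omega>) > t} \<omega> \<partial>M)"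
    by simp
  also have "\<dots> \<le> (\<integral>\<^sup>+\<omega>. ennreal (exp (- t\<^sup>2 / 2)) * ennreal (exp ((cmod (X \<omega>))\<^sup>2 / 2)) \<partial>M)"
  proof (intro nn_integral_mono)
    fix \<omega>
    have "1 \<le> exp (- t\<^sup>2 / 2) * exp ((cmod (X \<omega>))\<^sup>2 / 2)" if "cmod (X \<omega>) > t"
      using power_mono[of t "cmod (X \<omega>)" 2] that \<open>t \<ge> 0\<close> by (simp flip: exp_add)
    then show "indicator {\<omega>\<in>space M. cmod (X \<omega>) > t} \<omega> \<le> ennreal (exp (- t\<^sup>2 / 2)) * ennreal (exp ((cmod (X \<omega>))\<^sup>2 / 2))"
      by (auto simp: indicator_def simp flip: ennreal_mult)
  qed
  also have "\<dots> = ennreal (exp (- t\<^sup>2 / 2)) * 2"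
    by (simp add: nn_integral_cmult nn_integral_exp_half_norm_sq_gaussian[OF X])
  finally show ?thesis by (simp add: ennreal_mult mult.commute)
qed

lemma (in prob_space) nn_integral_norm_gaussian:
  assumes X: "distributed M lborel X std_gaussian_density"
  shows "(\<integral>\<^sup>+\<omega>. ennreal (cmod (X \<omega>)) \<partial>M) \<le> 2"
proof -
  have "(\<integral>\<^sup>+\<omega>. ennreal (cmod (X \<omega>)) \<partial>M) \<le> (\<integral>\<^sup>+\<omega>. ennreal (exp ((cmod (X \<omega>))\<^sup>2 / 2)) \<partial>M)"
  proof (intro nn_integral_mono ennreal_leI)
    fix \<omega>
    have "0 \<le> (cmod (X \<omega>) - 1)\<^sup>2" by simp
    then have "cmod (X \<omega>) \<le> 1 + (cmod (X \<omega>))\<^sup>2 / 2"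
      by (simp add: power2_eq_square algebra_simps)
    also have "\<dots> \<le> exp ((cmod (X \<omega>))\<^sup>2 / 2)" by (rule exp_ge_add_one_self)
    finally show "cmod (X \<omega>) \<le> exp ((cmod (X \<omega>))\<^sup>2 / 2)" .
  qed
  then show ?thesis by (simp add: nn_integral_exp_half_norm_sq_gaussian[OF X])
qed

text \<open>The density is at most 1 / pi. The bound is uniform in the centre c, which later depends
  on the remaining coefficients.\<close>

lemma (in prob_space) gaussian_small_ball:
  assumes X: "distributed M lborel X std_gaussian_density" and "t \<ge> 0"
  shows "emeasure (distr M borel X) (cball c t) \<le> ennreal (t\<^sup>2)"
proof -
  have [measurable]: "X \<in> borel_measurable M" using distributed_measurable[OF X] by simp
  have "emeasure (distr M borel X) (cball c t) = emeasure (distr M lborel X) (cball c t)"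
    by (simp add: emeasure_distr)
  also have "\<dots> = (\<integral>\<^sup>+z\<in>cball c t. std_gaussian_density z \<partial>lborel)"
    using distributed_distr_eq_density[OF X] by (simp add: emeasure_density)
  also have "\<dots> \<le> (\<integral>\<^sup>+z. ennreal (1 / pi) * indicator (cball c t) z \<partial>lborel)"
    by (intro nn_integral_mono) (auto simp: indicator_def intro!: ennreal_leI divide_right_mono)
  also have "\<dots> = ennreal (1 / pi) * ennreal (pi * t\<^sup>2)"
    using emeasure_cball[OF \<open>t \<ge> 0\<close>, of c] by (subst nn_integral_cmult_indicator) (auto simp: unit_ball_vol_2)
  also have "\<dots> = ennreal (t\<^sup>2)" by (simp flip: ennreal_mult)
  finally show ?thesis .
qed

(* Layer-cake over the dyadic levels. *)
lemma nn_integral_inverse_norm_le: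
  fixes Y :: "'w \<Rightarrow> complex"
  assumes M: "prob_space M" and [measurable]: "Y \<in> borel_measurable M"
    and small: "\<And>t. t > 0 \<Longrightarrow> emeasure M {\<omega>\<in>space M. cmod (Y \<omega>) \<le> t} \<le> ennreal (t\<^sup>2)"
  shows "(\<integral>\<^sup>+\<omega>. ennreal (1 / cmod (Y \<omega>)) \<partial>M) \<le> 5"
proof -
  interpret prob_space M by fact
  let ?A = "\<lambda>k. {\<omega>\<in>space M. cmod (Y \<omega>) \<le> (1/2) ^ k}"
  have "(\<integral>\<^sup>+\<omega>. ennreal (1 / cmod (Y \<omega>)) \<partial>M)
      \<le> (\<integral>\<^sup>+\<omega>. 1 + (\<Sum>k. ennreal (2 * 2 ^ k) * indicator (?A k) \<omega>) \<partial>M)"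
  proof (intro nn_integral_mono)
    fix \<omega> assume \<omega>: "\<omega> \<in> space M"
    show "ennreal (1 / cmod (Y \<omega>)) \<le> 1 + (\<Sum>k. ennreal (2 * 2 ^ k) * indicator (?A k) \<omega>)"
    \<comment> \<open>The zeros of Y belong to the easy case because 1 / 0 = 0.\<close>
    proof (cases "cmod (Y \<omega>) \<ge> 1 \<or> Y \<omega> = 0")
      case True
      then have "1 / cmod (Y \<omega>) \<le> 1" by (auto simp: divide_le_eq)
      then have "ennreal (1 / cmod (Y \<omega>)) \<le> 1" by (metis ennreal_1 ennreal_leI)
      then show ?thesis by (rule order_trans) simp
    next
      case False
      define P where "P k \<longleftrightarrow> (1/2) ^ k < cmod (Y \<omega>)" for k :: nat
      obtain m where "P m" using False real_arch_pow_inv[of "cmod (Y \<omega>)" "1/2"] by (auto simp: P_def)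
      define k where "k = (LEAST m. P m)"
      have k: "P k" unfolding k_def by (rule LeastI) fact
      have "k \<noteq> 0" using k False by (auto simp: P_def intro: ccontr)
      then obtain l where l: "k = Suc l" by (cases k) auto
      have "\<not> P l" using l not_less_Least[of l P] by (simp add: k_def)
      then have *: "cmod (Y \<omega>) \<le> (1/2) ^ l" by (simp add: P_def)
      have "1 / cmod (Y \<omega>) \<le> 2 * 2 ^ l"
        using k False by (simp add: P_def l power_divide field_simps)
      define F where "F k = ennreal (2 * 2 ^ k) * indicator (?A k) \<omega>" for k
      have "ennreal (1 / cmod (Y \<omega>)) \<le> F l"
        using * \<omega> \<open>1 / cmod (Y \<omega>) \<le> 2 * 2 ^ l\<close> by (simp add: ennreal_leI F_def)
      also have "F l \<le> (\<Sum>k. F k)"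
        using sum_le_suminf[of F "{l}"] by simp
      also have "(\<Sum>k. F k) = (\<Sum>k. ennreal (2 * 2 ^ k) * indicator (?A k) \<omega>)"
        by (simp only: F_def)
      finally show ?thesis by (rule order_trans) simp
    qed
  qed
  also have "\<dots> = 1 + (\<Sum>k. ennreal (2 * 2 ^ k) * emeasure M (?A k))"
    by (simp add: nn_integral_add nn_integral_suminf nn_integral_cmult emeasure_space_1)
  also have "\<dots> \<le> 1 + (\<Sum>k. ennreal (2 * (1/2) ^ k))"
  proof (intro add_left_mono suminf_le)
    fix k
    \<comment> \<open>The terms 2 * 2^k * 4^(-k) sum to 4, which with the leading 1 gives the
      constant 5.\<close>
    have "ennreal (2 * 2 ^ k) * emeasure M (?A k) \<le> ennreal (2 * 2 ^ k) * ennreal (((1/2) ^ k)\<^sup>2)"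
      by (intro mult_left_mono small) auto
    also have "\<dots> = ennreal (2 * (1/2) ^ k)"
      by (simp add: power2_eq_square power_divide flip: ennreal_mult)
    finally show "ennreal (2 * 2 ^ k) * emeasure M (?A k) \<le> ennreal (2 * (1/2) ^ k)" .
  qed auto
  also have "(\<Sum>k. ennreal (2 * (1/2) ^ k)) = ennreal (\<Sum>k. 2 * (1/2) ^ k)"
    by (intro suminf_ennreal2 summable_mult summable_geometric) auto
  also have "(\<Sum>k. 2 * (1/2) ^ k) = (4 :: real)"
    by (subst suminf_mult) (auto simp: suminf_geometric)
  finally show ?thesis by simp
qed

text \<open>Fix the coordinates outside J. Then \<rho> only displaces centres, the event is a
  product of discs of radii t_i / s_i, and the product law of the coordinates in J gives the product
  of the small-ball bounds, whatever the fixed values are. Independence of the two blocks allows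
  Fubini's theorem to conclude.\<close>

lemma (in prob_space) independent_gaussians_small_ball:
  fixes a :: "'i \<Rightarrow> 'a \<Rightarrow> complex" and \<rho> :: "'i \<Rightarrow> ('i \<Rightarrow> complex) \<Rightarrow> complex"
  assumes dist: "\<And>i. distributed M lborel (a i) std_gaussian_density"
    and ind: "indep_vars (\<lambda>_. borel) a UNIV"
    and J: "finite J" "J \<noteq> {}"
    and [measurable]: "\<And>i. i \<in> J \<Longrightarrow> \<rho> i \<in> borel_measurable (PiM (- J) (\<lambda>_. borel))"
    and s: "\<And>i. i \<in> J \<Longrightarrow> s i > 0" and t: "\<And>i. i \<in> J \<Longrightarrow> t i \<ge> 0"
  shows "emeasure M {\<omega>\<in>space M. \<forall>i\<in>J. cmod (of_real (s i) * a i \<omega> + \<rho> i (\<lambda>i\<in>-J. a i \<omega>)) \<le> t i}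
      \<le> ennreal (\<Prod>i\<in>J. (t i / s i)\<^sup>2)"
proof -
  have [measurable]: "a i \<in> borel_measurable M" for i using distributed_measurable[OF dist, of i] by simp
  let ?X = "\<lambda>\<omega>. \<lambda>i\<in>J. a i \<omega>" and ?Y = "\<lambda>\<omega>. \<lambda>i\<in>-J. a i \<omega>"
  let ?N1 = "PiM J (\<lambda>_. borel :: complex measure)" and ?N2 = "PiM (- J) (\<lambda>_. borel :: complex measure)"
  have "indep_var ?N1 ?X ?N2 ?Y"
    by (rule indep_var_restrict[OF ind]) auto
  then have XY: "random_variable ?N1 ?X" "random_variable ?N2 ?Y"
    "distr M ?N1 ?X \<Otimes>\<^sub>M distr M ?N2 ?Y = distr M (?N1 \<Otimes>\<^sub>M ?N2) (\<lambda>\<omega>. (?X \<omega>, ?Y \<omega>))"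
    unfolding indep_var_distribution_eq by auto
  note [measurable] = XY(1,2)
  interpret D: product_sigma_finite "\<lambda>i. distr M borel (a i)"
    unfolding product_sigma_finite_def by (intro allI prob_space_imp_sigma_finite prob_space_distr) simp
  interpret DY: prob_space "distr M ?N2 ?Y" by (rule prob_space_distr[OF XY(2)])
  interpret DX: prob_space "distr M ?N1 ?X" by (rule prob_space_distr[OF XY(1)])
  have DX_eq: "distr M ?N1 ?X = PiM J (\<lambda>i. distr M borel (a i))"
    by (subst indep_vars_iff_distr_eq_PiM'[THEN iffD1, OF J(2) _ indep_vars_subset[OF ind]]) auto
  let ?E = "{p \<in> space (?N1 \<Otimes>\<^sub>M ?N2). \<forall>i\<in>J. cmod (of_real (s i) * fst p i + \<rho> i (snd p)) \<le> t i}"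
  have comp: "(\<lambda>p :: ('i \<Rightarrow> complex) \<times> ('i \<Rightarrow> complex). fst p i) \<in> borel_measurable (?N1 \<Otimes>\<^sub>M ?N2)" if "i \<in> J" for i
    using that by measurable
  have comp2: "(\<lambda>p :: ('i \<Rightarrow> complex) \<times> ('i \<Rightarrow> complex). \<rho> i (snd p)) \<in> borel_measurable (?N1 \<Otimes>\<^sub>M ?N2)" if "i \<in> J" for i
    using that by measurable
  have E: "?E \<in> sets (?N1 \<Otimes>\<^sub>M ?N2)"
  proof (intro sets.sets_Collect_finite_All J(1))
    fix i assume "i \<in> J"
    note [measurable] = comp[OF this] comp2[OF this]
    show "{p \<in> space (?N1 \<Otimes>\<^sub>M ?N2). cmod (of_real (s i) * fst p i + \<rho> i (snd p)) \<le> t i} \<in> sets (?N1 \<Otimes>\<^sub>M ?N2)"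
      by (intro borel_measurable_le borel_measurable_norm borel_measurable_add borel_measurable_times) measurable
  qed
  have "{\<omega>\<in>space M. \<forall>i\<in>J. cmod (of_real (s i) * a i \<omega> + \<rho> i (\<lambda>i\<in>-J. a i \<omega>)) \<le> t i}
      = (\<lambda>\<omega>. (?X \<omega>, ?Y \<omega>)) -` ?E \<inter> space M"
    using measurable_space[OF XY(1)] measurable_space[OF XY(2)] by (auto simp: space_pair_measure)
  then have "emeasure M {\<omega>\<in>space M. \<forall>i\<in>J. cmod (of_real (s i) * a i \<omega> + \<rho> i (\<lambda>i\<in>-J. a i \<omega>)) \<le> t i}
      = emeasure (distr M (?N1 \<Otimes>\<^sub>M ?N2) (\<lambda>\<omega>. (?X \<omega>, ?Y \<omega>))) ?E"
    using E by (subst emeasure_distr) auto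
  also have "\<dots> = emeasure (distr M ?N1 ?X \<Otimes>\<^sub>M distr M ?N2 ?Y) ?E" by (simp add: XY(3))
  also have "\<dots> = (\<integral>\<^sup>+y. emeasure (distr M ?N1 ?X) ((\<lambda>x. (x, y)) -` ?E) \<partial>distr M ?N2 ?Y)"
  proof -
    interpret pair_sigma_finite "distr M ?N1 ?X" "distr M ?N2 ?Y" ..
    show ?thesis by (rule emeasure_pair_measure_alt2) (use E in simp)
  qed
  also have "\<dots> \<le> (\<integral>\<^sup>+y. ennreal (\<Prod>i\<in>J. (t i / s i)\<^sup>2) \<partial>distr M ?N2 ?Y)"
  proof (intro nn_integral_mono)
    fix y assume "y \<in> space (distr M ?N2 ?Y)"
    then have y: "y \<in> space ?N2" by simp
    have "(\<lambda>x. (x, y)) -` ?E = (\<Pi>\<^sub>E i\<in>J. cball (- \<rho> i y / of_real (s i)) (t i / s i))"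
    proof -
      have "cmod (of_real (s i) * z + c) \<le> t i \<longleftrightarrow> z \<in> cball (- c / of_real (s i)) (t i / s i)" if "i \<in> J" for i z c
      proof -
        have "of_real (s i) * z + c = of_real (s i) * (z - (- c / of_real (s i)))"
          using s[OF that] by (simp add: field_simps)
        then have "cmod (of_real (s i) * z + c) = s i * dist (- c / of_real (s i)) z"
          using s[OF that] by (simp add: norm_mult dist_norm norm_minus_commute)
        then show ?thesis using s[OF that] by (simp add: field_simps)
      qed
      then show ?thesis
        using y by (auto simp: space_pair_measure space_PiM PiE_iff intro: extensional_arb)
    qed
    also have "emeasure (distr M ?N1 ?X) \<dots> = (\<Prod>i\<in>J. emeasure (distr M borel (a i)) (cball (- \<rho> i y / of_real (s i)) (t i / s i)))"
      unfolding DX_eq using J by (intro D.emeasure_PiM) auto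
    also have "\<dots> \<le> (\<Prod>i\<in>J. ennreal ((t i / s i)\<^sup>2))"
      using s t by (intro prod_mono_ennreal gaussian_small_ball[OF dist] divide_nonneg_pos) auto
    also have "\<dots> = ennreal (\<Prod>i\<in>J. (t i / s i)\<^sup>2)" by (rule prod_ennreal) auto
    finally show "emeasure (distr M ?N1 ?X) ((\<lambda>x. (x, y)) -` ?E) \<le> ennreal (\<Prod>i\<in>J. (t i / s i)\<^sup>2)" .
  qed
  also have "\<dots> = ennreal (\<Prod>i\<in>J. (t i / s i)\<^sup>2)"
    using DY.emeasure_space_1 by (simp add: nn_integral_const)
  finally show ?thesis .
qed

section \<open>Measurability and size of unordered sums\<close>

text \<open>For complex families summability is absolute summability, and \<open>infsum\<close> is 0
  otherwise. Testing whether the absolute partial sums are bounded reproduces this default at every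
  point. The bound B ranges over the naturals to keep the test a countable union.\<close>

lemma infsum_eq_lim_partial_sums:
  fixes f :: "'i::countable \<Rightarrow> complex"
  shows "(\<lambda>k. if (\<exists>B::nat. \<forall>k. (\<Sum>i\<in>{i\<in>I. to_nat i < k}. cmod (f i)) \<le> real B)
      then (\<Sum>i\<in>{i\<in>I. to_nat i < k}. f i) else 0) \<longlonglongrightarrow> infsum f I"
proof -
  have fin: "finite {i\<in>I. to_nat i < k}" for k
    by (rule finite_subset[of _ "from_nat ` {..<k}"]) (auto intro: rev_image_eqI simp: from_nat_to_nat)
  have cofinal: "\<exists>k. F \<subseteq> {i\<in>I. to_nat i < k}" if "finite F" "F \<subseteq> I" for F
    using that by (intro exI[of _ "Suc (Max (to_nat ` F))"]) (auto simp: less_Suc_eq_le)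
  show ?thesis
  proof (cases "\<exists>B::nat. \<forall>k. (\<Sum>i\<in>{i\<in>I. to_nat i < k}. cmod (f i)) \<le> real B")
    case True
    then obtain B :: nat where B: "\<And>k. (\<Sum>i\<in>{i\<in>I. to_nat i < k}. cmod (f i)) \<le> real B" by blast
    have "(\<lambda>i. cmod (f i)) summable_on I"
    proof (rule nonneg_bdd_above_summable_on)
      show "bdd_above (sum (\<lambda>i. cmod (f i)) ` {F. F \<subseteq> I \<and> finite F})"
      proof (rule bdd_aboveI2)
        fix F assume "F \<in> {F. F \<subseteq> I \<and> finite F}"
        then obtain k where "F \<subseteq> {i\<in>I. to_nat i < k}" using cofinal by blast
        then have "(\<Sum>i\<in>F. cmod (f i)) \<le> (\<Sum>i\<in>{i\<in>I. to_nat i < k}. cmod (f i))"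
          by (intro sum_mono2 fin) auto
        then show "(\<Sum>i\<in>F. cmod (f i)) \<le> real B" using B[of k] by simp
      qed
    qed auto
    then have "(sum f \<longlongrightarrow> infsum f I) (finite_subsets_at_top I)"
      using abs_summable_summable has_sum_infsum unfolding has_sum_def by blast
    moreover have "filterlim (\<lambda>k. {i\<in>I. to_nat i < k}) (finite_subsets_at_top I) sequentially"
      unfolding filterlim_finite_subsets_at_top
    proof (intro allI impI)
      fix F assume F: "finite F \<and> F \<subseteq> I"
      then obtain k where "F \<subseteq> {i\<in>I. to_nat i < k}" using cofinal by blast
      then have "F \<subseteq> {i\<in>I. to_nat i < l}" if "l \<ge> k" for l using that by fastforce
      then show "\<forall>\<^sub>F k in sequentially. finite {i\<in>I. to_nat i < k} \<and> F \<subseteq> {i\<in>I. to_nat i < k} \<and> {i\<in>I. to_nat i < k} \<subseteq> I"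
        using fin by (auto simp: eventually_sequentially)
    qed
    ultimately have "(\<lambda>k. \<Sum>i\<in>{i\<in>I. to_nat i < k}. f i) \<longlonglongrightarrow> infsum f I"
      by (rule filterlim_compose)
    then show ?thesis using True by simp
  next
    case False
    have "\<not> (\<lambda>i. cmod (f i)) summable_on I"
    proof
      assume ab: "(\<lambda>i. cmod (f i)) summable_on I"
      obtain B :: nat where B: "infsum (\<lambda>i. cmod (f i)) I \<le> real B" using real_arch_simple by blast
      have "(\<Sum>i\<in>{i\<in>I. to_nat i < k}. cmod (f i)) \<le> real B" for k
        using finite_sum_le_infsum[OF ab fin, of k] B by force
      then show False using False by blast
    qed
    then have "infsum f I = 0"
      by (simp add: infsum_not_exists summable_on_iff_abs_summable_on_complex)
    then show ?thesis unfolding if_not_P[OF False] by simp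
  qed
qed

lemma borel_measurable_infsum:
  fixes F :: "'i::countable \<Rightarrow> 'a \<Rightarrow> complex"
  assumes [measurable]: "\<And>i. i \<in> I \<Longrightarrow> F i \<in> borel_measurable N"
  shows "(\<lambda>y. infsum (\<lambda>i. F i y) I) \<in> borel_measurable N"
proof (rule borel_measurable_LIMSEQ_metric)
  show "(\<lambda>k. if (\<exists>B::nat. \<forall>k. (\<Sum>i\<in>{i\<in>I. to_nat i < k}. cmod (F i y)) \<le> real B)
      then (\<Sum>i\<in>{i\<in>I. to_nat i < k}. F i y) else 0) \<longlonglongrightarrow> infsum (\<lambda>i. F i y) I" for y
    by (rule infsum_eq_lim_partial_sums)
  have [measurable]: "(\<lambda>y. \<Sum>i\<in>{i\<in>I. to_nat i < k}. cmod (F i y)) \<in> borel_measurable N"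
    "(\<lambda>y. \<Sum>i\<in>{i\<in>I. to_nat i < k}. F i y) \<in> borel_measurable N" for k
    by (auto intro!: borel_measurable_sum)
  show "(\<lambda>y. if (\<exists>B::nat. \<forall>k. (\<Sum>i\<in>{i\<in>I. to_nat i < k}. cmod (F i y)) \<le> real B)
      then (\<Sum>i\<in>{i\<in>I. to_nat i < k}. F i y) else 0) \<in> borel_measurable N" for k
    by measurable
qed

text \<open>Valid without any summability, since a divergent sum has the value 0; moments of the
  series can thus be bounded before its convergence is known.\<close>

lemma ennreal_norm_infsum_le:
  fixes f :: "'i \<Rightarrow> complex"
  shows "ennreal (cmod (infsum f I)) \<le> (\<integral>\<^sup>+i. ennreal (cmod (f i)) \<partial>count_space I)"
proof (cases "(\<lambda>i. cmod (f i)) summable_on I")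
  case True
  have "cmod (infsum f I) \<le> infsum (\<lambda>i. cmod (f i)) I" by (rule norm_infsum_bound[OF True])
  moreover have "ennreal (infsum (\<lambda>i. cmod (f i)) I) \<le> (\<integral>\<^sup>+i. ennreal (cmod (f i)) \<partial>count_space I)"
  proof (cases "(\<integral>\<^sup>+i. ennreal (cmod (f i)) \<partial>count_space I)")
    case (real b)
    have "infsum (\<lambda>i. cmod (f i)) I \<le> b"
    proof (rule infsum_le_finite_sums[OF True])
      fix F assume F: "finite F" "F \<subseteq> I"
      have "ennreal (\<Sum>i\<in>F. cmod (f i)) = (\<integral>\<^sup>+i. ennreal (cmod (f i)) \<partial>count_space F)"
        using F by (simp add: nn_integral_count_space_finite)
      also have "\<dots> \<le> (\<integral>\<^sup>+i. ennreal (cmod (f i)) \<partial>count_space I)"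
        using F by (subst (1 2) nn_integral_count_space_indicator) (auto intro!: nn_integral_mono simp: indicator_def)
      finally show "(\<Sum>i\<in>F. cmod (f i)) \<le> b" using real by simp
    qed
    then show ?thesis using real by (simp add: ennreal_leI)
  qed simp
  ultimately show ?thesis by (meson ennreal_leI order_trans)
next
  case False
  then have "infsum f I = 0"
    by (simp add: infsum_not_exists summable_on_iff_abs_summable_on_complex)
  then show ?thesis by simp
qed

section \<open>Bounds for the random series\<close>

definition hterm :: "real \<Rightarrow> complex ^ 'n::finite \<Rightarrow> ('n \<Rightarrow> nat) \<Rightarrow> complex" where
  "hterm L z \<alpha> = of_real (sqrt (hcoef L \<alpha>)) * (\<Prod>j\<in>UNIV. (z $ j) ^ \<alpha> j)"

lemma hyperbolic_series_eq: "hyperbolic_series L c z = (\<Sum>\<^sub>\<infinity>\<alpha>. c \<alpha> * hterm L z \<alpha>)"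
  by (simp add: hyperbolic_series_def hterm_def hcoef_def mult.assoc)

lemma norm_sq_vec: "(norm (z :: complex ^ 'n::finite))\<^sup>2 = (\<Sum>j\<in>UNIV. (cmod (z $ j))\<^sup>2)"
  by (simp add: norm_vec_def L2_set_def sum_nonneg)

text \<open>The square is one term of the kernel series at the dilated point s z, hence at most its
  sum.\<close>

lemma norm_hterm_le:
  fixes z :: "complex ^ 'n::finite"
  assumes "L > 0" "s \<ge> 0" "s\<^sup>2 * (norm z)\<^sup>2 < 1"
  shows "cmod (hterm L z \<alpha>) * s ^ (mdeg \<alpha>) \<le> (1 - s\<^sup>2 * (norm z)\<^sup>2) powr (- L / 2)"
proof (rule power2_le_imp_le)
  have "(cmod (hterm L z \<alpha>) * s ^ (mdeg \<alpha>))\<^sup>2 = hcoef L \<alpha> * (\<Prod>j\<in>UNIV. (s\<^sup>2 * (cmod (z $ j))\<^sup>2) ^ \<alpha> j)"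
    using hcoef_pos[OF assms(1), of \<alpha>]
    by (simp add: hterm_def norm_mult power_mult_distrib prod.distrib power_sum prod_norm[symmetric] norm_power
        prod_power_distrib mult_ac flip: power_mult)
  also have "\<dots> \<le> (1 - (\<Sum>j\<in>UNIV. s\<^sup>2 * (cmod (z $ j))\<^sup>2)) powr (- L)"
    using assms by (intro hcoef_term_le) (auto simp: norm_sq_vec sum_distrib_left)
  also have "(\<Sum>j\<in>UNIV. s\<^sup>2 * (cmod (z $ j))\<^sup>2) = s\<^sup>2 * (norm z)\<^sup>2"
    by (simp add: norm_sq_vec sum_distrib_left)
  also have "(1 - s\<^sup>2 * (norm z)\<^sup>2) powr (- L) = ((1 - s\<^sup>2 * (norm z)\<^sup>2) powr (- L / 2))\<^sup>2"
    by (simp add: power2_eq_square flip: powr_add)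
  finally show "(cmod (hterm L z \<alpha>) * s ^ (mdeg \<alpha>))\<^sup>2 \<le> ((1 - s\<^sup>2 * (norm z)\<^sup>2) powr (- L / 2))\<^sup>2" .
qed simp

text \<open>For s > 1, the sum of s^(-|\<alpha>|) over all multi-indices with n entries.\<close>

definition geom_const :: "real \<Rightarrow> nat \<Rightarrow> real" where
  "geom_const s n = (1 / (1 - 1 / s)) ^ n"

lemma geom_const_pos: "s > 1 \<Longrightarrow> geom_const s n > 0"
  by (simp add: geom_const_def)

lemma has_sum_geom_const:
  assumes "s > 1"
  shows "((\<lambda>\<alpha> :: 'n::finite \<Rightarrow> nat. (1 / s) ^ (mdeg \<alpha>)) has_sum geom_const s CARD('n)) UNIV"
  unfolding geom_const_def using assms by (intro has_sum_geometric_multi_index) auto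

text \<open>Dilating z by s^2, hence the s^4 in front of |z|^2, gains s^(2 |\<alpha>|). One half
  pays for the growth of the coefficients, the other is the geometric factor that makes the series
  converge.\<close>

lemma norm_coeff_hterm_le:
  fixes z :: "complex ^ 'n::finite"
  assumes "L > 0" "s > 1" "s ^ 4 * R\<^sup>2 < 1" "norm z \<le> R" "E \<ge> 0" "cmod (c \<alpha>) \<le> E * s ^ (mdeg \<alpha>)"
  shows "cmod (c \<alpha> * hterm L z \<alpha>) \<le> E * (1 - s ^ 4 * (norm z)\<^sup>2) powr (- L / 2) * (1 / s) ^ (mdeg \<alpha>)"
    and "(1 - s ^ 4 * (norm z)\<^sup>2) powr (- L / 2) \<le> (1 - s ^ 4 * R\<^sup>2) powr (- L / 2)"
    and "s ^ 4 * (norm z)\<^sup>2 < 1"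
proof -
  let ?k = "\<Sum>j\<in>UNIV. \<alpha> j"
  have zR: "s ^ 4 * (norm z)\<^sup>2 \<le> s ^ 4 * R\<^sup>2"
    using assms by (intro mult_left_mono power_mono) auto
  then show z1: "s ^ 4 * (norm z)\<^sup>2 < 1" using assms(3) by linarith
  have s4: "(s\<^sup>2)\<^sup>2 = s ^ 4" by simp
  show "(1 - s ^ 4 * (norm z)\<^sup>2) powr (- L / 2) \<le> (1 - s ^ 4 * R\<^sup>2) powr (- L / 2)"
    using zR assms by (intro powr_mono2') auto
  have h: "cmod (hterm L z \<alpha>) * (s\<^sup>2) ^ ?k \<le> (1 - s ^ 4 * (norm z)\<^sup>2) powr (- L / 2)"
    using norm_hterm_le[of L "s\<^sup>2" z \<alpha>] z1 assms by (simp add: s4)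
  have "cmod (c \<alpha> * hterm L z \<alpha>) \<le> (E * s ^ ?k) * cmod (hterm L z \<alpha>)"
    using assms by (simp add: norm_mult mult_right_mono)
  also have "\<dots> = E * (cmod (hterm L z \<alpha>) * (s\<^sup>2) ^ ?k) * (1 / s) ^ ?k"
    using assms by (simp add: power_mult_distrib power_divide power2_eq_square field_simps)
  also have "\<dots> \<le> E * (1 - s ^ 4 * (norm z)\<^sup>2) powr (- L / 2) * (1 / s) ^ ?k"
    using assms h by (intro mult_right_mono mult_left_mono) auto
  finally show "cmod (c \<alpha> * hterm L z \<alpha>) \<le> E * (1 - s ^ 4 * (norm z)\<^sup>2) powr (- L / 2) * (1 / s) ^ ?k" .
qed

lemma hyperbolic_series_bound:
  fixes z :: "complex ^ 'n::finite"
  assumes "L > 0" "s > 1" "s ^ 4 * R\<^sup>2 < 1" "norm z \<le> R" "E \<ge> 0"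
    and c: "\<And>\<alpha>. cmod (c \<alpha>) \<le> E * s ^ (mdeg \<alpha>)"
  shows "(\<lambda>\<alpha>. c \<alpha> * hterm L z \<alpha>) summable_on A"
    and "cmod (hyperbolic_series L c z) \<le> E * (1 - s ^ 4 * (norm z)\<^sup>2) powr (- L / 2) * geom_const s CARD('n)"
proof -
  let ?m = "\<lambda>\<alpha> :: 'n \<Rightarrow> nat. E * (1 - s ^ 4 * (norm z)\<^sup>2) powr (- L / 2) * (1 / s) ^ (mdeg \<alpha>)"
  have m: "(?m has_sum E * (1 - s ^ 4 * (norm z)\<^sup>2) powr (- L / 2) * geom_const s CARD('n)) UNIV"
    by (intro has_sum_cmult_right has_sum_geom_const assms)
  have le: "cmod (c \<alpha> * hterm L z \<alpha>) \<le> ?m \<alpha>" for \<alpha>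
    by (rule norm_coeff_hterm_le(1)[OF assms(1-5) c])
  have ab: "(\<lambda>\<alpha>. cmod (c \<alpha> * hterm L z \<alpha>)) summable_on UNIV"
    by (rule Infinite_Sum.summable_on_comparison_test[of ?m]) (use m le in \<open>auto simp: summable_on_def\<close>)
  then show "(\<lambda>\<alpha>. c \<alpha> * hterm L z \<alpha>) summable_on A"
    using summable_on_subset_banach[OF Infinite_Sum.abs_summable_summable[OF ab] subset_UNIV] by blast
  have "cmod (hyperbolic_series L c z) \<le> (\<Sum>\<^sub>\<infinity>\<alpha>. cmod (c \<alpha> * hterm L z \<alpha>))"
    unfolding hyperbolic_series_eq by (rule norm_infsum_bound[OF ab])
  also have "\<dots> \<le> E * (1 - s ^ 4 * (norm z)\<^sup>2) powr (- L / 2) * geom_const s CARD('n)"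
    by (rule has_sum_mono[OF has_sum_infsum[OF ab] m le])
  finally show "cmod (hyperbolic_series L c z) \<le> E * (1 - s ^ 4 * (norm z)\<^sup>2) powr (- L / 2) * geom_const s CARD('n)" .
qed

text \<open>The Weierstrass M-test along the filter of finite index sets.\<close>

lemma uniform_limit_infsum:
  fixes F :: "'i \<Rightarrow> 'a \<Rightarrow> complex"
  assumes le: "\<And>i x. x \<in> S \<Longrightarrow> cmod (F i x) \<le> m i" and m: "m summable_on UNIV"
  shows "uniform_limit S (\<lambda>A x. \<Sum>i\<in>A. F i x) (\<lambda>x. \<Sum>\<^sub>\<infinity>i. F i x) (finite_subsets_at_top UNIV)"
proof (rule uniform_limitI)
  fix e :: real assume "e > 0"
  have "(sum m \<longlongrightarrow> infsum m UNIV) (finite_subsets_at_top UNIV)"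
    using has_sum_infsum[OF m] by (simp add: has_sum_def)
  then have ev: "\<forall>\<^sub>F A in finite_subsets_at_top UNIV. dist (sum m A) (infsum m UNIV) < e"
    using \<open>e > 0\<close> by (rule tendstoD)
  have fin: "\<forall>\<^sub>F A in finite_subsets_at_top (UNIV :: 'i set). finite A"
    by (rule eventually_finite_subsets_at_top_weakI)
  show "\<forall>\<^sub>F A in finite_subsets_at_top UNIV. \<forall>x\<in>S. dist (\<Sum>i\<in>A. F i x) (\<Sum>\<^sub>\<infinity>i. F i x) < e"
    using ev fin
  proof eventually_elim
    case (elim A)
    show ?case
    proof
      fix x assume x: "x \<in> S"
      have ab: "(\<lambda>i. cmod (F i x)) summable_on UNIV"
        by (rule Infinite_Sum.summable_on_comparison_test[OF m]) (use le[OF x] in auto)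
      have s: "(\<lambda>i. F i x) summable_on B" "(\<lambda>i. cmod (F i x)) summable_on B" "m summable_on B" for B
        using ab m Infinite_Sum.abs_summable_summable[OF ab] summable_on_subset_banach by blast+
      have split: "infsum h UNIV = sum h A + infsum h (- A)" if "\<And>B. h summable_on B" for h :: "'i \<Rightarrow> 'z::banach"
        using infsum_Un_disjoint[of h A "- A"] that elim(2) by simp
      have "dist (\<Sum>i\<in>A. F i x) (\<Sum>\<^sub>\<infinity>i. F i x) = cmod (infsum (\<lambda>i. F i x) (- A))"
        by (subst split[OF s(1)]) (simp add: dist_norm)
      also have "\<dots> \<le> infsum (\<lambda>i. cmod (F i x)) (- A)" by (rule norm_infsum_bound[OF s(2)])
      also have "\<dots> \<le> infsum m (- A)" by (intro infsum_mono s le x)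
      also have "\<dots> < e"
        using elim(1) split[OF s(3)] by (simp add: dist_norm abs_less_iff)
      finally show "dist (\<Sum>i\<in>A. F i x) (\<Sum>\<^sub>\<infinity>i. F i x) < e" .
    qed
  qed
qed

text \<open>Locally uniform limits of polynomials. Holomorphy is stated along complex lines through
  z0, the form in which \<open>submean_ln_ball\<close> asks for it.\<close>

lemma hyperbolic_series_continuous_holomorphic:
  fixes c :: "('n::finite \<Rightarrow> nat) \<Rightarrow> complex"
  assumes "L > 0" "s > 1" "s ^ 4 * R\<^sup>2 < 1" "E \<ge> 0"
    and c: "\<And>\<alpha>. cmod (c \<alpha>) \<le> E * s ^ (mdeg \<alpha>)"
  shows "continuous_on (cball 0 R) (hyperbolic_series L c)"
    and "norm z0 + norm y \<le> R \<Longrightarrow> (\<lambda>t. hyperbolic_series L c (z0 + t *s y)) holomorphic_on ball 0 1"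
proof -
  let ?m = "\<lambda>\<alpha> :: 'n \<Rightarrow> nat. E * (1 - s ^ 4 * R\<^sup>2) powr (- L / 2) * (1 / s) ^ (mdeg \<alpha>)"
  have m: "?m summable_on UNIV"
    by (rule has_sum_imp_summable[OF has_sum_cmult_right[OF has_sum_geom_const[OF assms(2)]]])
  have le: "cmod (c \<alpha> * hterm L z \<alpha>) \<le> ?m \<alpha>" if "norm z \<le> R" for \<alpha> z
    by (rule order_trans[OF norm_coeff_hterm_le(1)[OF assms(1-3) that assms(4) c]],
        intro mult_right_mono mult_left_mono norm_coeff_hterm_le(2)[OF assms(1-3) that assms(4) c])
       (use assms in auto)
  have unif: "uniform_limit (cball 0 R) (\<lambda>A z. \<Sum>\<alpha>\<in>A. c \<alpha> * hterm L z \<alpha>) (hyperbolic_series L c) (finite_subsets_at_top UNIV)"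
    unfolding hyperbolic_series_eq[abs_def] by (rule uniform_limit_infsum[OF _ m]) (use le in auto)
  show "continuous_on (cball 0 R) (hyperbolic_series L c)"
    by (rule uniform_limit_theorem[OF _ unif])
       (auto intro!: always_eventually continuous_intros simp: hterm_def)
  assume y: "norm z0 + norm y \<le> R"
  have in_cball: "norm (z0 + t *s y) \<le> R" if "cmod t \<le> 1" for t
  proof -
    have "norm (z0 + t *s y) \<le> norm z0 + cmod t * norm y"
      using norm_triangle_ineq[of z0 "t *s y"] by (simp add: norm_vector_smult)
    also have "cmod t * norm y \<le> 1 * norm y" using that by (intro mult_right_mono) auto
    finally show ?thesis using y by simp
  qed
  have line: "(\<lambda>t. c \<alpha> * hterm L (z0 + t *s y) \<alpha>) = (\<lambda>t. c \<alpha> * (of_real (sqrt (hcoef L \<alpha>)) * (\<Prod>j\<in>UNIV. (z0 $ j + t * y $ j) ^ \<alpha> j)))" for \<alpha>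
    by (simp add: hterm_def)
  have hol: "(\<lambda>t. \<Sum>\<alpha>\<in>A. c \<alpha> * hterm L (z0 + t *s y) \<alpha>) holomorphic_on S" for A S
    by (intro holomorphic_on_sum, subst line) (intro holomorphic_intros)
  show "(\<lambda>t. hyperbolic_series L c (z0 + t *s y)) holomorphic_on ball 0 1"
  proof (rule holomorphic_uniform_limit)
    show "\<forall>\<^sub>F A in finite_subsets_at_top UNIV.
        continuous_on (cball 0 1) (\<lambda>t. \<Sum>\<alpha>\<in>A. c \<alpha> * hterm L (z0 + t *s y) \<alpha>) \<and>
        (\<lambda>t. \<Sum>\<alpha>\<in>A. c \<alpha> * hterm L (z0 + t *s y) \<alpha>) holomorphic_on ball 0 1"
      using hol by (intro always_eventually allI conjI holomorphic_on_imp_continuous_on) auto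
    show "uniform_limit (cball 0 1) (\<lambda>A t. \<Sum>\<alpha>\<in>A. c \<alpha> * hterm L (z0 + t *s y) \<alpha>)
        (\<lambda>t. hyperbolic_series L c (z0 + t *s y)) (finite_subsets_at_top UNIV)"
      unfolding hyperbolic_series_eq by (rule uniform_limit_infsum[OF _ m]) (use le in_cball in auto)
  qed auto
qed

section \<open>The exceptional event of large coefficients\<close>

lemma nn_integral_count_space_le:
  fixes f :: "'i::countable \<Rightarrow> real"
  assumes "\<And>i. f i \<ge> 0" "(f has_sum S) UNIV"
  shows "(\<integral>\<^sup>+i. ennreal (f i) \<partial>count_space UNIV) \<le> ennreal S"
proof -
  have fin: "finite {i :: 'i. to_nat i < k}" for k
    by (rule finite_subset[of _ "from_nat ` {..<k}"]) (auto intro: rev_image_eqI simp: from_nat_to_nat)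
  let ?F = "\<lambda>k i. ennreal (f i) * indicator {i. to_nat i < k} i"
  have F_sup: "(SUP k. ?F k i) = ennreal (f i)" for i
  proof (rule antisym)
    show "(SUP k. ?F k i) \<le> ennreal (f i)" by (rule SUP_least) (auto simp: indicator_def)
    show "ennreal (f i) \<le> (SUP k. ?F k i)" by (rule SUP_upper2[of "Suc (to_nat i)"]) auto
  qed
  have "(\<integral>\<^sup>+i. ennreal (f i) \<partial>count_space UNIV) = (\<integral>\<^sup>+i. (SUP k. ?F k i) \<partial>count_space UNIV)"
    by (simp only: F_sup)
  also have "\<dots> = (SUP k. \<integral>\<^sup>+i. ?F k i \<partial>count_space UNIV)"
    by (rule nn_integral_monotone_convergence_SUP) (auto simp: incseq_def le_fun_def indicator_def)
  also have "\<dots> \<le> ennreal S"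
  proof (rule SUP_least)
    fix k
    have "(\<integral>\<^sup>+i. ?F k i \<partial>count_space UNIV) = (\<integral>\<^sup>+i. ennreal (f i) \<partial>count_space {i. to_nat i < k})"
      by (subst (2) nn_integral_count_space_indicator) auto
    also have "\<dots> = ennreal (\<Sum>i\<in>{i. to_nat i < k}. f i)"
      using fin assms(1) by (simp add: nn_integral_count_space_finite)
    also have "\<dots> \<le> ennreal S"
      using assms by (intro ennreal_leI has_sum_mono_neutral[OF has_sum_finite[OF fin] assms(2)]) auto
    finally show "(\<integral>\<^sup>+i. ?F k i \<partial>count_space UNIV) \<le> ennreal S" .
  qed
  finally show ?thesis .
qed

lemma (in prob_space) upper_event_prob:
  fixes a :: "('n::finite \<Rightarrow> nat) \<Rightarrow> 'a \<Rightarrow> complex"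
  assumes dist: "\<And>\<alpha>. distributed M lborel (a \<alpha>) std_gaussian_density"
    and s: "s > 1" and E: "E\<^sup>2 \<ge> 2" "E \<ge> 0"
  shows "{\<omega>\<in>space M. \<exists>\<alpha>. cmod (a \<alpha> \<omega>) > E * s ^ (mdeg \<alpha>)} \<in> sets M"
    and "measure M {\<omega>\<in>space M. \<exists>\<alpha>. cmod (a \<alpha> \<omega>) > E * s ^ (mdeg \<alpha>)}
      \<le> 2 * exp (1 - E\<^sup>2 / 2) * geom_const s CARD('n)"
proof -
  have [measurable]: "a \<alpha> \<in> borel_measurable M" for \<alpha> using distributed_measurable[OF dist, of \<alpha>] by simp
  define A where "A \<alpha> = {\<omega>\<in>space M. cmod (a \<alpha> \<omega>) > E * s ^ (mdeg \<alpha>)}" for \<alpha>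
  have [measurable]: "A \<alpha> \<in> sets M" for \<alpha> unfolding A_def by measurable
  have eq: "{\<omega>\<in>space M. \<exists>\<alpha>. cmod (a \<alpha> \<omega>) > E * s ^ (mdeg \<alpha>)} = (\<Union>\<alpha>. A \<alpha>)" by (auto simp: A_def)
  show "{\<omega>\<in>space M. \<exists>\<alpha>. cmod (a \<alpha> \<omega>) > E * s ^ (mdeg \<alpha>)} \<in> sets M" unfolding eq by measurable
  have PA: "emeasure M (A \<alpha>) \<le> ennreal (2 * exp (1 - E\<^sup>2 / 2) * (1 / s) ^ (mdeg \<alpha>))" for \<alpha>
  proof -
    define k where "k = (mdeg \<alpha>)"
    define x y where "x = E\<^sup>2 / 2" and "y = (s ^ k)\<^sup>2"
    have sk: "s ^ k \<ge> 1" using s by simp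
    have x: "x \<ge> 1" using E by (simp add: x_def)
    have y: "y \<ge> s ^ k" using mult_left_mono[of 1 "s ^ k" "s ^ k"] sk by (simp add: y_def power2_eq_square)
    \<comment> \<open>x y \<ge> x + y - 1 for x, y \<ge> 1 separates the height E from the degree: a
      common factor exp (1 - x) remains, and exp (- y) is summable over \<alpha>.\<close>
    have "0 \<le> (x - 1) * (y - 1)" using x y sk by (intro mult_nonneg_nonneg) auto
    then have xy: "- (x * y) \<le> (1 - x) + (- y)" by (simp add: algebra_simps)
    have "exp (- y) \<le> (1 / s) ^ k"
    proof -
      have "s ^ k \<le> exp y" using y exp_ge_add_one_self[of y] by linarith
      then show ?thesis using sk s by (simp add: exp_minus power_divide inverse_eq_divide frac_le)
    qed
    then have "exp (- (x * y)) \<le> exp (1 - x) * (1 / s) ^ k"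
    proof -
      assume *: "exp (- y) \<le> (1 / s) ^ k"
      have "exp (- (x * y)) \<le> exp ((1 - x) + (- y))" using xy by simp
      also have "\<dots> = exp (1 - x) * exp (- y)" by (rule exp_add)
      also have "\<dots> \<le> exp (1 - x) * (1 / s) ^ k" using * by (intro mult_left_mono) auto
      finally show ?thesis .
    qed
    then have *: "2 * exp (- (E * s ^ k)\<^sup>2 / 2) \<le> 2 * exp (1 - E\<^sup>2 / 2) * (1 / s) ^ k"
      by (simp add: x_def y_def power_mult_distrib)
    have "emeasure M (A \<alpha>) \<le> ennreal (2 * exp (- (E * s ^ k)\<^sup>2 / 2))"
      unfolding A_def k_def using E s by (intro gaussian_tail[OF dist]) auto
    also have "\<dots> \<le> ennreal (2 * exp (1 - E\<^sup>2 / 2) * (1 / s) ^ k)" by (rule ennreal_leI[OF *])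
    finally show ?thesis by (simp add: k_def)
  qed
  have "emeasure M (\<Union>\<alpha>. A \<alpha>) = (\<integral>\<^sup>+\<omega>. indicator (\<Union>\<alpha>. A \<alpha>) \<omega> \<partial>M)" by simp
  also have "\<dots> \<le> (\<integral>\<^sup>+\<omega>. \<integral>\<^sup>+\<alpha>. indicator (A \<alpha>) \<omega> \<partial>count_space UNIV \<partial>M)"
  proof (intro nn_integral_mono)
    fix \<omega>
    show "indicator (\<Union>\<alpha>. A \<alpha>) \<omega> \<le> (\<integral>\<^sup>+\<alpha>. indicator (A \<alpha>) \<omega> \<partial>count_space UNIV)"
    proof (cases "\<omega> \<in> (\<Union>\<alpha>. A \<alpha>)")
      case True
      then obtain \<beta> where "\<omega> \<in> A \<beta>" by auto
      then have "1 = (\<integral>\<^sup>+\<alpha>. indicator {\<beta>} \<alpha> \<partial>count_space UNIV)" by simp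
      also have "\<dots> \<le> (\<integral>\<^sup>+\<alpha>. indicator (A \<alpha>) \<omega> \<partial>count_space UNIV)"
        using \<open>\<omega> \<in> A \<beta>\<close> by (intro nn_integral_mono) (auto simp: indicator_def)
      finally show ?thesis using True by simp
    qed simp
  qed
  also have "\<dots> = (\<integral>\<^sup>+\<alpha>. \<integral>\<^sup>+\<omega>. indicator (A \<alpha>) \<omega> \<partial>M \<partial>count_space UNIV)"
    by (rule nn_integral_count_space_nn_integral) auto
  also have "\<dots> \<le> (\<integral>\<^sup>+\<alpha>. ennreal (2 * exp (1 - E\<^sup>2 / 2) * (1 / s) ^ (mdeg \<alpha>)) \<partial>count_space (UNIV :: ('n \<Rightarrow> nat) set))"
  proof (rule nn_integral_mono)
    show "(\<integral>\<^sup>+\<omega>. indicator (A \<alpha>) \<omega> \<partial>M) \<le> ennreal (2 * exp (1 - E\<^sup>2 / 2) * (1 / s) ^ (mdeg \<alpha>))" for \<alpha>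
      using PA[of \<alpha>] by simp
  qed
  also have "\<dots> \<le> ennreal (2 * exp (1 - E\<^sup>2 / 2) * geom_const s CARD('n))"
    using s by (intro nn_integral_count_space_le has_sum_cmult_right has_sum_geom_const) auto
  finally show "measure M {\<omega>\<in>space M. \<exists>\<alpha>. cmod (a \<alpha> \<omega>) > E * s ^ (mdeg \<alpha>)}
      \<le> 2 * exp (1 - E\<^sup>2 / 2) * geom_const s CARD('n)"
    unfolding eq using less_imp_le[OF geom_const_pos[OF s]] by (simp add: emeasure_eq_measure ennreal_le_iff)
qed

section \<open>Lower bound at a point near w\<close>

abbreviation box_indices :: "nat \<Rightarrow> ('n \<Rightarrow> nat) set" where
  "box_indices m \<equiv> PiE UNIV (\<lambda>_. {..m})"

text \<open>The tensor product of the one-variable rules at the coordinates of w: the sum over the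
  box factors into one-variable sums, and the weights multiply.\<close>

lemma multi_interpolation_weights:
  fixes w :: "complex ^ 'n::finite" and m :: nat
  assumes w: "\<And>j. cmod (w $ j) \<le> 1" and r: "0 < r" "r \<le> 1"
  obtains x :: "('n \<Rightarrow> nat) \<Rightarrow> complex ^ 'n" and \<Lambda> :: "('n \<Rightarrow> nat) \<Rightarrow> ('n \<Rightarrow> nat) \<Rightarrow> complex" where
    "\<And>\<kappa> j. cmod (x \<kappa> $ j - w $ j) = r" "\<And>\<gamma> \<kappa>. cmod (\<Lambda> \<gamma> \<kappa>) \<le> (2 / r) ^ (m * CARD('n))"
    "\<And>\<gamma> e. \<gamma> \<in> box_indices m \<Longrightarrow> e \<in> box_indices m \<Longrightarrow>
      (\<Sum>\<kappa>\<in>box_indices m. \<Lambda> \<gamma> \<kappa> * (\<Prod>j\<in>UNIV. (x \<kappa> $ j) ^ e j)) = (if \<gamma> = e then 1 else 0)"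
proof -
  define P where "P v (p :: (nat \<Rightarrow> complex) \<times> (nat \<Rightarrow> nat \<Rightarrow> complex)) \<longleftrightarrow>
      (\<forall>k. cmod (fst p k - v) = r) \<and> (\<forall>d k. cmod (snd p d k) \<le> (2 / r) ^ m) \<and>
      (\<forall>d e. d \<le> m \<longrightarrow> e \<le> m \<longrightarrow> (\<Sum>k\<le>m. snd p d k * fst p k ^ e) = (if d = e then 1 else 0))" for v p
  have "\<exists>p. P (w $ j) p" for j
  proof -
    obtain x \<Lambda> where "\<And>k. cmod (x k - w $ j) = r" "\<And>d k. cmod (\<Lambda> d k) \<le> (2 / r) ^ m"
      "\<And>d e. d \<le> m \<Longrightarrow> e \<le> m \<Longrightarrow> (\<Sum>k\<le>m. \<Lambda> d k * x k ^ e) = (if d = e then 1 else 0)"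
      by (rule interpolation_weights[OF w r, of j m]) (rule that)
    then show ?thesis by (intro exI[of _ "(x, \<Lambda>)"]) (simp add: P_def)
  qed
  then obtain p where p: "\<And>j. P (w $ j) (p j)" by metis
  define x where "x \<kappa> = (\<chi> j. fst (p j) (\<kappa> j))" for \<kappa> :: "'n \<Rightarrow> nat"
  define \<Lambda> where "\<Lambda> \<gamma> \<kappa> = (\<Prod>j\<in>UNIV. snd (p j) (\<gamma> j) (\<kappa> j))" for \<gamma> \<kappa> :: "'n \<Rightarrow> nat"
  show ?thesis
  proof (rule that[of x \<Lambda>])
    show "cmod (x \<kappa> $ j - w $ j) = r" for \<kappa> j using p[of j] by (simp add: x_def P_def)
    show "cmod (\<Lambda> \<gamma> \<kappa>) \<le> (2 / r) ^ (m * CARD('n))" for \<gamma> \<kappa>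
    proof -
      have "cmod (\<Lambda> \<gamma> \<kappa>) \<le> (\<Prod>j\<in>(UNIV :: 'n set). (2 / r) ^ m)"
        unfolding \<Lambda>_def prod_norm[symmetric] using p by (intro prod_mono) (auto simp: P_def)
      then show ?thesis by (simp add: power_mult)
    qed
    fix \<gamma> e :: "'n \<Rightarrow> nat" assume \<gamma>: "\<gamma> \<in> box_indices m" and e: "e \<in> box_indices m"
    have "(\<Sum>\<kappa>\<in>box_indices m. \<Lambda> \<gamma> \<kappa> * (\<Prod>j\<in>UNIV. (x \<kappa> $ j) ^ e j))
        = (\<Sum>\<kappa>\<in>box_indices m. \<Prod>j\<in>UNIV. snd (p j) (\<gamma> j) (\<kappa> j) * fst (p j) (\<kappa> j) ^ e j)"
      by (simp add: \<Lambda>_def x_def prod.distrib)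
    also have "\<dots> = (\<Prod>j\<in>UNIV. \<Sum>k\<le>m. snd (p j) (\<gamma> j) k * fst (p j) k ^ e j)"
      by (rule prod_sum_PiE[symmetric]) auto
    also have "\<dots> = (\<Prod>j\<in>UNIV. if \<gamma> j = e j then 1 else 0)"
      using p \<gamma> e by (intro prod.cong refl) (auto simp: P_def PiE_iff)
    also have "\<dots> = (if \<gamma> = e then 1 else 0)"
      by (auto simp: fun_eq_iff)
    finally show "(\<Sum>\<kappa>\<in>box_indices m. \<Lambda> \<gamma> \<kappa> * (\<Prod>j\<in>UNIV. (x \<kappa> $ j) ^ e j)) = (if \<gamma> = e then 1 else 0)" .
  qed
qed

(* Interpolation at the nodes recovers each coefficient with index in the box alpha0 + {0..m}^n up to a quantity depending on the remaining coefficients only. If f is small at all nodes then every one of the (m+1)^n independent coefficients lies in a small disc. *)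
lemma (in prob_space) lower_event_fixed:
  fixes a :: "('n::finite \<Rightarrow> nat) \<Rightarrow> 'a \<Rightarrow> complex" and w :: "complex ^ 'n"
  assumes dist: "\<And>\<alpha>. distributed M lborel (a \<alpha>) std_gaussian_density"
    and ind: "indep_vars (\<lambda>_. borel) a UNIV"
    and L: "L \<ge> 1" and w: "\<And>j. cmod (w $ j) \<le> 1" and r: "0 < r" "r \<le> 1" and s: "s > 1"
    and torus: "\<And>x. (\<And>j. cmod (x $ j - w $ j) = r) \<Longrightarrow> s ^ 4 * (norm x)\<^sup>2 < 1"
    and B: "\<And>x. (\<And>j. cmod (x $ j - w $ j) = r) \<Longrightarrow> 1 \<le> B * (\<Prod>j\<in>UNIV. cmod (x $ j) ^ \<alpha>0 j)"
    and E: "E \<ge> 0" and \<tau>: "\<tau> \<ge> 0"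
    and T: "real (Suc m ^ CARD('n)) * (2 / r) ^ (m * CARD('n)) * B * \<tau> \<le> T"
  obtains A where "A \<in> sets M" "measure M A \<le> (T\<^sup>2 / hcoef L \<alpha>0) ^ (Suc m ^ CARD('n))"
    "\<And>\<omega>. \<omega> \<in> space M \<Longrightarrow> (\<And>\<alpha>. cmod (a \<alpha> \<omega>) \<le> E * s ^ (mdeg \<alpha>)) \<Longrightarrow> \<omega> \<notin> A \<Longrightarrow>
      \<exists>x. (\<forall>j. cmod (x $ j - w $ j) = r) \<and> \<tau> < cmod (hyperbolic_GAF L a \<omega> x)"
proof -
  have [measurable]: "a \<alpha> \<in> borel_measurable M" for \<alpha> using distributed_measurable[OF dist, of \<alpha>] by simp
  obtain x :: "('n \<Rightarrow> nat) \<Rightarrow> complex ^ 'n" and \<Lambda> :: "('n \<Rightarrow> nat) \<Rightarrow> ('n \<Rightarrow> nat) \<Rightarrow> complex" where x: "\<And>\<kappa> j. cmod (x \<kappa> $ j - w $ j) = r"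
    and \<Lambda>: "\<And>\<gamma> \<kappa>. cmod (\<Lambda> \<gamma> \<kappa>) \<le> (2 / r) ^ (m * CARD('n))"
    and interp: "\<And>\<gamma> e. \<gamma> \<in> box_indices m \<Longrightarrow> e \<in> box_indices m \<Longrightarrow>
      (\<Sum>\<kappa>\<in>box_indices m. \<Lambda> \<gamma> \<kappa> * (\<Prod>j\<in>UNIV. (x \<kappa> $ j) ^ e j)) = (if \<gamma> = e then 1 else 0)"
    by (rule multi_interpolation_weights[of w r m, OF w r]) (rule that)
  define Bx :: "('n \<Rightarrow> nat) set" where "Bx = box_indices m"
  have Bx: "finite Bx" "card Bx = Suc m ^ CARD('n)" "(\<lambda>_. 0) \<in> Bx"
    by (auto simp: Bx_def card_PiE intro!: finite_PiE)
  define sh where "sh \<gamma> = (\<lambda>j. \<alpha>0 j + \<gamma> j)" for \<gamma>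
  define sub where "sub i = (\<lambda>j. i j - \<alpha>0 j)" for i
  define J where "J = sh ` Bx"
  have sub_sh: "sub (sh \<gamma>) = \<gamma>" for \<gamma> by (simp add: sub_def sh_def)
  have inj_sh: "inj_on sh Bx" by (rule inj_on_inverseI[of _ sub]) (simp add: sub_sh)
  have J: "finite J" "J \<noteq> {}" "card J = Suc m ^ CARD('n)"
    using Bx by (auto simp: J_def card_image[OF inj_sh])
  \<comment> \<open>Dividing by the monomial of \<alpha>0 moves the box J to {0..m}^n, where the
    interpolation rule applies; whatever happens to the other indices goes into the error
    term.\<close>
  define \<mu> where "\<mu> \<kappa> = inverse (\<Prod>j\<in>UNIV. (x \<kappa> $ j) ^ \<alpha>0 j)" for \<kappa>
  have node: "cmod (\<mu> \<kappa>) \<le> B" "(\<Prod>j\<in>UNIV. (x \<kappa> $ j) ^ \<alpha>0 j) \<noteq> 0" for \<kappa>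
  proof -
    define Q where "Q = (\<Prod>j\<in>UNIV. cmod (x \<kappa> $ j) ^ \<alpha>0 j)"
    have Q1: "1 \<le> B * Q" unfolding Q_def by (rule B[OF x])
    have "Q \<ge> 0" by (auto simp: Q_def intro!: prod_nonneg)
    with Q1 have "Q > 0" by (cases "Q = 0") auto
    have norm_Q: "cmod (\<Prod>j\<in>UNIV. (x \<kappa> $ j) ^ \<alpha>0 j) = Q"
      by (simp add: Q_def norm_power flip: prod_norm)
    then show "(\<Prod>j\<in>UNIV. (x \<kappa> $ j) ^ \<alpha>0 j) \<noteq> 0" using \<open>Q > 0\<close> by (metis less_irrefl norm_zero)
    show "cmod (\<mu> \<kappa>) \<le> B" unfolding \<mu>_def norm_inverse norm_Q using Q1 \<open>Q > 0\<close> by (simp add: field_simps)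
  qed
  have B0: "B \<ge> 0" using node(1) norm_ge_zero order_trans by blast
  have T0: "T \<ge> 0" by (rule order_trans[OF _ T]) (use r B0 \<tau> in auto)
  \<comment> \<open>What the rule returns from the indices outside J. It is a function of those
    coefficients alone, hence independent of the ones in J.\<close>
  define \<rho> where "\<rho> i y = (\<Sum>\<kappa>\<in>Bx. \<Lambda> (sub i) \<kappa> * \<mu> \<kappa> * infsum (\<lambda>\<alpha>. y \<alpha> * hterm L (x \<kappa>) \<alpha>) (- J))" for i y
  have \<rho>_meas: "\<rho> i \<in> borel_measurable (PiM (- J) (\<lambda>_. borel))" for i
  proof -
    have "(\<lambda>y. y \<alpha> * hterm L (x \<kappa>) \<alpha>) \<in> borel_measurable (PiM (- J) (\<lambda>_. borel))" if "\<alpha> \<in> - J" for \<alpha> \<kappa>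
      using measurable_component_singleton[OF that, of "\<lambda>_. borel :: complex measure"]
      by (intro borel_measurable_times) auto
    then have "(\<lambda>y. infsum (\<lambda>\<alpha>. y \<alpha> * hterm L (x \<kappa>) \<alpha>) (- J)) \<in> borel_measurable (PiM (- J) (\<lambda>_. borel))" for \<kappa>
      by (rule borel_measurable_infsum)
    then show ?thesis
      unfolding \<rho>_def by (intro borel_measurable_sum borel_measurable_times borel_measurable_const)
  qed
  note [measurable] = \<rho>_meas
  \<comment> \<open>The event is phrased through \<open>\<rho>\<close> and not through f: in this
    form it fits the independence estimate on the whole space, also where the series diverges.
    Smallness of f at the nodes implies it under the growth bound on the coefficients, which makes
    the series summable.\<close>
  define A where "A = {\<omega>\<in>space M. \<forall>i\<in>J. cmod (of_real (sqrt (hcoef L i)) * a i \<omega> + \<rho> i (\<lambda>i\<in>-J. a i \<omega>)) \<le> T}"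
  have A: "A \<in> sets M"
    unfolding A_def
  proof (intro sets.sets_Collect_finite_All J(1))
    fix i
    have [measurable]: "(\<lambda>\<omega>. \<rho> i (\<lambda>i\<in>-J. a i \<omega>)) \<in> borel_measurable M"
      by (rule measurable_compose[OF _ \<rho>_meas]) (auto intro: measurable_restrict)
    show "{\<omega>\<in>space M. cmod (of_real (sqrt (hcoef L i)) * a i \<omega> + \<rho> i (\<lambda>i\<in>-J. a i \<omega>)) \<le> T} \<in> sets M"
      by measurable
  qed
  have c_pos: "hcoef L \<alpha> > 0" for \<alpha> using L by (intro hcoef_pos) auto
  have A_le: "measure M A \<le> (T\<^sup>2 / hcoef L \<alpha>0) ^ (Suc m ^ CARD('n))"
  proof -
    have le: "emeasure M A \<le> ennreal (\<Prod>i\<in>J. (T / sqrt (hcoef L i))\<^sup>2)"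
      unfolding A_def using c_pos T0
      by (intro independent_gaussians_small_ball[OF dist ind J(1,2) \<rho>_meas]) auto
    have "(\<Prod>i\<in>J. (T / sqrt (hcoef L i))\<^sup>2) \<le> (\<Prod>i\<in>J. T\<^sup>2 / hcoef L \<alpha>0)"
    proof (intro prod_mono conjI)
      fix i assume "i \<in> J"
      then obtain \<gamma> where i: "i = sh \<gamma>" by (auto simp: J_def)
      have "hcoef L \<alpha>0 \<le> hcoef L i" unfolding i sh_def by (rule hcoef_mono[OF L])
      then show "(T / sqrt (hcoef L i))\<^sup>2 \<le> T\<^sup>2 / hcoef L \<alpha>0"
        using c_pos[of \<alpha>0] c_pos[of i] by (simp add: power_divide frac_le)
    qed simp
    also have "\<dots> = (T\<^sup>2 / hcoef L \<alpha>0) ^ (Suc m ^ CARD('n))" by (simp add: J(3))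
    finally have "emeasure M A \<le> ennreal ((T\<^sup>2 / hcoef L \<alpha>0) ^ (Suc m ^ CARD('n)))"
      using le ennreal_leI order_trans by blast
    then show ?thesis
      using less_imp_le[OF c_pos[of \<alpha>0]] by (simp add: emeasure_eq_measure ennreal_le_iff)
  qed
  have event: "\<omega> \<in> A"
    if \<omega>: "\<omega> \<in> space M" and up: "\<And>\<alpha>. cmod (a \<alpha> \<omega>) \<le> E * s ^ (mdeg \<alpha>)"
      and small: "\<And>x. (\<And>j. cmod (x $ j - w $ j) = r) \<Longrightarrow> cmod (hyperbolic_GAF L a \<omega> x) \<le> \<tau>" for \<omega>
    unfolding A_def
  proof (intro CollectI conjI \<omega> ballI)
    fix i assume "i \<in> J"
    then obtain \<gamma> where \<gamma>: "\<gamma> \<in> Bx" "i = sh \<gamma>" by (auto simp: J_def)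
    define b where "b \<gamma>' = a (sh \<gamma>') \<omega> * of_real (sqrt (hcoef L (sh \<gamma>')))" for \<gamma>'
    define Q where "Q \<kappa> = infsum (\<lambda>\<alpha>. a \<alpha> \<omega> * hterm L (x \<kappa>) \<alpha>) (- J)" for \<kappa>
    have split: "\<mu> \<kappa> * hyperbolic_GAF L a \<omega> (x \<kappa>) = (\<Sum>\<gamma>'\<in>Bx. b \<gamma>' * (\<Prod>j\<in>UNIV. (x \<kappa> $ j) ^ \<gamma>' j)) + \<mu> \<kappa> * Q \<kappa>" for \<kappa>
    proof -
      have summ: "(\<lambda>\<alpha>. a \<alpha> \<omega> * hterm L (x \<kappa>) \<alpha>) summable_on S" for S
        using L by (intro hyperbolic_series_bound(1)[of L s "norm (x \<kappa>)" _ E] s torus x E up) auto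
      have "hyperbolic_GAF L a \<omega> (x \<kappa>) = infsum (\<lambda>\<alpha>. a \<alpha> \<omega> * hterm L (x \<kappa>) \<alpha>) (J \<union> - J)"
        by (simp add: hyperbolic_GAF_def hyperbolic_series_eq)
      also have "\<dots> = (\<Sum>\<alpha>\<in>J. a \<alpha> \<omega> * hterm L (x \<kappa>) \<alpha>) + Q \<kappa>"
        unfolding Q_def by (subst infsum_Un_disjoint) (use summ J in auto)
      also have "(\<Sum>\<alpha>\<in>J. a \<alpha> \<omega> * hterm L (x \<kappa>) \<alpha>) = (\<Sum>\<gamma>'\<in>Bx. a (sh \<gamma>') \<omega> * hterm L (x \<kappa>) (sh \<gamma>'))"
        unfolding J_def by (subst sum.reindex[OF inj_sh]) simp
      also have "\<dots> = (\<Sum>\<gamma>'\<in>Bx. (\<Prod>j\<in>UNIV. (x \<kappa> $ j) ^ \<alpha>0 j) * (b \<gamma>' * (\<Prod>j\<in>UNIV. (x \<kappa> $ j) ^ \<gamma>' j)))"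
      proof (rule sum.cong[OF refl])
        fix \<gamma>' :: "'n \<Rightarrow> nat"
        have "(\<Prod>j\<in>UNIV. (x \<kappa> $ j) ^ sh \<gamma>' j) = (\<Prod>j\<in>UNIV. (x \<kappa> $ j) ^ \<alpha>0 j) * (\<Prod>j\<in>UNIV. (x \<kappa> $ j) ^ \<gamma>' j)"
          by (simp add: sh_def power_add prod.distrib)
        then show "a (sh \<gamma>') \<omega> * hterm L (x \<kappa>) (sh \<gamma>') = (\<Prod>j\<in>UNIV. (x \<kappa> $ j) ^ \<alpha>0 j) * (b \<gamma>' * (\<Prod>j\<in>UNIV. (x \<kappa> $ j) ^ \<gamma>' j))"
          by (simp only: hterm_def b_def mult_ac)
      qed
      also have "\<dots> = (\<Prod>j\<in>UNIV. (x \<kappa> $ j) ^ \<alpha>0 j) * (\<Sum>\<gamma>'\<in>Bx. b \<gamma>' * (\<Prod>j\<in>UNIV. (x \<kappa> $ j) ^ \<gamma>' j))"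
        by (simp add: sum_distrib_left)
      finally show ?thesis
        using node(2)[of \<kappa>] by (simp add: \<mu>_def distrib_left flip: mult.assoc)
    qed
    have "(\<Sum>\<kappa>\<in>Bx. \<Lambda> \<gamma> \<kappa> * (\<mu> \<kappa> * hyperbolic_GAF L a \<omega> (x \<kappa>)))
        = (\<Sum>\<kappa>\<in>Bx. \<Sum>\<gamma>'\<in>Bx. b \<gamma>' * (\<Lambda> \<gamma> \<kappa> * (\<Prod>j\<in>UNIV. (x \<kappa> $ j) ^ \<gamma>' j))) + (\<Sum>\<kappa>\<in>Bx. \<Lambda> \<gamma> \<kappa> * \<mu> \<kappa> * Q \<kappa>)"
      unfolding split distrib_left sum.distrib sum_distrib_left
      by (intro arg_cong2[where f = "(+)"] sum.cong refl) (simp_all only: mult_ac)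
    also have "(\<Sum>\<kappa>\<in>Bx. \<Sum>\<gamma>'\<in>Bx. b \<gamma>' * (\<Lambda> \<gamma> \<kappa> * (\<Prod>j\<in>UNIV. (x \<kappa> $ j) ^ \<gamma>' j)))
        = (\<Sum>\<gamma>'\<in>Bx. b \<gamma>' * (\<Sum>\<kappa>\<in>Bx. \<Lambda> \<gamma> \<kappa> * (\<Prod>j\<in>UNIV. (x \<kappa> $ j) ^ \<gamma>' j)))"
      by (subst sum.swap) (simp add: sum_distrib_left)
    also have "\<dots> = (\<Sum>\<gamma>'\<in>Bx. if \<gamma> = \<gamma>' then b \<gamma>' else 0)"
      using interp[of \<gamma>] \<gamma>(1) unfolding Bx_def by (intro sum.cong refl) auto
    also have "\<dots> = b \<gamma>" using \<gamma>(1) Bx(1) by simp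
    also have "(\<Sum>\<kappa>\<in>Bx. \<Lambda> \<gamma> \<kappa> * \<mu> \<kappa> * Q \<kappa>) = \<rho> i (\<lambda>i\<in>-J. a i \<omega>)"
      unfolding \<rho>_def Q_def \<gamma>(2) sub_sh
      by (intro sum.cong refl arg_cong2[where f = times] infsum_cong) auto
    finally have eq: "of_real (sqrt (hcoef L i)) * a i \<omega> + \<rho> i (\<lambda>i\<in>-J. a i \<omega>)
        = (\<Sum>\<kappa>\<in>Bx. \<Lambda> \<gamma> \<kappa> * (\<mu> \<kappa> * hyperbolic_GAF L a \<omega> (x \<kappa>)))"
      by (simp add: b_def \<gamma>(2) mult.commute)
    have "cmod (\<Lambda> \<gamma> \<kappa> * (\<mu> \<kappa> * hyperbolic_GAF L a \<omega> (x \<kappa>))) \<le> (2 / r) ^ (m * CARD('n)) * (B * \<tau>)" for \<kappa>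
      unfolding norm_mult using r B0 by (intro mult_mono \<Lambda> node small x) auto
    then have "cmod (of_real (sqrt (hcoef L i)) * a i \<omega> + \<rho> i (\<lambda>i\<in>-J. a i \<omega>)) \<le> (\<Sum>\<kappa>\<in>Bx. (2 / r) ^ (m * CARD('n)) * (B * \<tau>))"
      unfolding eq by (intro sum_norm_le)
    also have "\<dots> \<le> T" using T Bx by (simp add: mult_ac)
    finally show "cmod (of_real (sqrt (hcoef L i)) * a i \<omega> + \<rho> i (\<lambda>i\<in>-J. a i \<omega>)) \<le> T" .
  qed
  show ?thesis
    by (rule that[OF A A_le]) (use event not_le in blast)
qed

text \<open>The comparison is required only where the exponent is positive, which exempts the
  vanishing coordinates of w.\<close>

lemma prod_power_le:
  fixes u v :: "'n::finite \<Rightarrow> real"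
  assumes "\<And>j. u j \<ge> 0" "\<And>j. \<alpha> j > 0 \<Longrightarrow> u j \<le> t * v j" "t \<ge> 1" "\<And>j. v j \<ge> 0"
  shows "(\<Prod>j\<in>UNIV. u j ^ \<alpha> j) \<le> t ^ (mdeg \<alpha>) * (\<Prod>j\<in>UNIV. v j ^ \<alpha> j)"
proof -
  have "(\<Prod>j\<in>UNIV. u j ^ \<alpha> j) \<le> (\<Prod>j\<in>UNIV. (t * v j) ^ \<alpha> j)"
  proof (intro prod_mono conjI)
    fix j show "u j ^ \<alpha> j \<le> (t * v j) ^ \<alpha> j"
      using assms by (cases "\<alpha> j = 0") (auto intro: power_mono)
  qed (use assms in auto)
  then show ?thesis by (simp add: power_mult_distrib prod.distrib power_sum)
qed

text \<open>Budget of the exponent \<epsilon>: the dominant term gives away 1/4, the change from w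
  to the nodes in its monomial 1/4, the interpolation weights and the number of nodes 1/8 each. A
  quarter remains, so each of the (m + 1)^n coefficients contributes a factor exp (- \<epsilon> L /
  4) to the probability.\<close>

lemma lower_event:
  fixes w :: "complex ^ 'n::finite"
  assumes w: "norm w < 1" and \<epsilon>: "\<epsilon> > 0" and \<rho>: "\<rho> > 0" and s: "s > 1" and R: "norm w + \<rho> \<le> R" "s ^ 4 * R\<^sup>2 < 1"
  obtains c L0 where "c > 0" "L0 \<ge> 1"
    "\<And>L E (M :: 'w measure) (a :: ('n \<Rightarrow> nat) \<Rightarrow> 'w \<Rightarrow> complex).
      L \<ge> L0 \<Longrightarrow> E \<ge> 0 \<Longrightarrow> prob_space M \<Longrightarrow> iid_complex_gaussians M a \<Longrightarrow>
      \<exists>A\<in>sets M. measure M A \<le> exp (- c * L ^ (CARD('n) + 1)) \<and>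
        (\<forall>\<omega>\<in>space M - A. (\<forall>\<alpha>. cmod (a \<alpha> \<omega>) \<le> E * s ^ (mdeg \<alpha>)) \<longrightarrow>
          (\<exists>x. norm (x - w) \<le> \<rho> \<and> exp (- \<epsilon> * L) * (1 - (norm w)\<^sup>2) powr (- L) < (cmod (hyperbolic_GAF L a \<omega> x))\<^sup>2))"
proof -
  define n where "n = CARD('n)"
  have n: "n \<ge> 1" by (simp add: n_def Suc_leI)
  define u where "u j = (cmod (w $ j))\<^sup>2" for j
  have u: "\<And>j. u j \<ge> 0" "(\<Sum>j\<in>UNIV. u j) = (norm w)\<^sup>2" by (simp_all add: u_def norm_sq_vec)
  have w1: "(norm w)\<^sup>2 < 1" using w power_strict_mono[of "norm w" 1 2] by simp
  obtain C L1 where C: "C > 0" "L1 \<ge> 1"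
    "\<And>L. L \<ge> L1 \<Longrightarrow> \<exists>\<alpha>. real (mdeg \<alpha>) \<le> C * L \<and>
        exp (- (\<epsilon> / 4) * L) * (1 - (\<Sum>j\<in>UNIV. u j)) powr (- L) \<le> hcoef L \<alpha> * (\<Prod>j\<in>UNIV. u j ^ \<alpha> j)"
    using exists_dominant_multi_index[of u "\<epsilon> / 4"] u w1 \<epsilon> by auto
  \<comment> \<open>The dominant index has degree at most C L, so \<open>t ^ (2 * k)\<close> stays
    below exp (\<epsilon> L / 4).\<close>
  define t where "t = exp (\<epsilon> / (8 * C))"
  have t: "t > 1" using \<epsilon> C by (simp add: t_def)
  \<comment> \<open>The smallest nonzero modulus among the coordinates of w, capped at 1; the
    inserted 1 also covers w = 0.\<close>
  define W where "W = Min (insert 1 ((\<lambda>j. cmod (w $ j)) ` {j. w $ j \<noteq> 0}))"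
  have W: "W > 0" unfolding W_def by (subst Min_gr_iff) auto
  have W_le: "W \<le> cmod (w $ j)" if "w $ j \<noteq> 0" for j unfolding W_def using that by (intro Min_le) auto
  \<comment> \<open>\<open>\<rho> / n\<close> keeps the torus within distance \<rho> of w, and
    \<open>W * (1 - 1 / t)\<close> ensures |w_j| \<le> t |x_j| on it for every nonzero w_j.\<close>
  define r where "r = min (1 / 2) (min (\<rho> / n) (W * (1 - 1 / t)))"
  have r: "0 < r" "r \<le> 1" "n * r \<le> \<rho>" "r \<le> W * (1 - 1 / t)"
  proof -
    show "0 < r" using \<rho> n W t by (simp add: r_def)
    show "r \<le> 1" by (simp add: r_def min_def)
    show "r \<le> W * (1 - 1 / t)" by (simp add: r_def)
    have "r \<le> \<rho> / n" by (simp add: r_def)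
    then show "n * r \<le> \<rho>" using n by (simp add: field_simps)
  qed
  have near: "norm (x - w) \<le> \<rho>" if "\<And>j. cmod (x $ j - w $ j) = r" for x
  proof -
    have "norm (x - w) \<le> (\<Sum>j\<in>UNIV. cmod ((x - w) $ j))" unfolding norm_vec_def by (rule L2_set_le_sum) auto
    then show ?thesis using that r(3) by (simp add: n_def)
  qed
  have torus: "s ^ 4 * (norm x)\<^sup>2 < 1" if "\<And>j. cmod (x $ j - w $ j) = r" for x
  proof -
    have "norm x \<le> norm w + norm (x - w)" using norm_triangle_ineq[of w "x - w"] by simp
    then have "norm x \<le> R" using near[OF that] R by simp
    then have "s ^ 4 * (norm x)\<^sup>2 \<le> s ^ 4 * R\<^sup>2" using s by (intro mult_left_mono power_mono) auto
    then show ?thesis using R by simp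
  qed
  have ratio: "cmod (w $ j) \<le> t * cmod (x $ j)" if "w $ j \<noteq> 0" "cmod (x $ j - w $ j) = r" for x j
  proof -
    have "cmod (w $ j) \<le> cmod (x $ j) + r"
      using norm_triangle_ineq4[of "x $ j" "x $ j - w $ j"] that(2) by simp
    also have "r \<le> cmod (w $ j) * (1 - 1 / t)"
    proof -
      have "0 \<le> 1 - 1 / t" using t by simp
      then show ?thesis using r(4) mult_right_mono[OF W_le[OF that(1)], of "1 - 1 / t"] by linarith
    qed
    finally show ?thesis using t by (simp add: field_simps)
  qed
  \<comment> \<open>m will be about \<eta> L, and with this \<eta> the squared weights (2 / r)^(2 m
    n) are at most exp (\<epsilon> L / 8).\<close>
  define \<eta> where "\<eta> = \<epsilon> / (16 * n * ln (2 / r))"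
  have ln_pos: "ln (2 / r) > 0" using r by simp
  have \<eta>: "\<eta> > 0" using \<epsilon> n ln_pos by (simp add: \<eta>_def)
  define c where "c = \<epsilon> / 4 * \<eta> ^ n"
  have "\<forall>\<^sub>F L in at_top. 2 * n * ln (\<eta> * L + 1) \<le> \<epsilon> / 8 * L"
    using \<epsilon> \<eta> n by real_asymp
  then obtain L2 where L2: "\<And>L. L \<ge> L2 \<Longrightarrow> 2 * n * ln (\<eta> * L + 1) \<le> \<epsilon> / 8 * L"
    by (auto simp: eventually_at_top_linorder)
  define L0 where "L0 = max L1 L2"
  have main: "\<exists>A\<in>sets M. measure M A \<le> exp (- c * L ^ (n + 1)) \<and>
        (\<forall>\<omega>\<in>space M - A. (\<forall>\<alpha>. cmod (a \<alpha> \<omega>) \<le> E * s ^ (mdeg \<alpha>)) \<longrightarrow>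
          (\<exists>x. norm (x - w) \<le> \<rho> \<and> exp (- \<epsilon> * L) * (1 - (norm w)\<^sup>2) powr (- L) < (cmod (hyperbolic_GAF L a \<omega> x))\<^sup>2))"
    if L: "L \<ge> L0" and E: "E \<ge> 0" and M: "prob_space M" and a: "iid_complex_gaussians M a"
    for L E and M :: "'w measure" and a :: "('n \<Rightarrow> nat) \<Rightarrow> 'w \<Rightarrow> complex"
  proof -
    interpret prob_space M by fact
    have dist: "\<And>\<alpha>. distributed M lborel (a \<alpha>) std_gaussian_density" and ind: "indep_vars (\<lambda>_. borel) a UNIV"
      using a by (auto simp: iid_complex_gaussians_def)
    have LL: "L \<ge> L1" "L \<ge> L2" "L \<ge> 1" using L C(2) by (auto simp: L0_def)
    obtain \<alpha>0 where \<alpha>0: "real (\<Sum>j\<in>UNIV. \<alpha>0 j) \<le> C * L"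
      "exp (- (\<epsilon> / 4) * L) * (1 - (norm w)\<^sup>2) powr (- L) \<le> hcoef L \<alpha>0 * (\<Prod>j\<in>UNIV. u j ^ \<alpha>0 j)"
      using C(3)[OF LL(1)] u(2) by auto
    define K where "K = (1 - (norm w)\<^sup>2) powr (- L)"
    have K: "K > 0" using w1 by (simp add: K_def)
    define k where "k = (\<Sum>j\<in>UNIV. \<alpha>0 j)"
    define P where "P = (\<Prod>j\<in>UNIV. cmod (w $ j) ^ \<alpha>0 j)"
    have P2: "(\<Prod>j\<in>UNIV. u j ^ \<alpha>0 j) = P\<^sup>2"
      by (simp add: P_def u_def prod_power_distrib mult.commute flip: power_mult)
    have c0: "hcoef L \<alpha>0 > 0" using LL by (intro hcoef_pos) auto
    have dom: "exp (- (\<epsilon> / 4) * L) * K \<le> hcoef L \<alpha>0 * P\<^sup>2" using \<alpha>0(2) by (simp add: P2 K_def)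
    have "0 < exp (- (\<epsilon> / 4) * L) * K" using K by simp
    with dom have "P \<noteq> 0" by (metis less_le_not_le mult_zero_right power_zero_numeral)
    moreover have "P \<ge> 0" by (auto simp: P_def intro!: prod_nonneg)
    ultimately have P: "P > 0" by simp
    \<comment> \<open>The dominant monomial does not vanish at w, so it involves no coordinate with
      w_j = 0, and the nodes can be compared with w in every coordinate that occurs.\<close>
    have w_nz: "w $ j \<noteq> 0" if "\<alpha>0 j > 0" for j
      using that \<open>P \<noteq> 0\<close> by (auto simp: P_def zero_power)
    define B where "B = t ^ k / P"
    have B: "1 \<le> B * (\<Prod>j\<in>UNIV. cmod (x $ j) ^ \<alpha>0 j)" if "\<And>j. cmod (x $ j - w $ j) = r" for x
    proof -
      have "P \<le> t ^ k * (\<Prod>j\<in>UNIV. cmod (x $ j) ^ \<alpha>0 j)"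
        unfolding P_def k_def using t by (intro prod_power_le ratio[OF w_nz that]) auto
      then show ?thesis using P by (simp add: B_def field_simps)
    qed
    define \<tau> where "\<tau> = sqrt (exp (- \<epsilon> * L) * K)"
    have \<tau>: "\<tau> \<ge> 0" "\<tau>\<^sup>2 = exp (- \<epsilon> * L) * K" using K by (auto simp: \<tau>_def)
    \<comment> \<open>The bound on \<open>m\<close> limits the weights from above, while
      \<open>Suc m\<close>, the number of nodes per coordinate, limits the number of coefficients
      from below.\<close>
    define m where "m = nat \<lfloor>\<eta> * L\<rfloor>"
    have m: "real m \<le> \<eta> * L" "\<eta> * L \<le> real (Suc m)"
    proof -
      have "real m = of_int \<lfloor>\<eta> * L\<rfloor>" using \<eta> LL by (simp add: m_def)
      then show "real m \<le> \<eta> * L" "\<eta> * L \<le> real (Suc m)"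
        using of_int_floor_le[of "\<eta> * L"] real_of_int_floor_add_one_ge[of "\<eta> * L"] by linarith+
    qed
    define T where "T = real (Suc m ^ n) * (2 / r) ^ (m * n) * B * \<tau>"
    obtain A where A: "A \<in> sets M" "measure M A \<le> (T\<^sup>2 / hcoef L \<alpha>0) ^ (Suc m ^ n)"
      "\<And>\<omega>. \<omega> \<in> space M \<Longrightarrow> (\<And>\<alpha>. cmod (a \<alpha> \<omega>) \<le> E * s ^ (mdeg \<alpha>)) \<Longrightarrow> \<omega> \<notin> A \<Longrightarrow>
      \<exists>x. (\<forall>j. cmod (x $ j - w $ j) = r) \<and> \<tau> < cmod (hyperbolic_GAF L a \<omega> x)"
    proof (rule lower_event_fixed[OF dist ind LL(3) _ r(1,2) s torus B E \<tau>(1), where m = m and T = T])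
      show "cmod (w $ j) \<le> 1" for j using Finite_Cartesian_Product.norm_nth_le[of w j] w by simp
      show "real (Suc m ^ CARD('n)) * (2 / r) ^ (m * CARD('n)) * B * \<tau> \<le> T" by (simp add: T_def n_def)
    qed (use that in \<open>auto simp: n_def\<close>)
    have small: "T\<^sup>2 / hcoef L \<alpha>0 \<le> exp (- (\<epsilon> / 4) * L)"
    proof -
      have "T\<^sup>2 = (real (Suc m)) ^ (2 * n) * (2 / r) ^ (2 * m * n) * t ^ (2 * k) * (exp (- \<epsilon> * L) * K) / P\<^sup>2"
        unfolding T_def power_mult_distrib \<tau>(2) B_def power_divide
        by (simp add: mult_ac flip: power_mult)
      moreover have "real (Suc m) ^ (2 * n) \<le> exp (\<epsilon> / 8 * L)"
      proof -
        have "real (Suc m) ^ (2 * n) \<le> (\<eta> * L + 1) ^ (2 * n)" using m by (intro power_mono) auto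
        also have "\<dots> = exp (2 * n * ln (\<eta> * L + 1))"
        proof -
          have "\<eta> * L + 1 > 0" using \<eta> LL by (simp add: add_pos_pos)
          then show ?thesis using exp_of_nat_mult[of "2 * n" "ln (\<eta> * L + 1)"] by simp
        qed
        also have "\<dots> \<le> exp (\<epsilon> / 8 * L)" using L2[OF LL(2)] by simp
        finally show ?thesis .
      qed
      moreover have "(2 / r) ^ (2 * m * n) \<le> exp (\<epsilon> / 8 * L)"
      proof -
        have "(2 / r) ^ (2 * m * n) = exp (real (2 * m * n) * ln (2 / r))"
          using r exp_of_nat_mult[of "2 * m * n" "ln (2 / r)"] by simp
        also have "real (2 * m * n) * ln (2 / r) \<le> (2 * n * ln (2 / r)) * (\<eta> * L)"
          using mult_left_mono[OF m(1), of "2 * n * ln (2 / r)"] ln_pos by (simp add: mult_ac)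
        also have "(2 * n * ln (2 / r)) * (\<eta> * L) = \<epsilon> / 8 * L"
          using n ln_pos unfolding \<eta>_def by (simp add: field_simps)
        finally show ?thesis by simp
      qed
      moreover have "t ^ (2 * k) \<le> exp (\<epsilon> / 4 * L)"
      proof -
        have "t ^ (2 * k) = exp (real (2 * k) * (\<epsilon> / (8 * C)))" unfolding t_def by (rule exp_of_nat_mult[symmetric])
        also have "real (2 * k) * (\<epsilon> / (8 * C)) \<le> 2 * (C * L) * (\<epsilon> / (8 * C))"
          using \<alpha>0(1) \<epsilon> C by (intro mult_right_mono) (auto simp: k_def)
        also have "\<dots> = \<epsilon> / 4 * L" using C by simp
        finally show ?thesis by simp
      qed
      ultimately have "T\<^sup>2 \<le> exp (\<epsilon> / 8 * L) * exp (\<epsilon> / 8 * L) * exp (\<epsilon> / 4 * L) * (exp (- \<epsilon> * L) * K) / P\<^sup>2"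
        using K r t P by (auto intro!: divide_right_mono mult_mono)
      also have "\<dots> = exp (- (\<epsilon> / 4) * L) * (exp (- (\<epsilon> / 4) * L) * K) / P\<^sup>2"
        by (simp add: algebra_simps flip: exp_add)
      also have "\<dots> \<le> exp (- (\<epsilon> / 4) * L) * (hcoef L \<alpha>0 * P\<^sup>2) / P\<^sup>2"
        using dom by (intro divide_right_mono mult_left_mono) auto
      also have "\<dots> = exp (- (\<epsilon> / 4) * L) * hcoef L \<alpha>0" using P by simp
      finally show ?thesis using c0 by (simp add: divide_le_eq)
    qed
    have "measure M A \<le> exp (- c * L ^ (n + 1))"
    proof -
      have "measure M A \<le> exp (- (\<epsilon> / 4) * L) ^ (Suc m ^ n)"
        by (rule order_trans[OF A(2)], intro power_mono small) (use c0 in simp)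
      also have "\<dots> = exp (- (real (Suc m ^ n) * (\<epsilon> / 4 * L)))"
        unfolding exp_of_nat_mult[symmetric] by simp
      also have "\<dots> \<le> exp (- c * L ^ (n + 1))"
      proof -
        have "(\<eta> * L) ^ n \<le> real (Suc m) ^ n" using m \<eta> LL by (intro power_mono) auto
        then have "(\<eta> * L) ^ n * (\<epsilon> / 4 * L) \<le> real (Suc m ^ n) * (\<epsilon> / 4 * L)"
          using \<epsilon> LL by (intro mult_right_mono) auto
        then show ?thesis by (simp add: c_def power_mult_distrib mult_ac)
      qed
      finally show ?thesis .
    qed
    moreover have "\<exists>x. norm (x - w) \<le> \<rho> \<and> exp (- \<epsilon> * L) * (1 - (norm w)\<^sup>2) powr (- L) < (cmod (hyperbolic_GAF L a \<omega> x))\<^sup>2"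
      if \<omega>: "\<omega> \<in> space M - A" "\<forall>\<alpha>. cmod (a \<alpha> \<omega>) \<le> E * s ^ (mdeg \<alpha>)" for \<omega>
    proof -
      obtain x where x: "\<forall>j. cmod (x $ j - w $ j) = r" "\<tau> < cmod (hyperbolic_GAF L a \<omega> x)"
        using A(3)[of \<omega>] \<omega> by auto
      have "\<tau>\<^sup>2 < (cmod (hyperbolic_GAF L a \<omega> x))\<^sup>2" using x(2) \<tau>(1) by (intro power_strict_mono) auto
      then show ?thesis using near[of x] x(1) \<tau>(2) by (auto simp: K_def)
    qed
    ultimately show ?thesis using A(1) by blast
  qed
  show ?thesis
  proof (rule that[of c L0])
    show "c > 0" using \<epsilon> \<eta> by (simp add: c_def)
    show "L0 \<ge> 1" using C(2) by (simp add: L0_def)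
  qed (use main in \<open>simp add: n_def\<close>)
qed

section \<open>Concentration in \<open>L\<^sup>1\<close>\<close>

lemma hyperbolic_series_measurable [measurable]: "hyperbolic_series L c \<in> borel_measurable borel"
  unfolding hyperbolic_series_eq[abs_def] hterm_def
  by (intro borel_measurable_infsum borel_measurable_continuous_onI continuous_intros)

lemma hyp_potential_measurable [measurable]: "(hyp_potential :: complex ^ 'n::finite \<Rightarrow> real) \<in> borel_measurable borel"
  unfolding hyp_potential_def by measurable

lemma continuous_on_hyp_potential: "R < 1 \<Longrightarrow> continuous_on (cball (0 :: complex ^ 'n::finite) R) hyp_potential"
proof -
  assume "R < 1"
  have "1 - (norm z)\<^sup>2 \<noteq> 0" if "norm z \<le> R" for z :: "complex ^ 'n"
    using that \<open>R < 1\<close> power_strict_mono[of "norm z" 1 2] by simp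
  then show ?thesis unfolding hyp_potential_def by (auto intro!: continuous_intros)
qed

lemma hyp_potential_nonneg: "norm z < 1 \<Longrightarrow> hyp_potential z \<ge> 0"
  using power_strict_mono[of "norm z" 1 2] by (simp add: hyp_potential_def)

text \<open>(1 - x) / (1 - S x) equals 1 + (S - 1) x / (1 - S x). With S = s^4 this is the price of
  the dilation in the upper bound of f.\<close>

lemma hyp_potential_dilation:
  fixes z :: "complex ^ 'n::finite"
  assumes "S \<ge> 1" "S * R\<^sup>2 < 1" "norm z \<le> R"
  shows "- ln (1 - S * (norm z)\<^sup>2) \<le> hyp_potential z + (S - 1) / (1 - S * R\<^sup>2)"
proof -
  define x where "x = (norm z)\<^sup>2"
  have x: "0 \<le> x" "x \<le> R\<^sup>2" using assms(3) by (auto simp: x_def intro: power_mono)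
  have "1 * R\<^sup>2 \<le> S * R\<^sup>2" by (rule mult_right_mono) (use assms in auto)
  then have R1: "x < 1" using x assms by linarith
  have Sx: "S * x \<le> S * R\<^sup>2" using x assms by (intro mult_left_mono) auto
  have pos: "1 - S * x > 0" "1 - S * R\<^sup>2 > 0" using Sx assms by linarith+
  have "ln (1 - x) - ln (1 - S * x) = ln ((1 - x) / (1 - S * x))" using pos R1 by (simp add: ln_div)
  also have "\<dots> = ln (1 + (S - 1) * x / (1 - S * x))" using pos by (simp add: field_simps)
  also have "\<dots> \<le> (S - 1) * x / (1 - S * x)"
    using pos x assms by (intro ln_add_one_self_le_self) auto
  also have "\<dots> \<le> (S - 1) * 1 / (1 - S * R\<^sup>2)"
    using pos x R1 assms Sx by (intro frac_le mult_left_mono) auto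
  finally show ?thesis by (simp add: hyp_potential_def x_def)
qed

(* On the ball the function v = ln |f|^2 - L psi is at most G, while the submean value property bounds its mean from below; Fatou's lemma removes the truncation of the logarithm. *)
lemma local_L1_bound:
  fixes c :: "('n::finite \<Rightarrow> nat) \<Rightarrow> complex" and z0 :: "complex ^ 'n"
  assumes L: "L > 0" and s: "s > 1" and R: "s ^ 4 * R\<^sup>2 < 1" "norm z0 + \<rho> \<le> R" and \<rho>: "\<rho> > 0" and E: "E \<ge> 0"
    and c: "\<And>\<alpha>. cmod (c \<alpha>) \<le> E * s ^ (mdeg \<alpha>)"
    and G: "G \<ge> 0" "\<And>z. norm z \<le> R \<Longrightarrow> (cmod (hyperbolic_series L c z))\<^sup>2 \<le> exp (G + L * hyp_potential z)"
    and b: "\<And>z. z \<in> ball z0 \<rho> \<Longrightarrow> hyp_potential z \<le> b"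
    and low: "exp (L * b - H) < (cmod (hyperbolic_series L c z0))\<^sup>2"
  shows "(\<integral>\<^sup>+z\<in>ball z0 \<rho>. ennreal \<bar>ln ((cmod (hyperbolic_series L c z))\<^sup>2) - L * hyp_potential z\<bar> \<partial>lborel)
      \<le> ennreal ((2 * G + H) * measure lborel (ball z0 \<rho>))"
proof -
  define f where "f = hyperbolic_series L c"
  have R1: "R < 1"
  proof (rule ccontr)
    assume "\<not> R < 1"
    then have "1 \<le> R\<^sup>2" "1 \<le> s ^ 4" using s by (auto simp: one_le_power)
    then have "1 * 1 \<le> s ^ 4 * R\<^sup>2" by (intro mult_mono) auto
    then show False using R by simp
  qed
  have [measurable]: "f \<in> borel_measurable borel" unfolding f_def by measurable
  have [measurable]: "ball z0 \<rho> \<in> sets borel" by simp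
  have ball_R: "norm z \<le> R" if "z \<in> cball z0 \<rho>" for z
  proof -
    have "norm z \<le> norm z0 + norm (z - z0)" using norm_triangle_ineq[of z0 "z - z0"] by simp
    then show ?thesis using that R(2) by (simp add: dist_norm norm_minus_commute)
  qed
  have psi0: "hyp_potential z \<ge> 0" if "z \<in> ball z0 \<rho>" for z
    using ball_R[of z] that R1 by (intro hyp_potential_nonneg) auto
  have f_cont: "continuous_on (cball z0 \<rho>) f"
    unfolding f_def using ball_R
    by (intro continuous_on_subset[OF hyperbolic_series_continuous_holomorphic(1)[OF L s R(1) E c]]) auto
  have f0: "f z0 \<noteq> 0" using low by (auto simp: f_def)
  have vol: "emeasure lborel (ball z0 \<rho>) = ennreal (measure lborel (ball z0 \<rho>))"
    using emeasure_lborel_ball_finite[of z0 \<rho>] by (simp add: measure_def)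
  define V where "V = measure lborel (ball z0 \<rho>)"
  have V: "V \<ge> 0" by (simp add: V_def)
  \<comment> \<open>G - v with the modulus of f floored at 1 / (k + 1). The floor is at most 1, so
    the upper bound for |f|^2 holds for the floored modulus too; hence \<open>g\<close> is
    nonnegative on the ball, as Fatou's lemma demands.\<close>
  define g where "g k z = G + L * hyp_potential z - 2 * ln (max (cmod (f z)) (inverse (real (Suc k))))" for k z
  have [measurable]: "g k \<in> borel_measurable borel" for k unfolding g_def by measurable
  have g_nonneg: "g k z \<ge> 0" if "z \<in> ball z0 \<rho>" for k z
  proof -
    have e1: "1 \<le> exp (G + L * hyp_potential z)" using G(1) L psi0[OF that] by simp
    have "(max (cmod (f z)) (inverse (real (Suc k))))\<^sup>2 \<le> exp (G + L * hyp_potential z)"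
    proof (cases "cmod (f z) \<le> inverse (real (Suc k))")
      case True
      have "(inverse (real (Suc k)))\<^sup>2 \<le> 1" by (intro power_le_one) (auto simp: field_simps)
      then show ?thesis unfolding max_absorb2[OF True] using e1 by linarith
    next
      case False
      then show ?thesis using G(2)[of z] ball_R[of z] that by (simp add: f_def max_def)
    qed
    moreover have "max (cmod (f z)) (inverse (real (Suc k))) > 0" by (simp add: less_max_iff_disj)
    ultimately have "2 * ln (max (cmod (f z)) (inverse (real (Suc k)))) \<le> G + L * hyp_potential z"
      using ln_mono[of "(max (cmod (f z)) (inverse (real (Suc k))))\<^sup>2" "exp (G + L * hyp_potential z)"]
      by (simp add: ln_realpow)
    then show ?thesis by (simp add: g_def)
  qed
  have g_int: "(\<integral>\<^sup>+z\<in>ball z0 \<rho>. ennreal (g k z) \<partial>lborel) \<le> ennreal ((G + H) * V)" for k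
  proof -
    let ?e = "inverse (real (Suc k))"
    let ?l = "\<lambda>z. ln (max (cmod (f z)) ?e)"
    have "continuous_on (cball z0 \<rho>) ?l"
      by (intro continuous_intros f_cont) (auto simp: less_max_iff_disj max_def)
    then have "set_integrable lborel (cball z0 \<rho>) ?l"
      unfolding set_integrable_def by (intro borel_integrable_compact) auto
    then have l_int: "set_integrable lborel (ball z0 \<rho>) ?l"
      by (rule set_integrable_subset) auto
    have const_int: "set_integrable lborel (ball z0 \<rho>) (\<lambda>_. G + L * b)"
      using emeasure_lborel_ball_finite[of z0 \<rho>] by (auto simp: set_integrable_def)
    have "(\<integral>\<^sup>+z\<in>ball z0 \<rho>. ennreal (g k z) \<partial>lborel) \<le> (\<integral>\<^sup>+z. ennreal (indicator (ball z0 \<rho>) z * (G + L * b - 2 * ?l z)) \<partial>lborel)"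
    proof (rule nn_integral_mono)
      fix z
      show "ennreal (g k z) * indicator (ball z0 \<rho>) z \<le> ennreal (indicator (ball z0 \<rho>) z * (G + L * b - 2 * ?l z))"
        using b[of z] L by (auto simp: indicator_def g_def intro!: ennreal_leI)
    qed
    also have "\<dots> = ennreal (\<integral>z. indicator (ball z0 \<rho>) z * (G + L * b - 2 * ?l z) \<partial>lborel)"
    proof (rule nn_integral_eq_integral)
      have "set_integrable lborel (ball z0 \<rho>) (\<lambda>z. (G + L * b) - 2 * ?l z)"
        by (intro set_integral_diff const_int set_integrable_mult_right l_int)
      then show "integrable lborel (\<lambda>z. indicator (ball z0 \<rho>) z * (G + L * b - 2 * ?l z))"
        by (simp add: set_integrable_def)
      show "AE z in lborel. 0 \<le> indicator (ball z0 \<rho>) z * (G + L * b - 2 * ?l z)"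
      proof (rule AE_I2)
        fix z
        show "0 \<le> indicator (ball z0 \<rho>) z * (G + L * b - 2 * ?l z)"
        proof (cases "z \<in> ball z0 \<rho>")
          case True
          have "L * hyp_potential z \<le> L * b" using b[OF True] L by simp
          then show ?thesis using g_nonneg[OF True, of k] True by (simp add: g_def)
        qed simp
      qed
    qed
    also have "(\<integral>z. indicator (ball z0 \<rho>) z * (G + L * b - 2 * ?l z) \<partial>lborel)
        = (LINT z:ball z0 \<rho>|lborel. (G + L * b)) - 2 * (LINT z:ball z0 \<rho>|lborel. ?l z)"
      using set_integral_diff(2)[OF const_int set_integrable_mult_right[OF l_int, of 2]]
      by (simp add: set_lebesgue_integral_def)
    also have "(LINT z:ball z0 \<rho>|lborel. (G + L * b)) = (G + L * b) * V"
      using vol by (simp add: set_lebesgue_integral_def V_def mult.commute)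
    also have "(G + L * b) * V - 2 * (LINT z:ball z0 \<rho>|lborel. ?l z) \<le> (G + H) * V"
    proof -
      have "V * ln (cmod (f z0)) \<le> (LINT z:ball z0 \<rho>|lborel. ?l z)"
        unfolding V_def
      proof (rule submean_ln_ball[OF f_cont \<rho> _ f0])
        show "(\<lambda>t. f (z0 + t *s y)) holomorphic_on ball 0 1" if "norm y \<le> \<rho>" for y
          unfolding f_def using that R(2)
          by (intro hyperbolic_series_continuous_holomorphic(2)[OF L s R(1) E c]) auto
      qed simp
      moreover have "L * b - H \<le> 2 * ln (cmod (f z0))"
      proof -
        have "ln (exp (L * b - H)) \<le> ln ((cmod (f z0))\<^sup>2)"
          using low f0 by (intro ln_mono) (auto simp: f_def)
        then show ?thesis using f0 by (simp add: ln_realpow)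
      qed
      then have "(L * b - H) * V \<le> 2 * ln (cmod (f z0)) * V" using V by (rule mult_right_mono)
      ultimately show ?thesis by (simp add: algebra_simps)
    qed
    finally show ?thesis by (simp add: ennreal_leI)
  qed
  define v where "v z = ln ((cmod (f z))\<^sup>2) - L * hyp_potential z" for z
  have [measurable]: "v \<in> borel_measurable borel" unfolding v_def by measurable
  have v_le: "v z \<le> G" if "z \<in> ball z0 \<rho>" for z
  proof (cases "f z = 0")
    case True
    have "0 \<le> L * hyp_potential z" using L psi0[OF that] by simp
    then show ?thesis using True G(1) by (simp add: v_def)
  next
    case False
    have "ln ((cmod (f z))\<^sup>2) \<le> ln (exp (G + L * hyp_potential z))"
      using G(2)[of z] ball_R[of z] that False by (intro ln_mono) (auto simp: f_def)
    then show ?thesis by (simp add: v_def)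
  qed
  have lim: "ennreal (G - v z) \<le> liminf (\<lambda>k. ennreal (g k z))" if z: "z \<in> ball z0 \<rho>" for z
  proof (rule Liminf_bounded)
    show "\<forall>\<^sub>F k in sequentially. ennreal (G - v z) \<le> ennreal (g k z)"
    proof (cases "f z = 0")
      case False
      then obtain N where N: "inverse (real (Suc N)) < cmod (f z)" using reals_Archimedean[of "cmod (f z)"] by auto
      have "G - v z \<le> g k z" if "k \<ge> N" for k
      proof -
        have "inverse (real (Suc k)) \<le> inverse (real (Suc N))" using that by simp
        then have "max (cmod (f z)) (inverse (real (Suc k))) = cmod (f z)"
          using N by (intro max_absorb1) linarith
        then show ?thesis using False by (simp add: g_def v_def ln_realpow)
      qed
      then show ?thesis by (auto simp: eventually_sequentially intro!: exI[of _ N] ennreal_leI)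
    next
      \<comment> \<open>At a zero, ln 0 = 0 gives v = - L \<psi>; since ln (1 / (k + 1)) \<le> 0 the
        inequality survives, and the zero set needs no separate treatment.\<close>
      case True
      have "G - v z \<le> g k z" for k
      proof -
        have "ln (inverse (real (Suc k))) \<le> 0" by (simp add: field_simps)
        then show ?thesis using True by (simp add: g_def v_def max_def)
      qed
      then show ?thesis by (auto intro!: always_eventually ennreal_leI)
    qed
  qed
  have "(\<integral>\<^sup>+z\<in>ball z0 \<rho>. ennreal (G - v z) \<partial>lborel) \<le> (\<integral>\<^sup>+z. liminf (\<lambda>k. ennreal (g k z) * indicator (ball z0 \<rho>) z) \<partial>lborel)"
  proof (rule nn_integral_mono)
    fix z
    show "ennreal (G - v z) * indicator (ball z0 \<rho>) z \<le> liminf (\<lambda>k. ennreal (g k z) * indicator (ball z0 \<rho>) z)"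
      using lim[of z] by (cases "z \<in> ball z0 \<rho>") auto
  qed
  also have "\<dots> \<le> liminf (\<lambda>k. \<integral>\<^sup>+z\<in>ball z0 \<rho>. ennreal (g k z) \<partial>lborel)"
    by (rule nn_integral_liminf) measurable
  also have "\<dots> \<le> ennreal ((G + H) * V)"
    by (rule Liminf_le) (auto intro!: always_eventually g_int)
  finally have main: "(\<integral>\<^sup>+z\<in>ball z0 \<rho>. ennreal (G - v z) \<partial>lborel) \<le> ennreal ((G + H) * V)" .
  have GH: "0 \<le> (G + H) * V"
  proof -
    have "L * b - H < G + L * b"
    proof -
      have "exp (L * b - H) < exp (G + L * hyp_potential z0)"
        by (rule less_le_trans[OF low G(2)]) (use R(2) \<rho> in simp)
      moreover have "L * hyp_potential z0 \<le> L * b" using b[of z0] \<rho> L by simp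
      ultimately show ?thesis by simp
    qed
    then show ?thesis using V by simp
  qed
  \<comment> \<open>|v| \<le> G + (G - v) because G \<ge> 0 and v \<le> G; this is the source of the
    constant 2 G + H.\<close>
  have "(\<integral>\<^sup>+z\<in>ball z0 \<rho>. ennreal \<bar>v z\<bar> \<partial>lborel) \<le> (\<integral>\<^sup>+z. ennreal G * indicator (ball z0 \<rho>) z + ennreal (G - v z) * indicator (ball z0 \<rho>) z \<partial>lborel)"
  proof (rule nn_integral_mono)
    fix z
    show "ennreal \<bar>v z\<bar> * indicator (ball z0 \<rho>) z \<le> ennreal G * indicator (ball z0 \<rho>) z + ennreal (G - v z) * indicator (ball z0 \<rho>) z"
      using v_le[of z] G(1) by (cases "z \<in> ball z0 \<rho>") (auto simp flip: ennreal_plus intro!: ennreal_leI)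
  qed
  also have "\<dots> = ennreal G * ennreal V + (\<integral>\<^sup>+z\<in>ball z0 \<rho>. ennreal (G - v z) \<partial>lborel)"
    by (subst nn_integral_add) (auto simp: nn_integral_cmult_indicator vol V_def)
  also have "\<dots> \<le> ennreal (G * V) + ennreal ((G + H) * V)"
    using main V G(1) by (simp add: ennreal_mult add_left_mono)
  also have "\<dots> = ennreal ((2 * G + H) * V)"
    using GH V G(1) by (simp flip: ennreal_plus add: algebra_simps)
  finally show ?thesis by (simp add: v_def f_def V_def)
qed

section \<open>Covering the compact set and collecting the exceptional events\<close>

abbreviation log_deviation ::
  "real \<Rightarrow> (('n::finite \<Rightarrow> nat) \<Rightarrow> 'w \<Rightarrow> complex) \<Rightarrow> 'w \<Rightarrow> complex ^ 'n \<Rightarrow> real" where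
  "log_deviation L a \<omega> z \<equiv> ln ((cmod (hyperbolic_GAF L a \<omega> z))\<^sup>2) - L * hyp_potential z"

text \<open>Take a \<rho>-separated subset of greatest cardinality: the balls of radius \<rho> / 2
  around its points are disjoint, so volume bounds its size. Later the product of cardinality and
  ball volume matters, and this stays bounded as \<rho> shrinks.\<close>

lemma separated_cover:
  fixes S :: "'a::euclidean_space set"
  assumes S: "S \<subseteq> cball 0 R" and \<rho>: "\<rho> > 0" and R: "R \<ge> 0"
  obtains W where "finite W" "W \<subseteq> S" "S \<subseteq> (\<Union>w\<in>W. ball w \<rho>)"
    "real (card W) * measure lborel (ball (0::'a) (\<rho> / 2)) \<le> measure lborel (ball (0::'a) (R + \<rho>))"
proof -
  define V where "V t = measure lborel (ball (0::'a) t)" for t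
  have V: "emeasure lborel (ball x t) = ennreal (V t)" for x :: 'a and t
  proof (cases "t > 0")
    case True
    then have "measure lborel (ball x t) = V t"
      by (simp add: V_def content_ball_conv_unit_ball[of t x] content_ball_conv_unit_ball[of t 0])
    then show ?thesis using emeasure_lborel_ball_finite[of x t] by (simp add: emeasure_eq_ennreal_measure)
  qed (simp add: V_def ball_empty)
  have V_pos: "V (\<rho> / 2) > 0" using \<rho> by (simp add: V_def content_ball_pos)
  define P where "P W \<longleftrightarrow> finite W \<and> W \<subseteq> S \<and> (\<forall>x\<in>W. \<forall>y\<in>W. x \<noteq> y \<longrightarrow> \<rho> \<le> dist x y)" for W
  have card_le: "real (card W) * V (\<rho> / 2) \<le> V (R + \<rho>)" if "P W" for W
  proof -
    have "ennreal (real (card W) * V (\<rho> / 2)) = (\<Sum>x\<in>W. emeasure lborel (ball x (\<rho> / 2)))"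
      using V_pos by (simp add: V ennreal_mult' ennreal_of_nat_eq_real_of_nat)
    also have "\<dots> = emeasure lborel (\<Union>x\<in>W. ball x (\<rho> / 2))"
    proof (rule sum_emeasure)
      show "disjoint_family_on (\<lambda>x. ball x (\<rho> / 2)) W"
        unfolding disjoint_family_on_def
      proof (intro ballI impI)
        fix x y assume "x \<in> W" "y \<in> W" "x \<noteq> y"
        then have "\<rho> \<le> dist x y" using that by (auto simp: P_def)
        show "ball x (\<rho> / 2) \<inter> ball y (\<rho> / 2) = {}"
        proof (rule ccontr)
          assume "ball x (\<rho> / 2) \<inter> ball y (\<rho> / 2) \<noteq> {}"
          then obtain z where "dist x z < \<rho> / 2" "dist y z < \<rho> / 2" by auto
          then show False using \<open>\<rho> \<le> dist x y\<close> dist_triangle2[of x y z] by linarith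
        qed
      qed
    qed (use that in \<open>auto simp: P_def\<close>)
    also have "\<dots> \<le> emeasure lborel (ball (0::'a) (R + \<rho>))"
    proof (rule emeasure_mono)
      show "(\<Union>x\<in>W. ball x (\<rho> / 2)) \<subseteq> ball 0 (R + \<rho>)"
      proof safe
        fix x z assume x: "x \<in> W" and z: "z \<in> ball x (\<rho> / 2)"
        have "norm x \<le> R" using x that S by (auto simp: P_def)
        moreover have "norm z \<le> norm x + dist x z" using norm_triangle_ineq[of x "z - x"] by (simp add: dist_norm norm_minus_commute)
        ultimately show "z \<in> ball 0 (R + \<rho>)" using z \<rho> by simp
      qed
    qed simp
    finally show ?thesis by (simp add: V V_def ennreal_le_iff)
  qed
  have "P {}" by (simp add: P_def)
  moreover have "card W < Suc (nat \<lfloor>V (R + \<rho>) / V (\<rho> / 2)\<rfloor>)" if "P W" for W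
  proof -
    have "real (card W) \<le> V (R + \<rho>) / V (\<rho> / 2)" using card_le[OF that] V_pos by (simp add: field_simps)
    then show ?thesis by (simp add: less_Suc_eq_le le_nat_floor)
  qed
  ultimately obtain W where W: "P W" "\<And>W'. P W' \<Longrightarrow> card W' \<le> card W"
    using ex_has_greatest_nat[of P "{}" card "Suc (nat \<lfloor>V (R + \<rho>) / V (\<rho> / 2)\<rfloor>)"] by blast
  have "S \<subseteq> (\<Union>w\<in>W. ball w \<rho>)"
  proof
    fix z assume z: "z \<in> S"
    show "z \<in> (\<Union>w\<in>W. ball w \<rho>)"
    proof (rule ccontr)
      assume "z \<notin> (\<Union>w\<in>W. ball w \<rho>)"
      then have far: "\<rho> \<le> dist w z" if "w \<in> W" for w using that by (auto simp: not_less)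
      then have "z \<notin> W" using \<rho> by fastforce
      have "P (insert z W)" using W(1) z far by (auto simp: P_def dist_commute)
      then show False using W(2)[of "insert z W"] W(1) \<open>z \<notin> W\<close> by (simp add: P_def)
    qed
  qed
  then show ?thesis using that[of W] W(1) card_le[OF W(1)] by (auto simp: P_def V_def)
qed

text \<open>s^4 = 1 + \<sigma> with \<sigma> so small that the denominator stays above (1 - R^2) /
  2.\<close>

lemma exists_dilation:
  assumes "0 < R" "R < 1" "\<epsilon> > 0"
  obtains s :: real where "s > 1" "s ^ 4 * R\<^sup>2 < 1" "(s ^ 4 - 1) / (1 - s ^ 4 * R\<^sup>2) \<le> \<epsilon>"
proof -
  have R2: "0 < R\<^sup>2" "R\<^sup>2 < 1" using assms power_strict_mono[of R 1 2] by auto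
  define \<sigma> where "\<sigma> = min 1 \<epsilon> * ((1 - R\<^sup>2) / 2)"
  have \<sigma>: "\<sigma> > 0" "\<sigma> \<le> (1 - R\<^sup>2) / 2" "\<sigma> \<le> \<epsilon> * ((1 - R\<^sup>2) / 2)"
    using R2 assms by (auto simp: \<sigma>_def mult_right_mono mult_left_le_one_le intro!: mult_right_mono)
  define s where "s = root 4 (1 + \<sigma>)"
  have s4: "s ^ 4 = 1 + \<sigma>" using \<sigma> by (simp add: s_def)
  have "\<sigma> * R\<^sup>2 \<le> \<sigma> * 1" using R2 \<sigma> by (intro mult_left_mono) auto
  moreover have "1 - s ^ 4 * R\<^sup>2 = 1 - R\<^sup>2 - \<sigma> * R\<^sup>2" by (simp add: s4 algebra_simps)
  moreover have "1 - R\<^sup>2 - (1 - R\<^sup>2) / 2 = (1 - R\<^sup>2) / 2" by (simp add: field_simps)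
  ultimately have d: "1 - s ^ 4 * R\<^sup>2 \<ge> (1 - R\<^sup>2) / 2" using \<sigma>(2) by linarith
  have pos: "1 - s ^ 4 * R\<^sup>2 > 0" by (rule less_le_trans[OF _ d]) (use R2 in simp)
  show ?thesis
  proof (rule that[of s])
    show "s > 1" using \<sigma> by (simp add: s_def)
    show "s ^ 4 * R\<^sup>2 < 1" using pos by simp
    have "\<sigma> \<le> \<epsilon> * (1 - s ^ 4 * R\<^sup>2)" using \<sigma>(3) d mult_left_mono[OF d, of \<epsilon>] assms by linarith
    then show "(s ^ 4 - 1) / (1 - s ^ 4 * R\<^sup>2) \<le> \<epsilon>" using pos by (simp add: s4 divide_le_eq)
  qed
qed

text \<open>Outside the exceptional events, balls of radius 2 \<rho> around the good points cover
  \<open>cball 0 R0\<close>, and the local bounds add up. The order of choices matters: \<epsilon>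
  depends on \<kappa> and the dimension only, s and \<rho> on \<epsilon>, the cover on
  \<rho>.\<close>

lemma L1_concentration:
  fixes R0 \<kappa> :: real
  assumes R0: "0 < R0" "R0 < 1" and \<kappa>: "\<kappa> > 0"
  obtains c L0 where "c > 0" "L0 \<ge> 1"
    "\<And>L (M :: 'w measure) (a :: ('n::finite \<Rightarrow> nat) \<Rightarrow> 'w \<Rightarrow> complex).
      L \<ge> L0 \<Longrightarrow> prob_space M \<Longrightarrow> iid_complex_gaussians M a \<Longrightarrow>
      \<exists>A\<in>sets M. measure M A \<le> exp (- c * L ^ (CARD('n) + 1)) \<and>
        (\<forall>\<omega>\<in>space M - A. (\<integral>\<^sup>+z\<in>cball 0 R0. ennreal \<bar>log_deviation L a \<omega> z\<bar> \<partial>lborel)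
          \<le> ennreal (\<kappa> * L))"
proof -
  define n where "n = CARD('n)"
  define V where "V t = measure lborel (ball (0 :: complex ^ 'n) t)" for t
  have V_eq: "measure lborel (ball x t) = V t" if "t > 0" for x :: "complex ^ 'n" and t
    using that by (simp add: V_def content_ball_conv_unit_ball[of t x] content_ball_conv_unit_ball[of t 0])
  have V2: "V 2 > 0" by (simp add: V_def content_ball_pos)
  \<comment> \<open>The ratio of the volumes of balls of radii 2 \<rho> and \<rho> / 2.\<close>
  define D where "D = (4 :: real) ^ DIM(complex ^ 'n)"
  have D: "D > 0" by (simp add: D_def)
  \<comment> \<open>Each ball contributes 8 \<epsilon> L V(2 \<rho>), and the separated cover makes
    the sum of the V(2 \<rho>) at most D V(2).\<close>
  define \<epsilon> where "\<epsilon> = \<kappa> / (8 * D * V 2)"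
  have \<epsilon>: "\<epsilon> > 0" "8 * \<epsilon> * D * V 2 = \<kappa>" using \<kappa> D V2 by (auto simp: \<epsilon>_def)
  define R where "R = (1 + R0) / 2"
  have R: "0 < R" "R < 1" "R0 < R" using R0 by (auto simp: R_def)
  obtain s where s: "s > 1" "s ^ 4 * R\<^sup>2 < 1" "(s ^ 4 - 1) / (1 - s ^ 4 * R\<^sup>2) \<le> \<epsilon>"
    using exists_dilation[OF R(1,2) \<epsilon>(1)] by blast
  define g where "g = geom_const s n"
  have g: "g > 0" using s by (simp add: g_def geom_const_pos)
  have "uniformly_continuous_on (cball 0 R) (hyp_potential :: complex ^ 'n \<Rightarrow> real)"
    by (intro compact_uniformly_continuous continuous_on_hyp_potential R) auto
  then obtain d where d: "d > 0"
    "\<And>x y :: complex ^ 'n. x \<in> cball 0 R \<Longrightarrow> y \<in> cball 0 R \<Longrightarrow> dist y x < d \<Longrightarrow> dist (hyp_potential y) (hyp_potential x) < \<epsilon>"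
    using \<epsilon>(1) unfolding uniformly_continuous_on_def by metis
  \<comment> \<open>A point within 2 \<rho> of x, with x within \<rho> of w, is within 3 \<rho> of
    w: there \<psi> differs from \<psi>(w) by less than \<epsilon>, and the point stays inside
    radius R.\<close>
  define \<rho> where "\<rho> = min (d / 4) ((R - R0) / 4)"
  have \<rho>: "\<rho> > 0" "3 * \<rho> < d" "R0 + 3 * \<rho> \<le> R" using d(1) R by (auto simp: \<rho>_def min_def field_simps)
  obtain W where W: "finite W" "W \<subseteq> cball (0 :: complex ^ 'n) R0" "cball 0 R0 \<subseteq> (\<Union>w\<in>W. ball w \<rho>)"
    "real (card W) * V (\<rho> / 2) \<le> V (R0 + \<rho>)"
    using separated_cover[of "cball (0 :: complex ^ 'n) R0" R0 \<rho>] \<rho> R0 unfolding V_def by auto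
  have "V (R0 + \<rho>) \<le> V 2"
    unfolding V_def
  proof (rule measure_mono_fmeasurable)
    show "ball 0 (R0 + \<rho>) \<subseteq> ball (0 :: complex ^ 'n) 2" by (rule subset_ball) (use \<rho> R in linarith)
    show "ball (0 :: complex ^ 'n) 2 \<in> fmeasurable lborel"
      using emeasure_lborel_ball_finite[of "0 :: complex ^ 'n" 2] by (intro fmeasurableI) auto
  qed simp
  then have W_card: "real (card W) * V (\<rho> / 2) \<le> V 2" using W(4) by simp
  have V_2\<rho>: "V (2 * \<rho>) = D * V (\<rho> / 2)"
  proof -
    have "(2 * \<rho>) ^ k = 4 ^ k * (\<rho> / 2) ^ k" for k
      using power_mult_distrib[of 4 "\<rho> / 2" k] by simp
    then show ?thesis
      using \<rho>(1) content_ball_conv_unit_ball[of "2 * \<rho>" "0 :: complex ^ 'n"] content_ball_conv_unit_ball[of "\<rho> / 2" "0 :: complex ^ 'n"]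
      unfolding V_def D_def by (simp only: mult.assoc)
  qed
  have low_ex: "\<exists>c L0. c > 0 \<and> L0 \<ge> 1 \<and> (\<forall>L E (M :: 'w measure) (a :: ('n \<Rightarrow> nat) \<Rightarrow> 'w \<Rightarrow> complex).
      L \<ge> L0 \<longrightarrow> E \<ge> 0 \<longrightarrow> prob_space M \<longrightarrow> iid_complex_gaussians M a \<longrightarrow>
      (\<exists>A\<in>sets M. measure M A \<le> exp (- c * L ^ (n + 1)) \<and>
        (\<forall>\<omega>\<in>space M - A. (\<forall>\<alpha>. cmod (a \<alpha> \<omega>) \<le> E * s ^ (mdeg \<alpha>)) \<longrightarrow>
          (\<exists>x. norm (x - w) \<le> \<rho> \<and> exp (- \<epsilon> * L) * (1 - (norm w)\<^sup>2) powr (- L) < (cmod (hyperbolic_GAF L a \<omega> x))\<^sup>2))))"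
    if w: "w \<in> W" for w
  proof -
    have "norm w \<le> R0" using w W(2) by auto
    then have w1: "norm w < 1" "norm w + \<rho> \<le> R" using R0 \<rho> by auto
    show ?thesis
      by (rule lower_event[OF w1(1) \<epsilon>(1) \<rho>(1) s(1) w1(2) s(2), where 'w = 'w]) (unfold n_def, blast)
  qed
  then obtain cw Lw where cw: "\<And>w. w \<in> W \<Longrightarrow> cw w > 0" and
    low: "\<And>w L E (M :: 'w measure) (a :: ('n \<Rightarrow> nat) \<Rightarrow> 'w \<Rightarrow> complex).
      w \<in> W \<Longrightarrow> L \<ge> Lw w \<Longrightarrow> E \<ge> 0 \<Longrightarrow> prob_space M \<Longrightarrow> iid_complex_gaussians M a \<Longrightarrow>
      (\<exists>A\<in>sets M. measure M A \<le> exp (- cw w * L ^ (n + 1)) \<and>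
        (\<forall>\<omega>\<in>space M - A. (\<forall>\<alpha>. cmod (a \<alpha> \<omega>) \<le> E * s ^ (mdeg \<alpha>)) \<longrightarrow>
          (\<exists>x. norm (x - w) \<le> \<rho> \<and> exp (- \<epsilon> * L) * (1 - (norm w)\<^sup>2) powr (- L) < (cmod (hyperbolic_GAF L a \<omega> x))\<^sup>2)))"
    by metis
  define c0 where "c0 = Min (insert 1 (cw ` W))"
  have c0: "c0 > 0" "c0 \<le> 1" "\<And>w. w \<in> W \<Longrightarrow> c0 \<le> cw w"
    using W(1) cw by (auto simp: c0_def)
  define L1 where "L1 = Max (insert 1 (Lw ` W))"
  have L1: "L1 \<ge> 1" "\<And>w. w \<in> W \<Longrightarrow> Lw w \<le> L1" using W(1) by (auto simp: L1_def)
  \<comment> \<open>The event of large coefficients has doubly exponentially small probability,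
    which beats any power of L in the exponent; the limit of x^(n+1) / exp x is used at x =
    \<epsilon> L.\<close>
  have "\<forall>\<^sub>F L in at_top. 2 * exp (1 - exp (\<epsilon> * L) / 2) * g \<le> exp (- (L ^ (n + 1)))"
  proof -
    have "((\<lambda>x :: real. x ^ (n + 1) / exp x) \<longlongrightarrow> 0) at_top" by (rule tendsto_power_div_exp_0)
    moreover have "filterlim (\<lambda>L. \<epsilon> * L) at_top at_top" using \<epsilon>(1) by real_asymp
    ultimately have "((\<lambda>L. (\<epsilon> * L) ^ (n + 1) / exp (\<epsilon> * L)) \<longlongrightarrow> 0) at_top" by (rule filterlim_compose)
    moreover have "\<epsilon> ^ (n + 1) / 4 > 0" using \<epsilon>(1) by simp
    ultimately have "\<forall>\<^sub>F L in at_top. (\<epsilon> * L) ^ (n + 1) / exp (\<epsilon> * L) < \<epsilon> ^ (n + 1) / 4" by (rule order_tendstoD(2))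
    moreover have "\<forall>\<^sub>F L in at_top. 1 + ln (2 * g) \<le> exp (\<epsilon> * L) / 4" using \<epsilon>(1) g by real_asymp
    ultimately show ?thesis
    proof eventually_elim
      case (elim L)
      have "(\<epsilon> * L) ^ (n + 1) < \<epsilon> ^ (n + 1) / 4 * exp (\<epsilon> * L)" using elim(1) by (simp only: divide_less_eq) simp
      then have "\<epsilon> ^ (n + 1) * L ^ (n + 1) < \<epsilon> ^ (n + 1) * (exp (\<epsilon> * L) / 4)" unfolding power_mult_distrib by simp
      then have "L ^ (n + 1) < exp (\<epsilon> * L) / 4" using \<epsilon>(1) by (simp only: mult_less_cancel_left_pos zero_less_power)
      then have "ln (2 * g) + (1 - exp (\<epsilon> * L) / 2) \<le> - (L ^ (n + 1))" using elim(2) by linarith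
      then have "exp (ln (2 * g) + (1 - exp (\<epsilon> * L) / 2)) \<le> exp (- (L ^ (n + 1)))" by (simp only: exp_le_cancel_iff)
      then show ?case using g by (simp add: exp_add mult_ac)
    qed
  qed
  moreover have "\<forall>\<^sub>F L in at_top. 2 * ln g \<le> \<epsilon> * L" using \<epsilon>(1) by real_asymp
  moreover have "\<forall>\<^sub>F L in at_top. 2 \<le> exp (\<epsilon> * L)" using \<epsilon>(1) by real_asymp
  moreover have "\<forall>\<^sub>F L in at_top. real (Suc (card W)) \<le> exp (c0 / 2 * L)" using c0(1) by real_asymp
  ultimately have "\<forall>\<^sub>F L in at_top. 2 * exp (1 - exp (\<epsilon> * L) / 2) * g \<le> exp (- (L ^ (n + 1))) \<and>
      2 * ln g \<le> \<epsilon> * L \<and> 2 \<le> exp (\<epsilon> * L) \<and> real (Suc (card W)) \<le> exp (c0 / 2 * L)"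
    by eventually_elim simp
  then obtain L2 where L2: "\<And>L. L \<ge> L2 \<Longrightarrow> 2 * exp (1 - exp (\<epsilon> * L) / 2) * g \<le> exp (- (L ^ (n + 1)))"
    "\<And>L. L \<ge> L2 \<Longrightarrow> 2 * ln g \<le> \<epsilon> * L" "\<And>L. L \<ge> L2 \<Longrightarrow> 2 \<le> exp (\<epsilon> * L)"
    "\<And>L. L \<ge> L2 \<Longrightarrow> real (Suc (card W)) \<le> exp (c0 / 2 * L)"
    by (auto simp: eventually_at_top_linorder)
  define L0 where "L0 = max L1 L2"
  \<comment> \<open>The lost half of c0 absorbs the number of events in the union bound.\<close>
  define c where "c = c0 / 2"
  have main: "\<exists>A\<in>sets M. measure M A \<le> exp (- c * L ^ (n + 1)) \<and>
        (\<forall>\<omega>\<in>space M - A. (\<integral>\<^sup>+z\<in>cball 0 R0. ennreal \<bar>log_deviation L a \<omega> z\<bar> \<partial>lborel)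
          \<le> ennreal (\<kappa> * L))"
    if L: "L \<ge> L0" and M: "prob_space M" and a: "iid_complex_gaussians M a"
    for L and M :: "'w measure" and a :: "('n \<Rightarrow> nat) \<Rightarrow> 'w \<Rightarrow> complex"
  proof -
    interpret prob_space M by fact
    have dist: "\<And>\<alpha>. distributed M lborel (a \<alpha>) std_gaussian_density"
      using a by (auto simp: iid_complex_gaussians_def)
    have LL: "L \<ge> L1" "L \<ge> L2" "L \<ge> 1" "L > 0" using L L1(1) by (auto simp: L0_def)
    define E where "E = exp (\<epsilon> * L / 2)"
    have E: "E \<ge> 0" "E\<^sup>2 = exp (\<epsilon> * L)" by (auto simp: E_def power2_eq_square simp flip: exp_add)
    define U where "U = {\<omega>\<in>space M. \<exists>\<alpha>. cmod (a \<alpha> \<omega>) > E * s ^ (mdeg \<alpha>)}"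
    have U: "U \<in> sets M" "measure M U \<le> 2 * exp (1 - E\<^sup>2 / 2) * g"
      unfolding U_def g_def n_def using E L2(3)[OF LL(2)] s(1) by (intro upper_event_prob[OF dist]; simp)+
    have "\<forall>w\<in>W. \<exists>A. A \<in> sets M \<and> measure M A \<le> exp (- cw w * L ^ (n + 1)) \<and>
        (\<forall>\<omega>\<in>space M - A. (\<forall>\<alpha>. cmod (a \<alpha> \<omega>) \<le> E * s ^ (mdeg \<alpha>)) \<longrightarrow>
          (\<exists>x. norm (x - w) \<le> \<rho> \<and> exp (- \<epsilon> * L) * (1 - (norm w)\<^sup>2) powr (- L) < (cmod (hyperbolic_GAF L a \<omega> x))\<^sup>2))"
    proof
      fix w assume w: "w \<in> W"
      have "L \<ge> Lw w" using LL(1) L1(2)[OF w] by simp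
      from low[OF w this E(1) M a]
      show "\<exists>A. A \<in> sets M \<and> measure M A \<le> exp (- cw w * L ^ (n + 1)) \<and>
        (\<forall>\<omega>\<in>space M - A. (\<forall>\<alpha>. cmod (a \<alpha> \<omega>) \<le> E * s ^ (mdeg \<alpha>)) \<longrightarrow>
          (\<exists>x. norm (x - w) \<le> \<rho> \<and> exp (- \<epsilon> * L) * (1 - (norm w)\<^sup>2) powr (- L) < (cmod (hyperbolic_GAF L a \<omega> x))\<^sup>2))"
        by blast
    qed
    then obtain Aw where Aw: "\<And>w. w \<in> W \<Longrightarrow> Aw w \<in> sets M" "\<And>w. w \<in> W \<Longrightarrow> measure M (Aw w) \<le> exp (- cw w * L ^ (n + 1))"
      "\<And>w \<omega>. w \<in> W \<Longrightarrow> \<omega> \<in> space M - Aw w \<Longrightarrow> (\<forall>\<alpha>. cmod (a \<alpha> \<omega>) \<le> E * s ^ (mdeg \<alpha>)) \<Longrightarrow>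
          (\<exists>x. norm (x - w) \<le> \<rho> \<and> exp (- \<epsilon> * L) * (1 - (norm w)\<^sup>2) powr (- L) < (cmod (hyperbolic_GAF L a \<omega> x))\<^sup>2)"
      unfolding bchoice_iff by blast
    define A where "A = U \<union> (\<Union>w\<in>W. Aw w)"
    have A_sets: "A \<in> sets M" unfolding A_def using U W(1) Aw(1) by auto
    have "measure M A \<le> exp (- c * L ^ (n + 1))"
    proof -
      have Ln: "L ^ (n + 1) \<ge> L" using power_increasing[of 1 "n + 1" L] LL by simp
      have "measure M A \<le> measure M U + measure M (\<Union>w\<in>W. Aw w)"
        unfolding A_def using U W(1) Aw(1) by (intro measure_Un_le) auto
      also have "measure M (\<Union>w\<in>W. Aw w) \<le> (\<Sum>w\<in>W. measure M (Aw w))"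
        using W(1) Aw(1) by (intro measure_UNION_le) auto
      also have "(\<Sum>w\<in>W. measure M (Aw w)) \<le> (\<Sum>w\<in>W. exp (- c0 * L ^ (n + 1)))"
      proof (rule sum_mono)
        fix w assume w: "w \<in> W"
        have "c0 * L ^ (n + 1) \<le> cw w * L ^ (n + 1)" using c0(3)[OF w] LL by (intro mult_right_mono) auto
        then show "measure M (Aw w) \<le> exp (- c0 * L ^ (n + 1))" using Aw(2)[OF w] by (simp add: order_trans)
      qed
      also have "measure M U \<le> exp (- c0 * L ^ (n + 1))"
      proof -
        have "c0 * L ^ (n + 1) \<le> 1 * L ^ (n + 1)" using c0(2) LL by (intro mult_right_mono) auto
        then have "exp (- (L ^ (n + 1))) \<le> exp (- c0 * L ^ (n + 1))" by simp
        then show ?thesis using U(2) L2(1)[OF LL(2)] unfolding E(2) by linarith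
      qed
      finally have "measure M A \<le> real (Suc (card W)) * exp (- c0 * L ^ (n + 1))" by (simp add: algebra_simps)
      also have "\<dots> \<le> exp (c0 / 2 * L ^ (n + 1)) * exp (- c0 * L ^ (n + 1))"
      proof (rule mult_right_mono)
        have "c0 / 2 * L \<le> c0 / 2 * L ^ (n + 1)" using Ln c0(1) by (intro mult_left_mono) auto
        then show "real (Suc (card W)) \<le> exp (c0 / 2 * L ^ (n + 1))"
          using L2(4)[OF LL(2)] by (meson exp_le_cancel_iff order_trans)
      qed simp
      also have "\<dots> = exp (- c * L ^ (n + 1))" by (simp add: c_def flip: exp_add)
      finally show ?thesis .
    qed
    moreover have "(\<integral>\<^sup>+z\<in>cball 0 R0. ennreal \<bar>log_deviation L a \<omega> z\<bar> \<partial>lborel)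
          \<le> ennreal (\<kappa> * L)" if \<omega>: "\<omega> \<in> space M - A" for \<omega>
    proof -
      define f where "f = hyperbolic_series L (\<lambda>\<alpha>. a \<alpha> \<omega>)"
      have f_eq: "hyperbolic_GAF L a \<omega> = f" by (simp add: f_def hyperbolic_GAF_def fun_eq_iff)
      have up: "cmod (a \<alpha> \<omega>) \<le> E * s ^ (mdeg \<alpha>)" for \<alpha>
        using \<omega> by (auto simp: A_def U_def not_less)
      \<comment> \<open>One \<epsilon> each for E^2, for the dilation, and for the squared geometric
        constant.\<close>
      have f_le: "(cmod (f z))\<^sup>2 \<le> exp (3 * \<epsilon> * L + L * hyp_potential z)" if z: "norm z \<le> R" for z
      proof -
        have z1: "s ^ 4 * (norm z)\<^sup>2 < 1"
          by (rule norm_coeff_hterm_le(3)[OF LL(4) s(1,2) z E(1), where c = "\<lambda>\<alpha>. a \<alpha> \<omega>", OF up])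
        have "(cmod (f z))\<^sup>2 \<le> (E * (1 - s ^ 4 * (norm z)\<^sup>2) powr (- L / 2) * g)\<^sup>2"
          unfolding f_def g_def n_def
          by (intro power_mono hyperbolic_series_bound(2)[OF LL(4) s(1,2) z E(1) up]) simp
        also have "\<dots> = E\<^sup>2 * ((1 - s ^ 4 * (norm z)\<^sup>2) powr (- L / 2))\<^sup>2 * g\<^sup>2" by (simp add: power_mult_distrib)
        also have "((1 - s ^ 4 * (norm z)\<^sup>2) powr (- L / 2))\<^sup>2 = exp (L * (- ln (1 - s ^ 4 * (norm z)\<^sup>2)))"
          using z1 by (simp add: powr_def power2_eq_square flip: exp_add)
        also have "g\<^sup>2 = exp (2 * ln g)" using g by (simp add: exp_double)
        also have "E\<^sup>2 * exp (L * (- ln (1 - s ^ 4 * (norm z)\<^sup>2))) * exp (2 * ln g)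
            = exp (\<epsilon> * L + L * (- ln (1 - s ^ 4 * (norm z)\<^sup>2)) + 2 * ln g)"
          unfolding E(2) by (simp only: exp_add)
        also have "\<dots> \<le> exp (3 * \<epsilon> * L + L * hyp_potential z)"
        proof -
          have "- ln (1 - s ^ 4 * (norm z)\<^sup>2) \<le> hyp_potential z + \<epsilon>"
            using hyp_potential_dilation[OF _ s(2) z] s(1,3) by (simp add: one_le_power)
          then have "L * (- ln (1 - s ^ 4 * (norm z)\<^sup>2)) \<le> L * (hyp_potential z + \<epsilon>)"
            using LL by (intro mult_left_mono) auto
          then have "\<epsilon> * L + L * (- ln (1 - s ^ 4 * (norm z)\<^sup>2)) + 2 * ln g \<le> 3 * \<epsilon> * L + L * hyp_potential z"
            using L2(2)[OF LL(2)] by (simp add: algebra_simps)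
          then show ?thesis by simp
        qed
        finally show ?thesis .
      qed
      define h where "h z = ennreal \<bar>ln ((cmod (f z))\<^sup>2) - L * hyp_potential z\<bar>" for z
      have [measurable]: "h \<in> borel_measurable borel" unfolding h_def f_def by measurable
      have "\<forall>w\<in>W. \<exists>x. norm (x - w) \<le> \<rho> \<and> (\<integral>\<^sup>+z\<in>ball x (2 * \<rho>). h z \<partial>lborel) \<le> ennreal (8 * \<epsilon> * L * V (2 * \<rho>))"
      proof
        fix w assume w: "w \<in> W"
        have wR: "norm w \<le> R0" using w W(2) by auto
        have "\<omega> \<in> space M - Aw w" using \<omega> w by (auto simp: A_def)
        from Aw(3)[OF w this] up
        obtain x where x: "norm (x - w) \<le> \<rho>" "exp (- \<epsilon> * L) * (1 - (norm w)\<^sup>2) powr (- L) < (cmod (f x))\<^sup>2"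
          unfolding f_eq by blast
        have nx: "norm x \<le> R0 + \<rho>" using x(1) wR norm_triangle_ineq[of w "x - w"] by simp
        have w1: "(norm w)\<^sup>2 < 1" using wR R0 power_strict_mono[of "norm w" 1 2] by simp
        have "(\<integral>\<^sup>+z\<in>ball x (2 * \<rho>). ennreal \<bar>ln ((cmod (f z))\<^sup>2) - L * hyp_potential z\<bar> \<partial>lborel)
            \<le> ennreal ((2 * (3 * \<epsilon> * L) + 2 * \<epsilon> * L) * measure lborel (ball x (2 * \<rho>)))"
          unfolding f_def
        proof (rule local_L1_bound[OF LL(4) s(1,2) _ _ E(1) up])
          show "norm x + 2 * \<rho> \<le> R" using nx \<rho> by simp
          show "0 < 2 * \<rho>" using \<rho> by simp
          show "0 \<le> 3 * \<epsilon> * L" using \<epsilon> LL by simp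
          show "(cmod (hyperbolic_series L (\<lambda>\<alpha>. a \<alpha> \<omega>) z))\<^sup>2 \<le> exp (3 * \<epsilon> * L + L * hyp_potential z)" if "norm z \<le> R" for z
            using f_le[OF that] by (simp add: f_def)
          \<comment> \<open>The local bound is applied with b = \<psi>(w) + \<epsilon> and H = 2
            \<epsilon> L: one \<epsilon> compensates b, the other is the loss in the lower bound at
            x.\<close>
          show "hyp_potential z \<le> hyp_potential w + \<epsilon>" if "z \<in> ball x (2 * \<rho>)" for z
          proof -
            have "dist z w \<le> dist x z + dist x w" using dist_triangle[of z w x] by (simp add: dist_commute)
            then have dz: "dist z w < 3 * \<rho>" using that x(1) by (simp add: dist_norm)
            have "norm z \<le> norm w + dist z w" using norm_triangle_ineq[of w "z - w"] by (simp add: dist_norm)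
            then have "norm z \<le> R" using dz wR \<rho> by simp
            then have "dist (hyp_potential z) (hyp_potential w) < \<epsilon>"
              using dz \<rho> wR R by (intro d(2)) auto
            then show ?thesis by (simp add: dist_real_def abs_less_iff)
          qed
          have "(1 - (norm w)\<^sup>2) powr (- L) = exp (L * hyp_potential w)"
            using w1 by (simp add: powr_def hyp_potential_def)
          then have "exp (- \<epsilon> * L) * (1 - (norm w)\<^sup>2) powr (- L) = exp (L * (hyp_potential w + \<epsilon>) - 2 * \<epsilon> * L)"
            by (simp add: algebra_simps flip: exp_add)
          then show "exp (L * (hyp_potential w + \<epsilon>) - 2 * \<epsilon> * L) < (cmod (hyperbolic_series L (\<lambda>\<alpha>. a \<alpha> \<omega>) x))\<^sup>2"
            using x(2) by (simp add: f_def)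
        qed
        also have "(2 * (3 * \<epsilon> * L) + 2 * \<epsilon> * L) * measure lborel (ball x (2 * \<rho>)) = 8 * \<epsilon> * L * V (2 * \<rho>)"
          using V_eq[of "2 * \<rho>" x] \<rho> by simp
        finally show "\<exists>x. norm (x - w) \<le> \<rho> \<and> (\<integral>\<^sup>+z\<in>ball x (2 * \<rho>). h z \<partial>lborel) \<le> ennreal (8 * \<epsilon> * L * V (2 * \<rho>))"
          using x(1) unfolding h_def by blast
      qed
      \<comment> \<open>The centres \<open>X w\<close> depend on the outcome but stay within \<rho>
        of w; doubling the radius makes their balls cover all the same.\<close>
      then obtain X where X: "\<And>w. w \<in> W \<Longrightarrow> norm (X w - w) \<le> \<rho>"
        "\<And>w. w \<in> W \<Longrightarrow> (\<integral>\<^sup>+z\<in>ball (X w) (2 * \<rho>). h z \<partial>lborel) \<le> ennreal (8 * \<epsilon> * L * V (2 * \<rho>))"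
        unfolding bchoice_iff by blast
      have [measurable]: "ball x t \<in> sets borel" for x :: "complex ^ 'n" and t by simp
      have "(\<integral>\<^sup>+z\<in>cball 0 R0. h z \<partial>lborel) \<le> (\<integral>\<^sup>+z. (\<Sum>w\<in>W. h z * indicator (ball (X w) (2 * \<rho>)) z) \<partial>lborel)"
      proof (rule nn_integral_mono)
        fix z
        show "h z * indicator (cball 0 R0) z \<le> (\<Sum>w\<in>W. h z * indicator (ball (X w) (2 * \<rho>)) z)"
        proof (cases "z \<in> cball 0 R0")
          case True
          then obtain w where w: "w \<in> W" "dist w z < \<rho>" using W(3) by auto
          have "dist (X w) z \<le> dist (X w) w + dist w z" by (rule dist_triangle)
          then have "z \<in> ball (X w) (2 * \<rho>)" using X(1)[OF w(1)] w(2) by (simp add: dist_norm)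
          then have "h z * indicator (cball 0 R0) z = h z * indicator (ball (X w) (2 * \<rho>)) z" using True by simp
          also have "\<dots> \<le> (\<Sum>w\<in>W. h z * indicator (ball (X w) (2 * \<rho>)) z)"
            using W(1) w(1) by (intro member_le_sum) auto
          finally show ?thesis .
        qed simp
      qed
      also have "\<dots> = (\<Sum>w\<in>W. \<integral>\<^sup>+z\<in>ball (X w) (2 * \<rho>). h z \<partial>lborel)"
        by (rule nn_integral_sum) measurable
      also have "\<dots> \<le> (\<Sum>w\<in>W. ennreal (8 * \<epsilon> * L * V (2 * \<rho>)))" by (rule sum_mono) (rule X(2))
      also have "\<dots> = ennreal (real (card W) * (8 * \<epsilon> * L * V (2 * \<rho>)))"
        using \<epsilon> LL by (simp add: ennreal_mult' ennreal_of_nat_eq_real_of_nat)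
      also have "real (card W) * (8 * \<epsilon> * L * V (2 * \<rho>)) = (8 * \<epsilon> * L * D) * (real (card W) * V (\<rho> / 2))"
        by (simp add: V_2\<rho>)
      also have "ennreal \<dots> \<le> ennreal ((8 * \<epsilon> * L * D) * V 2)"
        using W_card \<epsilon> LL D by (intro ennreal_leI mult_left_mono) auto
      also have "(8 * \<epsilon> * L * D) * V 2 = \<kappa> * L" using \<epsilon>(2) by (simp add: mult_ac)
      finally show ?thesis by (simp add: h_def f_eq)
    qed
    ultimately show ?thesis using A_sets by blast
  qed
  show ?thesis
  proof (rule that[of c L0])
    show "c > 0" using c0 by (simp add: c_def)
    show "L0 \<ge> 1" using L1 by (simp add: L0_def)
  qed (use main in \<open>simp add: n_def\<close>)
qed

section \<open>Moments\<close>

lemma hyperbolic_GAF_measurable_pair: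
  fixes a :: "('n::finite \<Rightarrow> nat) \<Rightarrow> 'w \<Rightarrow> complex"
  assumes [measurable]: "\<And>\<alpha>. a \<alpha> \<in> borel_measurable M"
  shows "(\<lambda>(\<omega>, z). hyperbolic_GAF L a \<omega> z) \<in> borel_measurable (M \<Otimes>\<^sub>M (borel :: (complex ^ 'n) measure))"
proof -
  have h: "(\<lambda>z. hterm L z \<alpha>) \<in> borel_measurable (borel :: (complex ^ 'n) measure)" for \<alpha>
    unfolding hterm_def by (intro borel_measurable_continuous_onI continuous_intros)
  have "(\<lambda>p. a \<alpha> (fst p) * hterm L (snd p) \<alpha>) \<in> borel_measurable (M \<Otimes>\<^sub>M (borel :: (complex ^ 'n) measure))" for \<alpha>
    by (intro borel_measurable_times measurable_compose[OF measurable_fst assms] measurable_compose[OF measurable_snd h])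
  then show ?thesis
    unfolding hyperbolic_GAF_def hyperbolic_series_eq split_beta by (intro borel_measurable_infsum)
qed

text \<open>For y \<ge> 1, ln (y^2) = 4 ln (sqrt y) \<le> 4 sqrt y, hence the 16; for x < 1 pass to
  1 / x, and at x = 0 both sides are 0 by convention. This reduces the second moment of ln |f|^2 to
  the means of |f| and 1 / |f|.\<close>

lemma ln_sq_le:
  fixes x :: real
  assumes "x \<ge> 0"
  shows "(ln (x\<^sup>2))\<^sup>2 \<le> 16 * (x + 1 / x)"
proof -
  have ge1: "(ln (y\<^sup>2))\<^sup>2 \<le> 16 * y" if "y \<ge> 1" for y :: real
  proof -
    have "ln (sqrt y) \<le> sqrt y" using that ln_le_minus_one[of "sqrt y"] by simp
    moreover have "ln (y\<^sup>2) = 4 * ln (sqrt y)" using that by (simp add: ln_sqrt ln_realpow)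
    moreover have "0 \<le> ln (y\<^sup>2)" using that by (simp add: one_le_power)
    ultimately have "(ln (y\<^sup>2))\<^sup>2 \<le> (4 * sqrt y)\<^sup>2" by (intro power_mono) auto
    then show ?thesis using that by (simp add: power_mult_distrib)
  qed
  consider "x = 0" | "0 < x" "x < 1" | "x \<ge> 1" using assms by linarith
  then show ?thesis
  proof cases
    case 2
    have "(ln ((1 / x)\<^sup>2))\<^sup>2 = (ln (x\<^sup>2))\<^sup>2" using 2 by (simp add: power_divide ln_div)
    then show ?thesis using ge1[of "1 / x"] 2 by simp
  next
    case 3
    then show ?thesis using ge1[of x] by (simp add: add_increasing2)
  qed simp
qed

text \<open>Triangle inequality and Tonelli, term by term. In the mean the coefficients do not grow
  with the degree, so a dilation by s suffices here.\<close>

lemma (in prob_space) nn_integral_norm_GAF: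
  fixes a :: "('n::finite \<Rightarrow> nat) \<Rightarrow> 'a \<Rightarrow> complex" and z :: "complex ^ 'n"
  assumes dist: "\<And>\<alpha>. distributed M lborel (a \<alpha>) std_gaussian_density"
    and "L > 0" "s > 1" "s\<^sup>2 * R\<^sup>2 < 1" "norm z \<le> R"
  shows "(\<integral>\<^sup>+\<omega>. ennreal (cmod (hyperbolic_GAF L a \<omega> z)) \<partial>M) \<le> ennreal (2 * ((1 - s\<^sup>2 * R\<^sup>2) powr (- L / 2) * geom_const s CARD('n)))"
proof -
  have [measurable]: "a \<alpha> \<in> borel_measurable M" for \<alpha> using distributed_measurable[OF dist, of \<alpha>] by simp
  define K where "K = (1 - s\<^sup>2 * R\<^sup>2) powr (- L / 2)"
  have zR: "s\<^sup>2 * (norm z)\<^sup>2 \<le> s\<^sup>2 * R\<^sup>2" using assms by (intro mult_left_mono power_mono) auto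
  then have z1: "s\<^sup>2 * (norm z)\<^sup>2 < 1" using assms(4) by linarith
  have h_le: "cmod (hterm L z \<alpha>) \<le> K * (1 / s) ^ (mdeg \<alpha>)" for \<alpha>
  proof -
    have "cmod (hterm L z \<alpha>) * s ^ (mdeg \<alpha>) \<le> (1 - s\<^sup>2 * (norm z)\<^sup>2) powr (- L / 2)"
      using assms(2,3) z1 by (intro norm_hterm_le) auto
    also have "\<dots> \<le> K" unfolding K_def using assms zR by (intro powr_mono2') auto
    finally show ?thesis using assms by (simp add: power_divide field_simps)
  qed
  have "(\<integral>\<^sup>+\<omega>. ennreal (cmod (hyperbolic_GAF L a \<omega> z)) \<partial>M)
      \<le> (\<integral>\<^sup>+\<omega>. \<integral>\<^sup>+\<alpha>. ennreal (cmod (a \<alpha> \<omega> * hterm L z \<alpha>)) \<partial>count_space UNIV \<partial>M)"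
    unfolding hyperbolic_GAF_def hyperbolic_series_eq by (rule nn_integral_mono) (rule ennreal_norm_infsum_le)
  also have "\<dots> = (\<integral>\<^sup>+\<alpha>. \<integral>\<^sup>+\<omega>. ennreal (cmod (a \<alpha> \<omega> * hterm L z \<alpha>)) \<partial>M \<partial>count_space UNIV)"
    by (rule nn_integral_count_space_nn_integral) auto
  also have "\<dots> \<le> (\<integral>\<^sup>+\<alpha>. ennreal (2 * K * (1 / s) ^ (mdeg \<alpha>)) \<partial>count_space (UNIV :: ('n \<Rightarrow> nat) set))"
  proof (rule nn_integral_mono)
    fix \<alpha> :: "'n \<Rightarrow> nat"
    have "(\<integral>\<^sup>+\<omega>. ennreal (cmod (a \<alpha> \<omega> * hterm L z \<alpha>)) \<partial>M) = (\<integral>\<^sup>+\<omega>. ennreal (cmod (a \<alpha> \<omega>)) \<partial>M) * ennreal (cmod (hterm L z \<alpha>))"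
      unfolding norm_mult by (simp add: ennreal_mult nn_integral_multc)
    also have "\<dots> \<le> 2 * ennreal (K * (1 / s) ^ (mdeg \<alpha>))"
      by (intro mult_mono nn_integral_norm_gaussian[OF dist] ennreal_leI h_le) auto
    also have "\<dots> = ennreal (2 * K * (1 / s) ^ (mdeg \<alpha>))"
      using assms by (simp add: ennreal_mult' K_def mult.assoc)
    finally show "(\<integral>\<^sup>+\<omega>. ennreal (cmod (a \<alpha> \<omega> * hterm L z \<alpha>)) \<partial>M) \<le> ennreal (2 * K * (1 / s) ^ (mdeg \<alpha>))" .
  qed
  also have "\<dots> \<le> ennreal (2 * K * geom_const s CARD('n))"
    using assms by (intro nn_integral_count_space_le has_sum_cmult_right has_sum_geom_const) (auto simp: K_def)
  finally show ?thesis by (simp add: K_def mult.assoc)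
qed

text \<open>The constant term of the series is a standard Gaussian independent of all the others, so
  the small-ball bound holds at every z with the same constant. Where the series diverges, f is 0
  and 1 / 0 = 0.\<close>

lemma (in prob_space) nn_integral_inverse_norm_GAF:
  fixes a :: "('n::finite \<Rightarrow> nat) \<Rightarrow> 'a \<Rightarrow> complex" and z :: "complex ^ 'n"
  assumes dist: "\<And>\<alpha>. distributed M lborel (a \<alpha>) std_gaussian_density"
    and ind: "indep_vars (\<lambda>_. borel) a UNIV" and L: "L > 0"
  shows "(\<integral>\<^sup>+\<omega>. ennreal (1 / cmod (hyperbolic_GAF L a \<omega> z)) \<partial>M) \<le> 5"
proof -
  have [measurable]: "a \<alpha> \<in> borel_measurable M" for \<alpha> using distributed_measurable[OF dist, of \<alpha>] by simp
  define o0 :: "'n \<Rightarrow> nat" where "o0 = (\<lambda>_. 0)"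
  have h0: "hterm L z o0 = 1"
    using Gamma_real_pos[OF L] by (simp add: hterm_def hcoef_def o0_def)
  define q where "q y = infsum (\<lambda>\<alpha>. y \<alpha> * hterm L z \<alpha>) (- {o0})" for y :: "('n \<Rightarrow> nat) \<Rightarrow> complex"
  define Y where "Y \<omega> = a o0 \<omega> + infsum (\<lambda>\<alpha>. a \<alpha> \<omega> * hterm L z \<alpha>) (- {o0})" for \<omega>
  have q_meas: "q \<in> borel_measurable (PiM (- {o0}) (\<lambda>_. borel))"
    unfolding q_def
  proof (rule borel_measurable_infsum)
    fix \<alpha> assume \<alpha>: "\<alpha> \<in> - {o0}"
    show "(\<lambda>y. y \<alpha> * hterm L z \<alpha>) \<in> borel_measurable (PiM (- {o0}) (\<lambda>_. borel))"
      using measurable_component_singleton[OF \<alpha>, of "\<lambda>_. borel :: complex measure"]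
      by (intro borel_measurable_times) auto
  qed
  have Y_meas: "Y \<in> borel_measurable M"
    unfolding Y_def by (intro borel_measurable_add borel_measurable_infsum borel_measurable_times) auto
  have Y_q: "Y \<omega> = a o0 \<omega> + q (\<lambda>i\<in>-{o0}. a i \<omega>)" for \<omega>
    unfolding Y_def q_def by (intro arg_cong2[where f = "(+)"] infsum_cong) auto
  have small: "emeasure M {\<omega>\<in>space M. cmod (Y \<omega>) \<le> t} \<le> ennreal (t\<^sup>2)" if "t > 0" for t
    using independent_gaussians_small_ball[OF dist ind, of "{o0}" "\<lambda>_. q" "\<lambda>_. 1" "\<lambda>_. t"] q_meas that
    by (simp add: Y_q)
  have "1 / cmod (hyperbolic_GAF L a \<omega> z) \<le> 1 / cmod (Y \<omega>)" for \<omega>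
  proof (cases "(\<lambda>\<alpha>. a \<alpha> \<omega> * hterm L z \<alpha>) summable_on UNIV")
    case True
    then have s: "(\<lambda>\<alpha>. a \<alpha> \<omega> * hterm L z \<alpha>) summable_on B" for B
      using summable_on_subset_banach by blast
    have "hyperbolic_GAF L a \<omega> z = infsum (\<lambda>\<alpha>. a \<alpha> \<omega> * hterm L z \<alpha>) ({o0} \<union> - {o0})"
      by (simp add: hyperbolic_GAF_def hyperbolic_series_eq)
    also have "\<dots> = infsum (\<lambda>\<alpha>. a \<alpha> \<omega> * hterm L z \<alpha>) {o0} + infsum (\<lambda>\<alpha>. a \<alpha> \<omega> * hterm L z \<alpha>) (- {o0})"
      by (rule infsum_Un_disjoint) (use s in auto)
    also have "\<dots> = Y \<omega>" by (simp add: Y_def h0)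
    finally show ?thesis by simp
  next
    case False
    then show ?thesis by (simp add: hyperbolic_GAF_def hyperbolic_series_eq infsum_not_exists)
  qed
  then have "(\<integral>\<^sup>+\<omega>. ennreal (1 / cmod (hyperbolic_GAF L a \<omega> z)) \<partial>M) \<le> (\<integral>\<^sup>+\<omega>. ennreal (1 / cmod (Y \<omega>)) \<partial>M)"
    by (intro nn_integral_mono ennreal_leI)
  also have "\<dots> \<le> 5" by (rule nn_integral_inverse_norm_le[OF prob_space_axioms Y_meas small])
  finally show ?thesis .
qed

(* Second moment of ln |f|^2 - L psi: crude, but only exponential in L, which is beaten by the probability exp(-c L^(n+1)) of the exceptional set. *)
lemma second_moment_bound:
  fixes R :: real
  assumes R: "0 < R" "R < 1"
  obtains C where "C > 0"
    "\<And>L (M :: 'w measure) (a :: ('n::finite \<Rightarrow> nat) \<Rightarrow> 'w \<Rightarrow> complex) z.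
      L \<ge> 1 \<Longrightarrow> prob_space M \<Longrightarrow> iid_complex_gaussians M a \<Longrightarrow> norm z \<le> R \<Longrightarrow>
      (\<integral>\<^sup>+\<omega>. ennreal ((log_deviation L a \<omega> z)\<^sup>2) \<partial>M) \<le> ennreal (exp (C * L))"
proof -
  obtain s where s: "s > 1" "s ^ 4 * R\<^sup>2 < 1" using exists_dilation[OF R, of 1] by auto
  have s2: "s\<^sup>2 * R\<^sup>2 < 1"
  proof -
    have "s\<^sup>2 * R\<^sup>2 \<le> s ^ 4 * R\<^sup>2" using s by (intro mult_right_mono power_increasing) auto
    then show ?thesis using s by simp
  qed
  define g where "g = geom_const s CARD('n)"
  have g: "g > 0" using s by (simp add: g_def geom_const_pos)
  define B where "B = - ln (1 - s\<^sup>2 * R\<^sup>2)"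
  define P where "P = - ln (1 - R\<^sup>2)"
  have R2: "R\<^sup>2 < 1" "0 < R\<^sup>2" using R power_strict_mono[of R 1 2] by auto
  have P: "P \<ge> 0" using R2 by (simp add: P_def)
  have B: "B \<ge> 0" using s2 by (simp add: B_def)
  \<comment> \<open>B / 2 is the rate in the bound for the mean of |f|; the logarithm collects 64 =
    32 * 2 and 160 = 32 * 5 with 1 to spare; 2 P comes from (L P)^2 \<le> exp (2 P L), and the last
    2 pays for a factor 2.\<close>
  define C where "C = B / 2 + ln (64 * g + 161) + 2 * P + 2"
  have C: "C > 0"
  proof -
    have "ln (64 * g + 161) \<ge> 0" using g by simp
    then show ?thesis using B P by (simp add: C_def)
  qed
  have main: "(\<integral>\<^sup>+\<omega>. ennreal ((log_deviation L a \<omega> z)\<^sup>2) \<partial>M) \<le> ennreal (exp (C * L))"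
    if L: "L \<ge> 1" and M: "prob_space M" and a: "iid_complex_gaussians M a" and z: "norm z \<le> R"
    for L and M :: "'w measure" and a :: "('n \<Rightarrow> nat) \<Rightarrow> 'w \<Rightarrow> complex" and z
  proof -
    interpret prob_space M by fact
    have dist: "\<And>\<alpha>. distributed M lborel (a \<alpha>) std_gaussian_density" and ind: "indep_vars (\<lambda>_. borel) a UNIV"
      using a by (auto simp: iid_complex_gaussians_def)
    have [measurable]: "a \<alpha> \<in> borel_measurable M" for \<alpha> using distributed_measurable[OF dist, of \<alpha>] by simp
    define F where "F \<omega> = hyperbolic_GAF L a \<omega> z" for \<omega>
    have [measurable]: "F \<in> borel_measurable M"
      unfolding F_def hyperbolic_GAF_def hyperbolic_series_eq by (intro borel_measurable_infsum borel_measurable_times) auto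
    have psi: "0 \<le> hyp_potential z" "hyp_potential z \<le> P"
    proof -
      show "0 \<le> hyp_potential z" using z R by (intro hyp_potential_nonneg) simp
      have "(norm z)\<^sup>2 \<le> R\<^sup>2" using z by (intro power_mono) auto
      then show "hyp_potential z \<le> P" using R2 by (simp add: hyp_potential_def P_def)
    qed
    have LP: "(L * hyp_potential z)\<^sup>2 \<le> (L * P)\<^sup>2" using psi L by (intro power_mono mult_left_mono) auto
    have "(\<integral>\<^sup>+\<omega>. ennreal ((ln ((cmod (F \<omega>))\<^sup>2) - L * hyp_potential z)\<^sup>2) \<partial>M)
        \<le> (\<integral>\<^sup>+\<omega>. ennreal 32 * ennreal (cmod (F \<omega>)) + ennreal 32 * ennreal (1 / cmod (F \<omega>)) + ennreal (2 * (L * P)\<^sup>2) \<partial>M)"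
    proof (rule nn_integral_mono)
      fix \<omega>
      define l where "l = ln ((cmod (F \<omega>))\<^sup>2)"
      have "0 \<le> (l + L * hyp_potential z)\<^sup>2" by simp
      then have "(l - L * hyp_potential z)\<^sup>2 \<le> 2 * l\<^sup>2 + 2 * (L * hyp_potential z)\<^sup>2"
        by (simp add: power2_eq_square algebra_simps)
      also have "\<dots> \<le> 2 * (16 * (cmod (F \<omega>) + 1 / cmod (F \<omega>))) + 2 * (L * P)\<^sup>2"
        using ln_sq_le[of "cmod (F \<omega>)"] LP by (simp add: l_def)
      also have "\<dots> = 32 * cmod (F \<omega>) + 32 * (1 / cmod (F \<omega>)) + 2 * (L * P)\<^sup>2" by simp
      finally have "ennreal ((l - L * hyp_potential z)\<^sup>2) \<le> ennreal (32 * cmod (F \<omega>) + 32 * (1 / cmod (F \<omega>)) + 2 * (L * P)\<^sup>2)"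
        by (rule ennreal_leI)
      also have "\<dots> = ennreal 32 * ennreal (cmod (F \<omega>)) + ennreal 32 * ennreal (1 / cmod (F \<omega>)) + ennreal (2 * (L * P)\<^sup>2)"
        by (subst ennreal_plus, simp, simp, subst ennreal_plus, simp, simp, subst (1 2) ennreal_mult) auto
      finally show "ennreal ((ln ((cmod (F \<omega>))\<^sup>2) - L * hyp_potential z)\<^sup>2)
          \<le> ennreal 32 * ennreal (cmod (F \<omega>)) + ennreal 32 * ennreal (1 / cmod (F \<omega>)) + ennreal (2 * (L * P)\<^sup>2)"
        by (simp add: l_def)
    qed
    also have "\<dots> = ennreal 32 * (\<integral>\<^sup>+\<omega>. ennreal (cmod (F \<omega>)) \<partial>M) + ennreal 32 * (\<integral>\<^sup>+\<omega>. ennreal (1 / cmod (F \<omega>)) \<partial>M) + ennreal (2 * (L * P)\<^sup>2)"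
      by (simp add: nn_integral_add nn_integral_cmult emeasure_space_1)
    also have "\<dots> \<le> ennreal 32 * ennreal (2 * ((1 - s\<^sup>2 * R\<^sup>2) powr (- L / 2) * g)) + ennreal 32 * ennreal 5 + ennreal (2 * (L * P)\<^sup>2)"
      unfolding F_def g_def using L
      by (intro add_mono mult_left_mono nn_integral_norm_GAF[OF dist _ s(1) s2 z] order_trans[OF nn_integral_inverse_norm_GAF[OF dist ind]]) auto
    also have "\<dots> = ennreal (64 * ((1 - s\<^sup>2 * R\<^sup>2) powr (- L / 2) * g) + 160 + 2 * (L * P)\<^sup>2)"
    proof -
      define A where "A = (1 - s\<^sup>2 * R\<^sup>2) powr (- L / 2) * g"
      have A: "A \<ge> 0" using g by (simp add: A_def)
      have "ennreal 32 * ennreal (2 * A) = ennreal (32 * (2 * A))" "ennreal 32 * ennreal 5 = ennreal (32 * 5)"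
        using A by (intro ennreal_mult[symmetric]; simp)+
      moreover have "ennreal (32 * (2 * A)) + ennreal (32 * 5) + ennreal (2 * (L * P)\<^sup>2) = ennreal (32 * (2 * A) + 32 * 5 + 2 * (L * P)\<^sup>2)"
      proof -
        have "ennreal x + ennreal y + ennreal z = ennreal (x + y + z)" if "x \<ge> 0" "y \<ge> 0" "z \<ge> 0" for x y z
          using that by simp
        then show ?thesis using A by (meson mult_nonneg_nonneg zero_le_numeral zero_le_power2)
      qed
      ultimately show ?thesis by (simp only: A_def[symmetric]) simp
    qed
    also have "\<dots> \<le> ennreal (exp (C * L))"
    proof (rule ennreal_leI)
      have e1: "(1 - s\<^sup>2 * R\<^sup>2) powr (- L / 2) = exp (B / 2 * L)" using s2 by (simp add: powr_def B_def)
      define X where "X = exp (B / 2 * L)"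
      have X: "X \<ge> 1" using B L by (simp add: X_def)
      define Z where "Z = exp (2 * P * L)"
      have "P * L \<le> exp (P * L)" using exp_ge_add_one_self[of "P * L"] by linarith
      then have "(P * L)\<^sup>2 \<le> (exp (P * L))\<^sup>2" using P L by (intro power_mono) auto
      then have Z1: "(L * P)\<^sup>2 \<le> Z" unfolding Z_def by (simp add: mult_ac flip: exp_double)
      have Z: "Z \<ge> 1" using P L by (simp add: Z_def)
      define Q where "Q = exp (2 * L)"
      have Q: "Q \<ge> 2" using exp_ge_add_one_self[of "2 * L"] L unfolding Q_def by linarith
      have G1: "64 * g + 161 \<le> exp (ln (64 * g + 161) * L)"
      proof -
        have "exp (ln (64 * g + 161) * 1) \<le> exp (ln (64 * g + 161) * L)" using g L by (subst exp_le_cancel_iff, intro mult_left_mono) auto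
        then show ?thesis using g by simp
      qed
      have "64 * (X * g) + 160 + 2 * (L * P)\<^sup>2 \<le> 64 * (X * g) * Z + 160 * (X * Z) + 2 * Z"
      proof -
        have "64 * (X * g) * 1 \<le> 64 * (X * g) * Z" using X g Z by (intro mult_left_mono) auto
        moreover have "1 * 1 \<le> X * Z" using X Z by (intro mult_mono) auto
        ultimately show ?thesis using Z1 by linarith
      qed
      also have "\<dots> \<le> (64 * g + 161) * (X * Z) * Q"
      proof -
        have XZ: "Z \<le> X * Z" using X Z by simp
        have "(64 * g + 161) * (X * Z) * 2 \<le> (64 * g + 161) * (X * Z) * Q" using X Z g Q by (intro mult_left_mono) auto
        moreover have "64 * (X * g) * Z + 160 * (X * Z) + 2 * Z \<le> (64 * g + 161) * (X * Z) * 2"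
        proof -
          have "0 \<le> g * (X * Z)" "0 \<le> X * Z" using g X Z by auto
          moreover have "(64 * g + 161) * (X * Z) * 2 = 128 * (g * (X * Z)) + 322 * (X * Z)" "64 * (X * g) * Z = 64 * (g * (X * Z))"
            by (simp_all add: algebra_simps)
          ultimately show ?thesis using XZ by linarith
        qed
        ultimately show ?thesis by linarith
      qed
      also have "\<dots> \<le> exp (ln (64 * g + 161) * L) * (X * Z) * Q"
        using G1 X Z Q by (intro mult_right_mono) auto
      also have "\<dots> = exp (C * L)"
        by (simp add: X_def Z_def Q_def C_def algebra_simps flip: exp_add)
      finally show "64 * ((1 - s\<^sup>2 * R\<^sup>2) powr (- L / 2) * g) + 160 + 2 * (L * P)\<^sup>2 \<le> exp (C * L)"
        unfolding e1 X_def .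
    qed
    finally show ?thesis by (simp add: F_def)
  qed
  show ?thesis by (rule that[OF C]) (use main in blast)
qed

section \<open>The linear statistic\<close>

lemma log_deviation_measurable_pair:
  fixes a :: "('n::finite \<Rightarrow> nat) \<Rightarrow> 'w \<Rightarrow> complex"
  assumes am: "\<And>\<alpha>. a \<alpha> \<in> borel_measurable M"
  shows "(\<lambda>(\<omega>, z). log_deviation L a \<omega> z)
    \<in> borel_measurable (M \<Otimes>\<^sub>M (lborel :: (complex ^ 'n) measure))"
proof -
  have [measurable]: "(\<lambda>p. hyperbolic_GAF L a (fst p) (snd p)) \<in> borel_measurable (M \<Otimes>\<^sub>M (borel :: (complex ^ 'n) measure))"
    using hyperbolic_GAF_measurable_pair[of a M L, OF am] by (simp add: split_beta)
  have "(\<lambda>p. ln ((cmod (hyperbolic_GAF L a (fst p) (snd p)))\<^sup>2) - L * hyp_potential (snd p))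
      \<in> borel_measurable (M \<Otimes>\<^sub>M (borel :: (complex ^ 'n) measure))"
    by measurable
  then show ?thesis by (simp add: split_beta cong: measurable_cong_sets)
qed

lemma L1_deviation_measurable:
  fixes a :: "('n::finite \<Rightarrow> nat) \<Rightarrow> 'w \<Rightarrow> complex"
  assumes am: "\<And>\<alpha>. a \<alpha> \<in> borel_measurable M"
  shows "(\<lambda>\<omega>. (\<integral>\<^sup>+z\<in>cball 0 R. ennreal \<bar>log_deviation L a \<omega> z\<bar> \<partial>lborel))
    \<in> borel_measurable M"
proof -
  have [measurable]: "(\<lambda>p. ln ((cmod (hyperbolic_GAF L a (fst p) (snd p)))\<^sup>2) - L * hyp_potential (snd p))
      \<in> borel_measurable (M \<Otimes>\<^sub>M (lborel :: (complex ^ 'n) measure))"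
    using log_deviation_measurable_pair[of a M L, OF am] by (simp add: split_beta)
  have [measurable]: "cball (0 :: complex ^ 'n) R \<in> sets borel" by simp
  have "(\<lambda>p. ennreal \<bar>ln ((cmod (hyperbolic_GAF L a (fst p) (snd p)))\<^sup>2) - L * hyp_potential (snd p)\<bar> * indicator (cball 0 R) (snd p))
      \<in> borel_measurable (M \<Otimes>\<^sub>M (lborel :: (complex ^ 'n) measure))"
    by measurable
  from lborel.borel_measurable_nn_integral_fst[OF this] show ?thesis by simp
qed

text \<open>On the exceptional event A use |v| \<le> N + v^2 / N with N = exp (C L): the first part
  costs N P(A) \<le> 1, since P(A) is superexponentially small, and the second at most 1 by the
  second moment. The complement of A contributes at most half of \<kappa> L by
  concentration.\<close>

lemma L1_concentration_and_mean:
  fixes R \<kappa> :: real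
  assumes R: "0 < R" "R < 1" and \<kappa>: "\<kappa> > 0"
  obtains c L0 where "c > 0" "L0 \<ge> 1"
    "\<And>L (M :: 'w measure) (a :: ('n::finite \<Rightarrow> nat) \<Rightarrow> 'w \<Rightarrow> complex).
      L \<ge> L0 \<Longrightarrow> prob_space M \<Longrightarrow> iid_complex_gaussians M a \<Longrightarrow>
      (\<exists>A\<in>sets M. measure M A \<le> exp (- c * L ^ (CARD('n) + 1)) \<and>
        (\<forall>\<omega>\<in>space M - A. (\<integral>\<^sup>+z\<in>cball 0 R. ennreal \<bar>log_deviation L a \<omega> z\<bar> \<partial>lborel)
          \<le> ennreal (\<kappa> * L))) \<and>
      (\<integral>\<^sup>+\<omega>. (\<integral>\<^sup>+z\<in>cball 0 R. ennreal \<bar>log_deviation L a \<omega> z\<bar> \<partial>lborel) \<partial>M) \<le> ennreal (\<kappa> * L)"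
proof -
  define n where "n = CARD('n)"
  have n: "n \<ge> 1" by (simp add: n_def Suc_leI)
  obtain c L1 where c: "c > 0" and L1: "L1 \<ge> 1" and conc: "\<And>L (M :: 'w measure) (a :: ('n \<Rightarrow> nat) \<Rightarrow> 'w \<Rightarrow> complex).
      L \<ge> L1 \<Longrightarrow> prob_space M \<Longrightarrow> iid_complex_gaussians M a \<Longrightarrow>
      \<exists>A\<in>sets M. measure M A \<le> exp (- c * L ^ (n + 1)) \<and>
        (\<forall>\<omega>\<in>space M - A. (\<integral>\<^sup>+z\<in>cball 0 R. ennreal \<bar>log_deviation L a \<omega> z\<bar> \<partial>lborel)
          \<le> ennreal (\<kappa> / 2 * L))"
    by (rule L1_concentration[where 'n = 'n and 'w = 'w, OF R, of "\<kappa> / 2"]) (use \<kappa> in \<open>simp, unfold n_def, blast\<close>)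
  obtain C where C: "C > 0" and mom: "\<And>L (M :: 'w measure) (a :: ('n \<Rightarrow> nat) \<Rightarrow> 'w \<Rightarrow> complex) z.
      L \<ge> 1 \<Longrightarrow> prob_space M \<Longrightarrow> iid_complex_gaussians M a \<Longrightarrow> norm z \<le> R \<Longrightarrow>
      (\<integral>\<^sup>+\<omega>. ennreal ((log_deviation L a \<omega> z)\<^sup>2) \<partial>M) \<le> ennreal (exp (C * L))"
    by (rule second_moment_bound[where 'n = 'n and 'w = 'w, OF R]) blast
  define V where "V = measure lborel (cball (0 :: complex ^ 'n) R)"
  have V: "emeasure lborel (cball (0 :: complex ^ 'n) R) = ennreal V" "V \<ge> 0"
    using emeasure_lborel_cball_finite[of "0 :: complex ^ 'n" R] by (auto simp: V_def emeasure_eq_ennreal_measure)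
  \<comment> \<open>C / c yields C L \<le> c L^2 \<le> c L^(n+1), as n \<ge> 1; 4 V / \<kappa>
    yields 2 V \<le> \<kappa> L / 2.\<close>
  define L0 where "L0 = max L1 (max (C / c) (4 * V / \<kappa>))"
  have main: "(\<exists>A\<in>sets M. measure M A \<le> exp (- c * L ^ (n + 1)) \<and>
        (\<forall>\<omega>\<in>space M - A. (\<integral>\<^sup>+z\<in>cball 0 R. ennreal \<bar>log_deviation L a \<omega> z\<bar> \<partial>lborel)
          \<le> ennreal (\<kappa> * L))) \<and>
      (\<integral>\<^sup>+\<omega>. (\<integral>\<^sup>+z\<in>cball 0 R. ennreal \<bar>log_deviation L a \<omega> z\<bar> \<partial>lborel) \<partial>M) \<le> ennreal (\<kappa> * L)"
    if L: "L \<ge> L0" and M: "prob_space M" and a: "iid_complex_gaussians M a"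
    for L and M :: "'w measure" and a :: "('n \<Rightarrow> nat) \<Rightarrow> 'w \<Rightarrow> complex"
  proof -
    interpret prob_space M by fact
    interpret P: pair_sigma_finite M "lborel :: (complex ^ 'n) measure" ..
    have LL: "L \<ge> L1" "L \<ge> C / c" "L \<ge> 4 * V / \<kappa>" "L \<ge> 1" using L L1 by (auto simp: L0_def)
    have am: "a \<alpha> \<in> borel_measurable M" for \<alpha>
      using a distributed_measurable[of M lborel "a \<alpha>"] by (auto simp: iid_complex_gaussians_def)
    define v where "v \<omega> z = log_deviation L a \<omega> z" for \<omega> z
    have v_pair: "(\<lambda>(\<omega>, z). v \<omega> z) \<in> borel_measurable (M \<Otimes>\<^sub>M (lborel :: (complex ^ 'n) measure))"
      unfolding v_def by (rule log_deviation_measurable_pair[OF am])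
    then have [measurable]: "(\<lambda>p. v (fst p) (snd p)) \<in> borel_measurable (M \<Otimes>\<^sub>M (lborel :: (complex ^ 'n) measure))"
      by (simp add: split_beta)
    have v_meas: "(\<lambda>\<omega>. v \<omega> z) \<in> borel_measurable M" for z
      using measurable_compose[OF measurable_Pair2'[of z lborel M] v_pair] by simp
    obtain A where A: "A \<in> sets M" "measure M A \<le> exp (- c * L ^ (n + 1))"
      "\<And>\<omega>. \<omega> \<in> space M - A \<Longrightarrow> (\<integral>\<^sup>+z\<in>cball 0 R. ennreal \<bar>v \<omega> z\<bar> \<partial>lborel) \<le> ennreal (\<kappa> / 2 * L)"
      using conc[OF LL(1) M a] unfolding v_def by blast
    define W where "W \<omega> = (\<integral>\<^sup>+z\<in>cball 0 R. ennreal \<bar>v \<omega> z\<bar> \<partial>lborel)" for \<omega>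
    have [measurable]: "cball (0 :: complex ^ 'n) R \<in> sets borel" by simp
    note [measurable] = A(1)
    have W_meas [measurable]: "W \<in> borel_measurable M"
      unfolding W_def v_def by (rule L1_deviation_measurable[OF am])
    have small: "exp (C * L) * measure M A \<le> 1"
    proof -
      have "C \<le> c * L" using LL(2) c by (simp add: field_simps)
      then have "C * L \<le> c * L * L" using LL(4) by (intro mult_right_mono) auto
      also have "c * L * L = c * L ^ 2" by (simp add: power2_eq_square)
      also have "\<dots> \<le> c * L ^ (n + 1)" using c LL(4) n by (intro mult_left_mono power_increasing) auto
      finally have "C * L - c * L ^ (n + 1) \<le> 0" by simp
      have "exp (C * L) * measure M A \<le> exp (C * L) * exp (- c * L ^ (n + 1))" using A(2) by (intro mult_left_mono) auto
      also have "\<dots> = exp (C * L - c * L ^ (n + 1))" by (simp flip: exp_add)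
      also have "\<dots> \<le> 1" using \<open>C * L - c * L ^ (n + 1) \<le> 0\<close> by simp
      finally show ?thesis .
    qed
    have inner: "(\<integral>\<^sup>+\<omega>. ennreal \<bar>v \<omega> z\<bar> * indicator A \<omega> \<partial>M) \<le> 2" if z: "norm z \<le> R" for z
    proof -
      define N where "N = exp (C * L)"
      have N: "N > 0" by (simp add: N_def)
      have "(\<integral>\<^sup>+\<omega>. ennreal \<bar>v \<omega> z\<bar> * indicator A \<omega> \<partial>M)
          \<le> (\<integral>\<^sup>+\<omega>. ennreal N * indicator A \<omega> + ennreal (1 / N) * ennreal ((v \<omega> z)\<^sup>2) \<partial>M)"
      proof (rule nn_integral_mono)
        fix \<omega>
        have "\<bar>v \<omega> z\<bar> \<le> N + (1 / N) * (v \<omega> z)\<^sup>2"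
        proof (cases "\<bar>v \<omega> z\<bar> \<le> N")
          case True
          have "0 \<le> (1 / N) * (v \<omega> z)\<^sup>2" using N by simp
          then show ?thesis using True by linarith
        next
          case False
          then have "N * \<bar>v \<omega> z\<bar> \<le> \<bar>v \<omega> z\<bar> * \<bar>v \<omega> z\<bar>" by (intro mult_right_mono) auto
          then have "\<bar>v \<omega> z\<bar> \<le> (1 / N) * (v \<omega> z)\<^sup>2" using N by (simp add: field_simps power2_eq_square)
          then show ?thesis using N by linarith
        qed
        then have "ennreal \<bar>v \<omega> z\<bar> \<le> ennreal (N + (1 / N) * (v \<omega> z)\<^sup>2)" by (rule ennreal_leI)
        also have "\<dots> = ennreal N + ennreal ((1 / N) * (v \<omega> z)\<^sup>2)" using N by (intro ennreal_plus) auto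
        also have "ennreal ((1 / N) * (v \<omega> z)\<^sup>2) = ennreal (1 / N) * ennreal ((v \<omega> z)\<^sup>2)" using N by (intro ennreal_mult) auto
        finally have "ennreal \<bar>v \<omega> z\<bar> \<le> ennreal N + ennreal (1 / N) * ennreal ((v \<omega> z)\<^sup>2)" .
        then show "ennreal \<bar>v \<omega> z\<bar> * indicator A \<omega> \<le> ennreal N * indicator A \<omega> + ennreal (1 / N) * ennreal ((v \<omega> z)\<^sup>2)"
          by (auto simp: indicator_def)
      qed
      also have "\<dots> = ennreal N * emeasure M A + ennreal (1 / N) * (\<integral>\<^sup>+\<omega>. ennreal ((v \<omega> z)\<^sup>2) \<partial>M)"
        using v_meas[of z] by (subst nn_integral_add) (auto simp: nn_integral_cmult)
      also have "\<dots> \<le> ennreal 1 + ennreal 1"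
      proof (rule add_mono)
        have "ennreal N * emeasure M A = ennreal (N * measure M A)"
          using N by (simp add: emeasure_eq_measure ennreal_mult)
        also have "\<dots> \<le> ennreal 1" using small by (intro ennreal_leI) (simp add: N_def)
        finally show "ennreal N * emeasure M A \<le> ennreal 1" .
        have "ennreal (1 / N) * (\<integral>\<^sup>+\<omega>. ennreal ((v \<omega> z)\<^sup>2) \<partial>M) \<le> ennreal (1 / N) * ennreal N"
          using mom[OF LL(4) M a z] unfolding v_def N_def by (intro mult_left_mono) auto
        also have "\<dots> = ennreal 1" using N by (subst ennreal_mult[symmetric]) auto
        finally show "ennreal (1 / N) * (\<integral>\<^sup>+\<omega>. ennreal ((v \<omega> z)\<^sup>2) \<partial>M) \<le> ennreal 1" .
      qed
      also have "\<dots> = 2" by simp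
      finally show ?thesis .
    qed
    have bad: "(\<integral>\<^sup>+\<omega>. W \<omega> * indicator A \<omega> \<partial>M) \<le> ennreal (\<kappa> / 2 * L)"
    proof -
      have "(\<integral>\<^sup>+\<omega>. W \<omega> * indicator A \<omega> \<partial>M) = (\<integral>\<^sup>+\<omega>. \<integral>\<^sup>+z. (ennreal \<bar>v \<omega> z\<bar> * indicator (cball 0 R) z) * indicator A \<omega> \<partial>lborel \<partial>M)"
      proof (rule nn_integral_cong)
        fix \<omega> assume "\<omega> \<in> space M"
        then have [measurable]: "v \<omega> \<in> borel_measurable lborel"
          using measurable_compose[OF measurable_Pair1'[of \<omega> M lborel] v_pair] by simp
        show "W \<omega> * indicator A \<omega> = (\<integral>\<^sup>+z. (ennreal \<bar>v \<omega> z\<bar> * indicator (cball 0 R) z) * indicator A \<omega> \<partial>lborel)"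
          unfolding W_def by (rule nn_integral_multc[symmetric]) measurable
      qed
      also have "\<dots> = (\<integral>\<^sup>+z. \<integral>\<^sup>+\<omega>. (ennreal \<bar>v \<omega> z\<bar> * indicator (cball 0 R) z) * indicator A \<omega> \<partial>M \<partial>lborel)"
        by (rule P.Fubini'[symmetric]) (simp add: split_beta)
      also have "\<dots> \<le> (\<integral>\<^sup>+z. 2 * indicator (cball (0 :: complex ^ 'n) R) z \<partial>lborel)"
      proof (rule nn_integral_mono)
        fix z :: "complex ^ 'n"
        show "(\<integral>\<^sup>+\<omega>. (ennreal \<bar>v \<omega> z\<bar> * indicator (cball 0 R) z) * indicator A \<omega> \<partial>M) \<le> 2 * indicator (cball 0 R) z"
          using inner[of z] by (cases "z \<in> cball 0 R") auto
      qed
      also have "\<dots> = 2 * ennreal V" using V by (simp add: nn_integral_cmult_indicator)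
      also have "\<dots> = ennreal (2 * V)" using V by (simp add: ennreal_mult)
      also have "\<dots> \<le> ennreal (\<kappa> / 2 * L)" using LL(3) \<kappa> by (intro ennreal_leI) (simp add: field_simps)
      finally show ?thesis .
    qed
    have good: "(\<integral>\<^sup>+\<omega>. W \<omega> * indicator (space M - A) \<omega> \<partial>M) \<le> ennreal (\<kappa> / 2 * L)"
    proof -
      have "(\<integral>\<^sup>+\<omega>. W \<omega> * indicator (space M - A) \<omega> \<partial>M) \<le> (\<integral>\<^sup>+\<omega>. ennreal (\<kappa> / 2 * L) \<partial>M)"
        by (rule nn_integral_mono) (use A(3) in \<open>auto simp: W_def indicator_def\<close>)
      then show ?thesis by (simp add: emeasure_space_1)
    qed
    have "(\<integral>\<^sup>+\<omega>. W \<omega> \<partial>M) = (\<integral>\<^sup>+\<omega>. W \<omega> * indicator A \<omega> + W \<omega> * indicator (space M - A) \<omega> \<partial>M)"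
      by (rule nn_integral_cong) (auto simp: indicator_def)
    also have "\<dots> = (\<integral>\<^sup>+\<omega>. W \<omega> * indicator A \<omega> \<partial>M) + (\<integral>\<^sup>+\<omega>. W \<omega> * indicator (space M - A) \<omega> \<partial>M)"
      by (rule nn_integral_add) measurable
    also have "\<dots> \<le> ennreal (\<kappa> / 2 * L) + ennreal (\<kappa> / 2 * L)" by (rule add_mono[OF bad good])
    also have "\<dots> = ennreal (\<kappa> * L)"
      using \<kappa> LL by (subst ennreal_plus[symmetric]) auto
    finally have mean: "(\<integral>\<^sup>+\<omega>. W \<omega> \<partial>M) \<le> ennreal (\<kappa> * L)" .
    have "W \<omega> \<le> ennreal (\<kappa> * L)" if "\<omega> \<in> space M - A" for \<omega>
    proof -
      have "W \<omega> \<le> ennreal (\<kappa> / 2 * L)" using A(3)[OF that] by (simp add: W_def)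
      also have "\<dots> \<le> ennreal (\<kappa> * L)" using \<kappa> LL(4) by (intro ennreal_leI) simp
      finally show ?thesis .
    qed
    then show ?thesis using A(1,2) mean unfolding W_def v_def by blast
  qed
  show ?thesis
  proof (rule that[of c L0])
    show "c > 0" by fact
    show "L0 \<ge> 1" using L1 by (simp add: L0_def)
  qed (use main in \<open>simp add: n_def\<close>)
qed

section \<open>Comparison of the statistic with its leading term\<close>

text \<open>If v is integrable on \<open>cball 0 R\<close>, the difference is the integral of v
  against the density of the current. Otherwise the right-hand side is infinite, since B > 0. So the
  bound holds at every outcome, and it can be integrated to compare the means.\<close>

lemma lin_stat_deviation:
  fixes \<phi> :: "'n::{finite,linorder} form"
  assumes \<phi>: "smooth_form \<phi>" "of_bidegree (CARD('n) - 1) (CARD('n) - 1) \<phi>"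
    and K: "compact K" "K \<subseteq> cball 0 R" "R < 1" "\<And>z I J. z \<notin> K \<Longrightarrow> \<phi> z I J = 0"
    and B: "B > 0" "\<And>z. cmod (current_density \<phi> z) \<le> B"
  shows "ennreal (cmod (lin_stat L a \<phi> \<omega> - of_real L * form_integral unit_ball (wedge \<phi> bergman_form)))
    \<le> ennreal B * (\<integral>\<^sup>+z\<in>cball 0 R. ennreal \<bar>log_deviation L a \<omega> z\<bar> \<partial>lborel)"
proof (cases "(\<integral>\<^sup>+z\<in>cball 0 R. ennreal \<bar>log_deviation L a \<omega> z\<bar> \<partial>lborel) = \<infinity>")
  case True
  then show ?thesis using B by (simp add: ennreal_mult_top)
next
  case False
  let ?\<Psi> = "current_density \<phi>"
  define f where "f = hyperbolic_GAF L a \<omega>"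
  have [measurable]: "f \<in> borel_measurable borel" by (simp add: f_def hyperbolic_GAF_def[abs_def])
  define v where "v z = ln ((cmod (f z))\<^sup>2) - L * hyp_potential z" for z :: "complex ^ 'n::{finite,linorder}"
  have [measurable]: "v \<in> borel_measurable borel" unfolding v_def by measurable
  define W where "W = (\<integral>\<^sup>+z\<in>cball 0 R. ennreal \<bar>v z\<bar> \<partial>lborel)"
  have [measurable]: "cball (0 :: complex ^ 'n::{finite,linorder}) R \<in> sets borel" by simp
  have K_ball: "K \<subseteq> unit_ball" using K(2,3) by auto
  have \<Psi>_cont: "continuous_on UNIV ?\<Psi>" by (rule current_density_continuous[OF \<phi>(1)])
  have \<Psi>0: "?\<Psi> z = 0" if "z \<notin> K" for z
    using current_density_zero_off_support[of K \<phi> z] compact_imp_closed[OF K(1)] K(4) that by simp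
  have [measurable]: "?\<Psi> \<in> borel_measurable borel" by (rule borel_measurable_continuous_onI[OF \<Psi>_cont])
  have psi_cont: "continuous_on (ball 0 1) (\<lambda>w :: complex ^ 'n::{finite,linorder}. complex_of_real (hyp_potential w))"
    by (intro continuous_at_imp_continuous_on ballI has_derivative_continuous[OF has_derivative_hyp_potential]) simp
  have psi_int: "integrable lborel (\<lambda>z. ?\<Psi> z * of_real (hyp_potential z))"
    using continuous_mult_compact_support(2)[of ?\<Psi> K "ball 0 1"] \<Psi>_cont K(1) \<Psi>0 K_ball psi_cont by simp
  have full: "(LINT z:unit_ball|lborel. h z) = (\<integral>z. h z \<partial>lborel)" if "\<And>z. z \<notin> K \<Longrightarrow> h z = 0"
    for h :: "complex ^ 'n::{finite,linorder} \<Rightarrow> complex"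
    unfolding set_lebesgue_integral_def
  proof (rule Bochner_Integration.integral_cong[OF refl])
    fix x show "indicat_real unit_ball x *\<^sub>R h x = h x"
      using subsetD[OF K_ball, of x] that[of x] by (cases "x \<in> K") (auto simp: indicator_def)
  qed
  have nn: "(\<integral>\<^sup>+z. ennreal (cmod (of_real (v z) * ?\<Psi> z)) \<partial>lborel) \<le> ennreal B * W"
  proof -
    have "(\<integral>\<^sup>+z. ennreal (cmod (of_real (v z) * ?\<Psi> z)) \<partial>lborel) \<le> (\<integral>\<^sup>+z. ennreal B * (ennreal \<bar>v z\<bar> * indicator (cball 0 R) z) \<partial>lborel)"
    proof (rule nn_integral_mono)
      fix z
      show "ennreal (cmod (of_real (v z) * ?\<Psi> z)) \<le> ennreal B * (ennreal \<bar>v z\<bar> * indicator (cball 0 R) z)"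
      proof (cases "z \<in> K")
        case True
        have "cmod (of_real (v z) * ?\<Psi> z) \<le> B * \<bar>v z\<bar>"
          using mult_left_mono[OF B(2)[of z], of "\<bar>v z\<bar>"] by (simp add: norm_mult mult.commute)
        then have "ennreal (cmod (of_real (v z) * ?\<Psi> z)) \<le> ennreal (B * \<bar>v z\<bar>)" by (rule ennreal_leI)
        then show ?thesis using B(1) subsetD[OF K(2) True] by (simp add: ennreal_mult)
      qed (simp add: \<Psi>0)
    qed
    also have "\<dots> = ennreal B * W"
      unfolding W_def by (rule nn_integral_cmult) measurable
    finally show ?thesis .
  qed
  have v_int: "integrable lborel (\<lambda>z. of_real (v z) * ?\<Psi> z)"
  proof (rule integrableI_bounded)
    have "ennreal B * W < \<infinity>" using False by (simp add: W_def v_def f_def ennreal_mult_less_top less_top)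
    with nn show "(\<integral>\<^sup>+z. ennreal (cmod (of_real (v z) * ?\<Psi> z)) \<partial>lborel) < \<infinity>" by (rule le_less_trans)
  qed measurable
  have "lin_stat L a \<phi> \<omega> = (LINT z:unit_ball|lborel. of_real (ln ((cmod (f z))\<^sup>2)) * ?\<Psi> z)"
    by (simp add: lin_stat_def zero_current_eq_integral f_def)
  also have "\<dots> = (\<integral>z. of_real (ln ((cmod (f z))\<^sup>2)) * ?\<Psi> z \<partial>lborel)"
    by (rule full) (simp add: \<Psi>0)
  also have "\<dots> = (\<integral>z. of_real (v z) * ?\<Psi> z + of_real L * (?\<Psi> z * of_real (hyp_potential z)) \<partial>lborel)"
    by (rule Bochner_Integration.integral_cong) (simp_all add: v_def algebra_simps)
  also have "\<dots> = (\<integral>z. of_real (v z) * ?\<Psi> z \<partial>lborel) + of_real L * (\<integral>z. ?\<Psi> z * of_real (hyp_potential z) \<partial>lborel)"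
    using v_int psi_int by simp
  also have "(\<integral>z. ?\<Psi> z * of_real (hyp_potential z) \<partial>lborel) = form_integral unit_ball (wedge \<phi> bergman_form)"
  proof -
    have "form_integral unit_ball (wedge \<phi> bergman_form) = (LINT z:unit_ball|lborel. of_real (hyp_potential z) * ?\<Psi> z)"
      using form_integral_wedge_bergman[of \<phi> K] \<phi> K(1) K_ball K(4) by simp
    then show ?thesis
      using full[of "\<lambda>z. of_real (hyp_potential z) * ?\<Psi> z"] \<Psi>0 by (simp add: mult.commute)
  qed
  finally have "lin_stat L a \<phi> \<omega> - of_real L * form_integral unit_ball (wedge \<phi> bergman_form) = (\<integral>z. of_real (v z) * ?\<Psi> z \<partial>lborel)"
    by simp
  then have "ennreal (cmod (lin_stat L a \<phi> \<omega> - of_real L * form_integral unit_ball (wedge \<phi> bergman_form)))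
      \<le> (\<integral>\<^sup>+z. ennreal (cmod (of_real (v z) * ?\<Psi> z)) \<partial>lborel)"
    using integral_norm_bound_ennreal[OF v_int] by simp
  also have "\<dots> \<le> ennreal B * W" by (rule nn)
  finally show ?thesis by (simp add: W_def v_def f_def)
qed

lemma lin_stat_measurable:
  fixes \<phi> :: "'n::{finite,linorder} form" and a :: "('n \<Rightarrow> nat) \<Rightarrow> 'w \<Rightarrow> complex"
  assumes \<phi>: "smooth_form \<phi>" and a: "\<And>\<alpha>. a \<alpha> \<in> borel_measurable M"
  shows "lin_stat L a \<phi> \<in> borel_measurable M"
proof -
  have [measurable]: "current_density \<phi> \<in> borel_measurable borel"
    by (rule borel_measurable_continuous_onI[OF current_density_continuous[OF \<phi>]])
  have [measurable]: "(\<lambda>p. hyperbolic_GAF L a (fst p) (snd p)) \<in> borel_measurable (M \<Otimes>\<^sub>M (borel :: (complex ^ 'n::{finite,linorder}) measure))"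
    using hyperbolic_GAF_measurable_pair[of a M L, OF a] by (simp add: split_beta)
  have [measurable]: "unit_ball \<in> sets (borel :: (complex ^ 'n::{finite,linorder}) measure)" by simp
  have "(\<lambda>p. indicat_real unit_ball (snd p) *\<^sub>R (of_real (ln ((cmod (hyperbolic_GAF L a (fst p) (snd p)))\<^sup>2)) * current_density \<phi> (snd p)))
      \<in> borel_measurable (M \<Otimes>\<^sub>M (borel :: (complex ^ 'n::{finite,linorder}) measure))"
    by measurable
  then have "(\<lambda>(\<omega>, z). indicat_real unit_ball z *\<^sub>R (of_real (ln ((cmod (hyperbolic_GAF L a \<omega> z))\<^sup>2)) * current_density \<phi> z))
      \<in> borel_measurable (M \<Otimes>\<^sub>M (lborel :: (complex ^ 'n::{finite,linorder}) measure))"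
    by (simp add: split_beta cong: measurable_cong_sets)
  from lborel.borel_measurable_lebesgue_integral[OF this] show ?thesis
    by (simp add: lin_stat_def[abs_def] zero_current_eq_integral set_lebesgue_integral_def)
qed

text \<open>The nonvanishing of the integral of \<phi> \<and> \<omega> makes the mean of order L,
  which sets the scale of the deviations. The constants are chosen before the probability measure
  and the coefficients, hence are uniform in them.\<close>

theorem theorem2:
  fixes \<phi> :: "'n::{finite,linorder} form" and \<delta> :: real
  assumes "smooth_form \<phi>"
    and "of_bidegree (CARD('n) - 1) (CARD('n) - 1) \<phi>"
    and "compactly_supported_in unit_ball \<phi>"
    and "form_integral unit_ball (wedge \<phi> bergman_form) \<noteq> 0"
    and "\<delta> > 0"
  shows "\<exists>c>0. \<exists>L\<^sub>0>0. \<forall>L\<ge>L\<^sub>0.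
    \<forall>(M :: 'w measure) (a :: ('n \<Rightarrow> nat) \<Rightarrow> 'w \<Rightarrow> complex).
      prob_space M \<longrightarrow> iid_complex_gaussians M a \<longrightarrow>
      measure M {x \<in> space M.
          cmod (lin_stat L a \<phi> x - (\<integral>y. lin_stat L a \<phi> y \<partial>M))
            > \<delta> * cmod (\<integral>y. lin_stat L a \<phi> y \<partial>M)}
        \<le> exp (- c * L ^ (CARD('n) + 1))"
proof -
  obtain K where K: "compact K" "K \<subseteq> unit_ball" "\<And>z I J. z \<notin> K \<Longrightarrow> \<phi> z I J = 0"
    using assms(3) unfolding compactly_supported_in_def by blast
  obtain R where R: "0 < R" "R < 1" "K \<subseteq> cball 0 R"
  proof (cases "K = {}")
    case True
    then show ?thesis using that[of "1/2"] by simp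
  next
    case False
    obtain x where x: "x \<in> K" "\<And>y. y \<in> K \<Longrightarrow> norm y \<le> norm x"
      using continuous_attains_sup[OF K(1) False, of norm] continuous_on_norm_id by blast
    show ?thesis
    \<comment> \<open>The floor 1/2 keeps R positive when K is {0}.\<close>
    proof (rule that[of "max (1/2) (norm x)"])
      show "max (1/2) (norm x) < 1" using x(1) K(2) by auto
      show "K \<subseteq> cball 0 (max (1/2) (norm x))" using x(2) by force
    qed simp
  qed
  obtain B where B: "B > 0" "\<And>z. cmod (current_density \<phi> z) \<le> B"
  proof -
    have "compact (current_density \<phi> ` K)"
      by (intro compact_continuous_image K(1) continuous_on_subset[OF current_density_continuous[OF assms(1)]]) auto
    then obtain B where B: "B > 0" "\<forall>y\<in>current_density \<phi> ` K. norm y \<le> B"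
      using compact_imp_bounded bounded_pos by blast
    have "cmod (current_density \<phi> z) \<le> B" for z
      using B current_density_zero_off_support[of K \<phi> z] compact_imp_closed[OF K(1)] K(3) by (cases "z \<in> K") auto
    then show ?thesis using that B(1) by blast
  qed
  define \<mu> where "\<mu> = form_integral unit_ball (wedge \<phi> bergman_form)"
  have \<mu>: "cmod \<mu> > 0" using assms(4) by (simp add: \<mu>_def)
  \<comment> \<open>Off the exceptional event the statistic, and in any case its mean, is then
    within |\<mu>| L min(1, \<delta>) / 8 of L \<mu>. The minimum with 1 keeps the modulus of the
    mean above 7/8 of |\<mu>| L, and 2/8 \<le> 7/8 closes the estimate.\<close>
  define \<kappa> where "\<kappa> = cmod \<mu> * min 1 \<delta> / (8 * B)"
  have \<kappa>: "\<kappa> > 0" "B * \<kappa> = cmod \<mu> * min 1 \<delta> / 8" using \<mu> B assms(5) by (auto simp: \<kappa>_def)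
  obtain c L0 where c: "c > 0" "L0 \<ge> 1" and conc: "\<And>L (M :: 'w measure) (a :: ('n \<Rightarrow> nat) \<Rightarrow> 'w \<Rightarrow> complex).
      L \<ge> L0 \<Longrightarrow> prob_space M \<Longrightarrow> iid_complex_gaussians M a \<Longrightarrow>
      (\<exists>A\<in>sets M. measure M A \<le> exp (- c * L ^ (CARD('n) + 1)) \<and>
        (\<forall>\<omega>\<in>space M - A. (\<integral>\<^sup>+z\<in>cball 0 R. ennreal \<bar>log_deviation L a \<omega> z\<bar> \<partial>lborel)
          \<le> ennreal (\<kappa> * L))) \<and>
      (\<integral>\<^sup>+\<omega>. (\<integral>\<^sup>+z\<in>cball 0 R. ennreal \<bar>log_deviation L a \<omega> z\<bar> \<partial>lborel) \<partial>M) \<le> ennreal (\<kappa> * L)"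
    by (rule L1_concentration_and_mean[where 'n = 'n and 'w = 'w, OF R(1,2) \<kappa>(1)]) blast
  have "measure M {x \<in> space M. cmod (lin_stat L a \<phi> x - (\<integral>y. lin_stat L a \<phi> y \<partial>M)) > \<delta> * cmod (\<integral>y. lin_stat L a \<phi> y \<partial>M)}
        \<le> exp (- c * L ^ (CARD('n) + 1))"
    if L: "L \<ge> L0" and M: "prob_space M" and a: "iid_complex_gaussians M a"
    for L and M :: "'w measure" and a :: "('n \<Rightarrow> nat) \<Rightarrow> 'w \<Rightarrow> complex"
  proof -
    interpret prob_space M by fact
    have L1: "L \<ge> 1" using L c by simp
    have am: "a \<alpha> \<in> borel_measurable M" for \<alpha>
      using a distributed_measurable[of M lborel "a \<alpha>"] by (auto simp: iid_complex_gaussians_def)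
    define W where "W \<omega> = (\<integral>\<^sup>+z\<in>cball 0 R. ennreal \<bar>log_deviation L a \<omega> z\<bar> \<partial>lborel)" for \<omega>
    obtain A where A: "A \<in> sets M" "measure M A \<le> exp (- c * L ^ (CARD('n) + 1))"
      "\<And>\<omega>. \<omega> \<in> space M - A \<Longrightarrow> W \<omega> \<le> ennreal (\<kappa> * L)" and mean: "(\<integral>\<^sup>+\<omega>. W \<omega> \<partial>M) \<le> ennreal (\<kappa> * L)"
      using conc[OF L M a] unfolding W_def by blast
    define I where "I = lin_stat L a \<phi>"
    have [measurable]: "I \<in> borel_measurable M" unfolding I_def by (rule lin_stat_measurable[OF assms(1) am])
    have dev: "ennreal (cmod (I \<omega> - of_real L * \<mu>)) \<le> ennreal B * W \<omega>" for \<omega>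
      unfolding I_def \<mu>_def W_def by (rule lin_stat_deviation[OF assms(1,2) K(1) R(3,2) K(3) B])
    have BL: "ennreal B * ennreal (\<kappa> * L) = ennreal (B * \<kappa> * L)"
      using B \<kappa> L1 by (simp add: ennreal_mult mult.assoc)
    have BL0: "B * \<kappa> * L \<ge> 0" using B \<kappa> L1 by simp
    have good: "cmod (I \<omega> - of_real L * \<mu>) \<le> B * \<kappa> * L" if "\<omega> \<in> space M - A" for \<omega>
    proof -
      have "ennreal (cmod (I \<omega> - of_real L * \<mu>)) \<le> ennreal B * ennreal (\<kappa> * L)"
        by (rule order_trans[OF dev]) (intro mult_left_mono A(3) that, simp)
      then show ?thesis using BL0 by (simp add: BL)
    qed
    have mean_dev: "(\<integral>\<^sup>+\<omega>. ennreal (cmod (I \<omega> - of_real L * \<mu>)) \<partial>M) \<le> ennreal (B * \<kappa> * L)"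
    proof -
      have W_meas: "W \<in> borel_measurable M" unfolding W_def by (rule L1_deviation_measurable[OF am])
      have "(\<integral>\<^sup>+\<omega>. ennreal (cmod (I \<omega> - of_real L * \<mu>)) \<partial>M) \<le> (\<integral>\<^sup>+\<omega>. ennreal B * W \<omega> \<partial>M)"
        by (rule nn_integral_mono) (rule dev)
      also have "\<dots> = ennreal B * (\<integral>\<^sup>+\<omega>. W \<omega> \<partial>M)" by (rule nn_integral_cmult[OF W_meas])
      also have "\<dots> \<le> ennreal B * ennreal (\<kappa> * L)" by (intro mult_left_mono mean) simp
      finally show ?thesis by (simp add: BL)
    qed
    \<comment> \<open>Integrability must be shown, since the Bochner integral of a non-integrable
      function is 0 by default and not a mean; it follows from the finite mean deviation.\<close>
    have int: "integrable M (\<lambda>\<omega>. I \<omega> - of_real L * \<mu>)"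
      by (rule integrableI_bounded) (use mean_dev in \<open>auto intro: le_less_trans\<close>)
    then have intI: "integrable M I"
      using Bochner_Integration.integrable_add[OF int, of "\<lambda>_. of_real L * \<mu>"] by simp
    define EI where "EI = (\<integral>y. I y \<partial>M)"
    have "(\<integral>\<omega>. I \<omega> - of_real L * \<mu> \<partial>M) = EI - of_real L * \<mu>"
      using intI by (simp add: EI_def prob_space)
    then have EI: "cmod (EI - of_real L * \<mu>) \<le> B * \<kappa> * L"
      using integral_norm_bound_ennreal[OF int] mean_dev BL0 by (metis ennreal_le_iff order_trans)
    have "{x \<in> space M. cmod (I x - EI) > \<delta> * cmod EI} \<subseteq> A"
    proof
      fix x assume x: "x \<in> {x \<in> space M. cmod (I x - EI) > \<delta> * cmod EI}"
      show "x \<in> A"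
      proof (rule ccontr)
        assume "x \<notin> A"
        then have 1: "cmod (I x - of_real L * \<mu>) \<le> B * \<kappa> * L" using good x by auto
        have "cmod (I x - EI) \<le> cmod (I x - of_real L * \<mu>) + cmod (EI - of_real L * \<mu>)"
          using norm_triangle_ineq4[of "I x - of_real L * \<mu>" "EI - of_real L * \<mu>"] by simp
        also have "\<dots> \<le> 2 * (B * \<kappa> * L)" using 1 EI by simp
        also have "\<dots> \<le> \<delta> * cmod EI"
        proof -
          define m where "m = min 1 \<delta>"
          have m: "0 < m" "m \<le> 1" "m \<le> \<delta>" using assms(5) by (auto simp: m_def)
          define X where "X = cmod \<mu> * L"
          have X: "X > 0" using \<mu> L1 by (simp add: X_def)
          have BX: "B * \<kappa> * L = X * m / 8" by (simp add: \<kappa>(2) X_def m_def)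
          have "cmod (of_real L * \<mu>) = X" using L1 by (simp add: norm_mult X_def)
          then have "X \<le> cmod EI + X * m / 8"
            using norm_triangle_ineq4[of EI "EI - of_real L * \<mu>"] EI by (simp add: BX)
          moreover have "X * m \<le> X" using X m by (simp add: mult_left_le)
          ultimately have E: "cmod EI \<ge> X * (7 / 8)" by simp
          have "2 * (X * m / 8) \<le> m * (X * (7 / 8))" using X m by simp
          also have "\<dots> \<le> \<delta> * cmod EI" using m E X by (intro mult_mono) auto
          finally show ?thesis by (simp add: BX)
        qed
        finally show False using x by simp
      qed
    qed
    then have "measure M {x \<in> space M. cmod (I x - EI) > \<delta> * cmod EI} \<le> measure M A"
      using A(1) by (rule finite_measure_mono)
    then show ?thesis using A(2) unfolding I_def EI_def by linarith
  qed
  then show ?thesis using c by (intro exI[of _ c] conjI exI[of _ L0]) auto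
qed

end
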